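(* For $\tilde{\mathbb{P}}$-almost every $\omega$, the discrete probability distribution $\mu_t$ on $\mathbb{R}$ which gives to the point $y$ the mass $$\mu_t(y)=\begin{cases}p(t,\sqrt{t}\,y;\omega)&\text{if } y\in t^{-1/2}\mathbb{Z},\\ 0&\text{otherwise},\end{cases}$$ converges weakly to the standard normal distribution as $t\to\infty$ (through the positive integers).
   Context: Environment. Let $\{v(0,k):k\in\mathbb{Z}\}$ be i.i.d. Poisson(1) random variables. For each $k\in\mathbb{Z}$ and $1\le i\le v(0,k)$ let $S^{(k,i)}=(S^{(k,i)}(t))_{t\in\mathbb{Z}}$ be a two-sided symmetric nearest-neighbour simple random walk on $\mathbb{Z}$ with $S^{(k,i)}(0)=k$, all these walks being independent. For $(t,y)\in\mathbb{Z}^2$ put $e^{+}(t,y)=\#\{(k,i):S^{(k,i)}(t)=y,\ S^{(k,i)}(t+1)=y+1\}$, $e^{-}(t,y)=\#\{(k,i):S^{(k,i)}(t)=y,\ S^{(k,i)}(t+1)=y-1\}$, and $v(t,y)=\#\{(k,i):S^{(k,i)}(t)=y\}=e^+(t,y)+e^-(t,y)$; also $v(t,y)=e^+(t-1,y-1)+e^-(t-1,y+1)$. The environment is $\omega=\{(e^+(t,y),e^-(t,y)):(t,y)\in\mathbb{Z}^2\}$, an element of $\Omega=(\mathbb{Z}_{\ge 0}^2)^{\mathbb{Z}^2}$ with product sigma-field $\mathcal{G}$. Let $\mathbb{P}$ be the law of $\omega$ on $(\Omega,\mathcal{G})$, with expectation $\mathbb{E}$, and let $\tilde{\mathbb{P}}(A)=\mathbb{E}(v(0,0)\mathbf{1}_A)$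 for $A\in\mathcal{G}$; this is a probability measure with $\tilde{\mathbb{P}}(v(0,0)>0)=1$. Random mass splitting. For $\omega$ with $v(0,0)>0$, the mass distribution is defined by $p(0,0;\omega)=1$, $p(0,y;\omega)=0$ for $y\ne0$, and for integers $t\ge0$ and $y\in\mathbb{Z}$, $$p(t+1,y;\omega)=p(t,y+1;\omega)\frac{e^-(t,y+1)}{v(t,y+1)}+p(t,y-1;\omega)\frac{e^+(t,y-1)}{v(t,y-1)},$$ where a term whose denominator (and hence numerator) vanishes is taken to be $0$. For each $t$, $\sum_y p(t,y;\omega)=1$. *)

theory Defs
  imports "HOL-Probability.Probability"
begin

type_synonym environment = "int \<times> int \<Rightarrow> nat \<times> nat"

text \<open>A configuration consists of the initial particle numbers \<open>N k\<close> and of the steps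
  \<open>X (k, i) s\<close> which the \<open>i\<close>-th walk started from \<open>k\<close> makes between the times \<open>s\<close> and \<open>s + 1\<close>,
  for all \<open>s\<close> in \<open>\<int>\<close>. Walks with index \<open>i = 0\<close> or \<open>i > N k\<close> are present but never used.\<close>

type_synonym config = "(int \<Rightarrow> nat) \<times> (int \<times> nat \<Rightarrow> int \<Rightarrow> int)"

definition config_measure :: "config measure" where
  "config_measure =
     (\<Pi>\<^sub>M k\<in>UNIV. measure_pmf (poisson_pmf 1)) \<Otimes>\<^sub>M
     (\<Pi>\<^sub>M ki\<in>UNIV. \<Pi>\<^sub>M s\<in>UNIV. measure_pmf (pmf_of_set {-1, 1}))"

text \<open>The two-sided walk: for \<open>t \<ge> 0\<close> only the first sum is nonempty, for \<open>t \<le> 0\<close> only the second.\<close>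

definition two_sided_walk :: "int \<Rightarrow> (int \<Rightarrow> int) \<Rightarrow> int \<Rightarrow> int" where
  "two_sided_walk k x t = k + (\<Sum>s\<in>{0..<t}. x s) - (\<Sum>s\<in>{t..<0}. x s)"

definition walk :: "config \<Rightarrow> int \<Rightarrow> nat \<Rightarrow> int \<Rightarrow> int" where
  "walk c k i t = two_sided_walk k (snd c (k, i)) t"

text \<open>The set below is infinite only on a null event (some step is not \<open>\<plusminus>1\<close>), where \<open>card\<close>
  returns \<open>0\<close>.\<close>

definition crossings :: "config \<Rightarrow> int \<Rightarrow> int \<Rightarrow> int \<Rightarrow> nat" where
  "crossings c t y z = card {(k, i). 1 \<le> i \<and> i \<le> fst c k \<and> walk c k i t = y \<and> walk c k i (t + 1) = z}"

definition environment_of :: "config \<Rightarrow> environment" where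
  "environment_of c = (\<lambda>(t, y). (crossings c t y (y + 1), crossings c t y (y - 1)))"

definition environment_space :: "environment measure" where
  "environment_space = (\<Pi>\<^sub>M ty\<in>UNIV. count_space UNIV)"

definition env_law :: "environment measure" where
  "env_law = distr config_measure environment_space environment_of"

definition e_plus :: "environment \<Rightarrow> int \<Rightarrow> int \<Rightarrow> nat" where
  "e_plus \<omega> t y = fst (\<omega> (t, y))"

definition e_minus :: "environment \<Rightarrow> int \<Rightarrow> int \<Rightarrow> nat" where
  "e_minus \<omega> t y = snd (\<omega> (t, y))"

definition visits :: "environment \<Rightarrow> int \<Rightarrow> int \<Rightarrow> nat" where
  "visits \<omega> t y = e_plus \<omega> t y + e_minus \<omega> t y"

definition env_law_tilde :: "environment measure" where
  "env_law_tilde = density env_law (\<lambda>\<omega>. of_nat (visits \<omega> 0 0))"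

text \<open>Terms with vanishing denominator are \<open>0\<close> because \<open>x / 0 = 0\<close>.\<close>

fun mass :: "environment \<Rightarrow> nat \<Rightarrow> int \<Rightarrow> real" where
  "mass \<omega> 0 y = (if y = 0 then 1 else 0)"
| "mass \<omega> (Suc t) y =
     mass \<omega> t (y + 1) * (real (e_minus \<omega> (int t) (y + 1)) / real (visits \<omega> (int t) (y + 1)))
   + mass \<omega> t (y - 1) * (real (e_plus \<omega> (int t) (y - 1)) / real (visits \<omega> (int t) (y - 1)))"

definition rescaled_mass :: "environment \<Rightarrow> nat \<Rightarrow> real \<Rightarrow> real" where
  "rescaled_mass \<omega> t y = (if sqrt t * y \<in> \<int> then mass \<omega> t \<lfloor>sqrt t * y\<rfloor> else 0)"

text \<open>The discrete measure with these point masses, restricted to the Borel sets; for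
  \<open>t > 0\<close> and almost every \<open>\<omega>\<close> it is a probability distribution.\<close>

definition mass_distribution :: "environment \<Rightarrow> nat \<Rightarrow> real measure" where
  "mass_distribution \<omega> t = distr (point_measure UNIV (\<lambda>y. ennreal (rescaled_mass \<omega> t y))) borel (\<lambda>y. y)"

lemma space_config_measure [simp]: "space config_measure = UNIV"
  by (simp add: config_measure_def space_pair_measure space_PiM PiE_UNIV_domain)

lemma prob_space_config_measure: "prob_space config_measure"
  unfolding config_measure_def
  by (intro prob_space_pair prob_space_PiM measure_pmf.prob_space_axioms)

lemma measurable_count [measurable]: "(\<lambda>c. fst c k) \<in> measurable config_measure (count_space UNIV)"
proof -
  have "(\<lambda>f. f k) \<in> measurable (\<Pi>\<^sub>M k\<in>(UNIV::int set). measure_pmf (poisson_pmf 1)) (measure_pmf (poisson_pmf 1))"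
    by (rule measurable_component_singleton) simp
  then have "(\<lambda>c. fst c k) \<in> measurable config_measure (measure_pmf (poisson_pmf 1))"
    unfolding config_measure_def by (rule measurable_compose[OF measurable_fst])
  then show ?thesis by simp
qed

lemma measurable_step [measurable]:
  "(\<lambda>c. snd c ki s) \<in> measurable config_measure (count_space UNIV)"
proof -
  let ?M = "measure_pmf (pmf_of_set {-1, 1::int})"
  have 1: "(\<lambda>f. f s) \<in> measurable (\<Pi>\<^sub>M s\<in>(UNIV::int set). ?M) ?M"
    by (rule measurable_component_singleton) simp
  have 2: "(\<lambda>f. f ki) \<in> measurable (\<Pi>\<^sub>M ki\<in>(UNIV::(int\<times>nat) set). \<Pi>\<^sub>M s\<in>(UNIV::int set). ?M) (\<Pi>\<^sub>M s\<in>(UNIV::int set). ?M)"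
    by (rule measurable_component_singleton) simp
  have "(\<lambda>c. snd c ki s) \<in> measurable config_measure ?M"
    unfolding config_measure_def
    by (rule measurable_compose[OF measurable_compose[OF measurable_snd 2] 1])
  then show ?thesis by simp
qed

lemma measurable_sum_int:
  fixes f :: "'i \<Rightarrow> 'a \<Rightarrow> int"
  assumes "\<And>i. f i \<in> measurable M (count_space UNIV)" "finite A"
  shows "(\<lambda>x. \<Sum>i\<in>A. f i x) \<in> measurable M (count_space UNIV)"
  using assms(2)
proof (induction A rule: finite_induct)
  case (insert i A)
  note [measurable] = insert.IH assms(1)
  have "(\<lambda>x. f i x + (\<Sum>i\<in>A. f i x)) \<in> measurable M (count_space UNIV)"
    by measurable
  then show ?case using insert by simp
qed simp

lemma measurable_walk [measurable]: "(\<lambda>c. walk c k i t) \<in> measurable config_measure (count_space UNIV)"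
proof -
  note [measurable] = measurable_sum_int[where M = config_measure]
  have [measurable]: "(\<lambda>c. \<Sum>s\<in>A. snd c (k, i) s) \<in> measurable config_measure (count_space UNIV)"
    if "finite A" for A
    using that by (intro measurable_sum_int) measurable
  have "(\<lambda>c. k + (\<Sum>s\<in>{0..<t}. snd c (k, i) s) - (\<Sum>s\<in>{t..<0}. snd c (k, i) s))
      \<in> measurable config_measure (count_space UNIV)"
    by measurable
  then show ?thesis unfolding walk_def two_sided_walk_def .
qed

lemma measurable_crossings [measurable]:
  "(\<lambda>c. crossings c t y z) \<in> measurable config_measure (count_space UNIV)"
proof -
  define A where "A c = {(k, i). 1 \<le> i \<and> i \<le> fst c k \<and> walk c k i t = y \<and> walk c k i (t + 1) = z}" for c
  have "{c \<in> space config_measure. n \<in> to_nat ` A c} \<in> sets config_measure" for n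
  proof -
    have "{c \<in> space config_measure. n \<in> to_nat ` A c} =
      (\<Union>(k, i)\<in>{ki. to_nat ki = n}. {c \<in> space config_measure.
         1 \<le> i \<and> i \<le> fst c k \<and> walk c k i t = y \<and> walk c k i (t + 1) = z})"
      by (auto simp: A_def)
    also have "\<dots> \<in> sets config_measure"
    proof (intro sets.countable_UN'')
      fix ki :: "int \<times> nat"
      obtain k i where [simp]: "ki = (k, i)" by force
      have "{c \<in> space config_measure.
         1 \<le> i \<and> i \<le> fst c k \<and> walk c k i t = y \<and> walk c k i (t + 1) = z} \<in> sets config_measure"
        by measurable
      then show "(case ki of (k, i) \<Rightarrow> {c \<in> space config_measure.
         1 \<le> i \<and> i \<le> fst c k \<and> walk c k i t = y \<and> walk c k i (t + 1) = z}) \<in> sets config_measure"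
        by simp
    qed simp
    finally show ?thesis .
  qed
  then have "(\<lambda>c. card (to_nat ` A c)) \<in> measurable config_measure (count_space UNIV)"
    by (rule measurable_card)
  moreover have "card (to_nat ` A c) = crossings c t y z" for c
    unfolding crossings_def A_def by (intro card_image inj_on_subset[OF inj_to_nat]) auto
  ultimately show ?thesis by simp
qed

lemma measurable_environment_of [measurable]:
  "environment_of \<in> measurable config_measure environment_space"
  unfolding environment_space_def
proof (rule measurable_PiM_single')
  fix ty :: "int \<times> int"
  obtain t y where [simp]: "ty = (t, y)" by force
  have "(\<lambda>c. (crossings c t y (y + 1), crossings c t y (y - 1)))
      \<in> measurable config_measure (count_space UNIV \<Otimes>\<^sub>M count_space UNIV)"
    by measurable
  then show "(\<lambda>c. environment_of c ty) \<in> measurable config_measure (count_space UNIV)"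
    by (simp add: environment_of_def pair_measure_countable)
qed (auto simp: PiE_UNIV_domain)

lemma prob_space_env_law: "prob_space env_law"
  unfolding env_law_def
  by (rule prob_space.prob_space_distr[OF prob_space_config_measure measurable_environment_of])

end

theory Submission
  imports Defs "HOL-Real_Asymp.Real_Asymp"
begin

text \<open>Read \<open>mass \<omega> t\<close> as the law at time \<open>t\<close> of a walker that moves, from each space-time
site it visits, along with one of the particles there, chosen uniformly and afresh at each step.
Given the past, the particles make independent fair steps; hence the walker, averaged over the
environment, is a simple random walk and satisfies the central limit theorem. What has to be shown
is that averages of a test function for a fixed environment stay close to their mean.

Let \<open>P\<close> be the transition operator of simple random walk (\<open>srw\<close>), let \<open>f\<close> be a test function
on the scale \<open>sqrt T\<close>, and let \<open>M t\<close> be the average of \<open>P ^ (T - t) f\<close> against \<open>mass \<omega> t\<close>.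
Given the past, the drifts \<open>(e_plus - e_minus) / visits\<close> at the sites of one time are centred,
uncorrelated, and of variance \<open>1 / visits\<close>
(\<open>expectation_adapted_drift\<close>, \<open>expectation_adapted_drift2\<close>). So \<open>M\<close> is a martingale whose
increments have second moment at most \<open>C / T\<close> times the mean of \<open>\<Sum>y. (mass \<omega> t y)^2\<close>, and
Kolmogorov's inequality (\<open>maximal_inequality\<close>) reduces the claim to a bound of the form
\<open>T powr (1 - \<delta>)\<close> for the sum of these means over \<open>t < T\<close>: two walkers that move independently in
one environment rarely meet.

Two mechanisms give this bound. First, the mean distance of the two walkers grows at time \<open>t\<close> by
exactly the mean of \<open>\<Sum>y. (mass \<omega> t y)^2 * (1 - 1 / visits)\<close>, and it is at most \<open>2 * sqrt T\<close>;
this counts the meetings at sites with at least two particles (\<open>sum_expectation_crowded\<close>).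
Second, at a site with a single particle the walkers stay together until that particle meets
another one, so that such a meeting can be charged to a later one at a crowded site, unless the
particle remains alone for \<open>n\<close> steps (\<open>mass2_le_crowded_plus_lone\<close>). A particle that goes alone
from \<open>(s, y)\<close> to \<open>(s + n, z)\<close> is crossed by no other particle of its parity. The number of
particles that would cross is Poisson distributed with mean of order at least \<open>sqrt n\<close>
(\<open>prob_uncrossed\<close>, \<open>sum_cross_prob_ge\<close>), so that with \<open>n = T powr (1 / 4)\<close> even the union of the
events over all sites up to time \<open>T\<close> is negligible. Together this bounds the number of meetings by
a multiple of \<open>T powr (3 / 4)\<close> (\<open>sum_expectation_mass2_block\<close>).

The Borel-Cantelli lemma along \<open>T = m ^ 8\<close> yields almost sure convergence of the averages of each
Lipschitz test function of compact support: between \<open>(m - 1) ^ 8\<close> and \<open>m ^ 8\<close> the martingale is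
controlled by the maximal inequality, and the change of scale by continuity (\<open>avg_tendsto\<close>).
Countably many trapezoids then bound the distribution functions from both sides
(\<open>weak_conv_of_trapezoids\<close>). Since \<open>env_law_tilde\<close> has density \<open>visits \<omega> 0 0\<close>, it suffices
to argue on the event that the origin is occupied at time 0; the factor \<open>occupied\<close> expresses this.\<close>

section \<open>Sign flips of single steps\<close>

definition sg :: "int \<Rightarrow> int" where
  "sg a = (if a = 1 then 1 else -1)"

text \<open>Steps other than \<open>1\<close> and \<open>-1\<close> occur only on a null event. Turning them into \<open>-1\<close> makes
the counting identities below true for every configuration, which keeps them free of exceptional
sets.\<close>

definition signed :: "config \<Rightarrow> config" where
  "signed c = (fst c, \<lambda>w s. sg (snd c w s))"

abbreviation coin :: "int measure" where
  "coin \<equiv> measure_pmf (pmf_of_set {-1, 1})"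

abbreviation path_measure :: "(int \<Rightarrow> int) measure" where
  "path_measure \<equiv> \<Pi>\<^sub>M s\<in>UNIV. coin"

abbreviation paths_measure :: "(int \<times> nat \<Rightarrow> int \<Rightarrow> int) measure" where
  "paths_measure \<equiv> \<Pi>\<^sub>M w\<in>UNIV. path_measure"

abbreviation counts_measure :: "(int \<Rightarrow> nat) measure" where
  "counts_measure \<equiv> \<Pi>\<^sub>M k\<in>UNIV. measure_pmf (poisson_pmf 1)"

lemma prob_space_path_measure: "prob_space path_measure"
  by (intro prob_space_PiM measure_pmf.prob_space_axioms)

lemma prob_space_paths_measure: "prob_space paths_measure"
  by (intro prob_space_PiM prob_space_path_measure)

lemma prob_space_counts_measure: "prob_space counts_measure"
  by (intro prob_space_PiM measure_pmf.prob_space_axioms)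

lemma space_path_measure [simp]: "space path_measure = UNIV"
  and space_paths_measure [simp]: "space paths_measure = UNIV"
  and space_counts_measure [simp]: "space counts_measure = UNIV"
  by (simp_all add: space_PiM PiE_UNIV_domain)

interpretation cfg: prob_space config_measure
  by (rule prob_space_config_measure)

abbreviation expect :: "(config \<Rightarrow> real) \<Rightarrow> real" where
  "expect \<equiv> integral\<^sup>L config_measure"

abbreviation observable :: "(config \<Rightarrow> real) \<Rightarrow> bool" where
  "observable H \<equiv> H \<in> borel_measurable config_measure"

lemma distr_PiM_coordinatewise:
  fixes M :: "'i \<Rightarrow> 'a measure"
  assumes M: "\<And>i. prob_space (M i)"
    and f [measurable]: "\<And>i. f i \<in> measurable (M i) (M i)"
    and d: "\<And>i. distr (M i) (M i) (f i) = M i"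
  shows "(\<lambda>x i. f i (x i)) \<in> measurable (PiM UNIV M) (PiM UNIV M)"
    and "distr (PiM UNIV M) (PiM UNIV M) (\<lambda>x i. f i (x i)) = PiM UNIV M"
proof -
  show meas [measurable]: "(\<lambda>x i. f i (x i)) \<in> measurable (PiM UNIV M) (PiM UNIV M)"
    by (rule measurable_PiM_single')
      (auto simp: PiE_UNIV_domain space_PiM intro!: measurable_space[OF f])
  show "distr (PiM UNIV M) (PiM UNIV M) (\<lambda>x i. f i (x i)) = PiM UNIV M"
  proof (rule measure_eqI_PiM_infinite[symmetric, OF refl])
    interpret prob_space "PiM UNIV M"
      using M by (intro prob_space_PiM) auto
    show "finite_measure (PiM UNIV M)" by unfold_locales
    fix A J assume J: "finite J" "J \<subseteq> (UNIV :: 'i set)" and A: "\<And>i. i \<in> J \<Longrightarrow> A i \<in> sets (M i)"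
    have pre: "f i -` A i \<inter> space (M i) \<in> sets (M i)" if "i \<in> J" for i
      using A[OF that] by measurable
    have "PiM UNIV M (prod_emb UNIV M J (Pi\<^sub>E J A)) = (\<Prod>i\<in>J. M i (A i))"
      using J A by (intro emeasure_PiM_emb M) auto
    also have "\<dots> = (\<Prod>i\<in>J. M i (f i -` A i \<inter> space (M i)))"
    proof (rule prod.cong)
      fix i assume "i \<in> J"
      then have "emeasure (distr (M i) (M i) (f i)) (A i) = M i (f i -` A i \<inter> space (M i))"
        using A by (intro emeasure_distr) auto
      then show "emeasure (M i) (A i) = M i (f i -` A i \<inter> space (M i))" by (simp add: d)
    qed simp
    also have "\<dots> = PiM UNIV M (prod_emb UNIV M J (\<Pi>\<^sub>E i\<in>J. f i -` A i \<inter> space (M i)))"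
      using J pre by (intro emeasure_PiM_emb[symmetric] M) auto
    also have "prod_emb UNIV M J (\<Pi>\<^sub>E i\<in>J. f i -` A i \<inter> space (M i))
        = (\<lambda>x i. f i (x i)) -` prod_emb UNIV M J (Pi\<^sub>E J A) \<inter> space (PiM UNIV M)"
      using measurable_space[OF f]
      by (auto simp: prod_emb_def space_PiM PiE_UNIV_domain PiE_iff restrict_def extensional_def)
        (auto simp: Pi_def)
    also have "PiM UNIV M \<dots> = distr (PiM UNIV M) (PiM UNIV M) (\<lambda>x i. f i (x i)) (prod_emb UNIV M J (Pi\<^sub>E J A))"
      using J A by (intro emeasure_distr[symmetric] sets_PiM_I meas) auto
    finally show "PiM UNIV M (prod_emb UNIV M J (Pi\<^sub>E J A)) =
      distr (PiM UNIV M) (PiM UNIV M) (\<lambda>x i. f i (x i)) (prod_emb UNIV M J (Pi\<^sub>E J A))" .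
  qed simp
qed

text \<open>Reversing the step of walker \<open>w\<close> at time \<open>t\<close>. The minus sign is applied after \<open>sg\<close>, so that the
signed step changes its sign at every configuration.\<close>

definition flip_path :: "int \<times> nat \<Rightarrow> int \<Rightarrow> (int \<times> nat \<Rightarrow> int \<Rightarrow> int) \<Rightarrow> int \<times> nat \<Rightarrow> int \<Rightarrow> int" where
  "flip_path w t x = (\<lambda>w' s. if w' = w \<and> s = t then - sg (x w' s) else x w' s)"

lemma map_pmf_flip_coin: "map_pmf (\<lambda>a. - sg a) (pmf_of_set {-1, 1}) = pmf_of_set {-1, 1}"
proof (subst map_pmf_of_set_inj)
  show "pmf_of_set ((\<lambda>a. - sg a) ` {-1, 1}) = pmf_of_set {-1, 1}"
    by (simp add: sg_def insert_commute)
qed (auto simp: sg_def inj_on_def)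

lemma flip_path_preserves:
  shows measurable_flip_path: "flip_path w t \<in> measurable paths_measure paths_measure"
    and distr_flip_path: "distr paths_measure paths_measure (flip_path w t) = paths_measure"
proof -
  have eq: "flip_path w t = (\<lambda>x w'. (\<lambda>p s. (if w' = w \<and> s = t then (\<lambda>a. - sg a) else (\<lambda>a. a)) (p s)) (x w'))"
    by (auto simp: flip_path_def fun_eq_iff)
  have coin: "distr coin coin (if b then (\<lambda>a. - sg a) else (\<lambda>a. a)) = coin" for b
  proof (cases b)
    case True
    have "distr coin coin (\<lambda>a. - sg a) = distr coin (count_space UNIV) (\<lambda>a. - sg a)"
      by (rule distr_cong) auto
    also have "\<dots> = measure_pmf (map_pmf (\<lambda>a. - sg a) (pmf_of_set {-1, 1}))"
      by (simp add: map_pmf_rep_eq)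
    finally show ?thesis using True by (simp add: map_pmf_flip_coin)
  qed (simp add: distr_id)
  note path = distr_PiM_coordinatewise[of "\<lambda>s::int. coin", OF measure_pmf.prob_space_axioms _ coin]
  note paths = distr_PiM_coordinatewise[of "\<lambda>w::int\<times>nat. path_measure", OF prob_space_path_measure path]
  show "flip_path w t \<in> measurable paths_measure paths_measure"
    unfolding eq by (rule paths(1)) auto
  show "distr paths_measure paths_measure (flip_path w t) = paths_measure"
    unfolding eq by (rule paths(2)) auto
qed

section \<open>Walkers and the environment they create\<close>

definition walkers :: "config \<Rightarrow> (int \<times> nat) set" where
  "walkers c = {w. 1 \<le> snd w \<and> snd w \<le> fst c (fst w)}"

definition pos :: "config \<Rightarrow> nat \<Rightarrow> int \<times> nat \<Rightarrow> int" where
  "pos c t w = walk (signed c) (fst w) (snd w) (int t)"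

definition step :: "config \<Rightarrow> nat \<Rightarrow> int \<times> nat \<Rightarrow> int" where
  "step c t w = sg (snd c w (int t))"

definition occ :: "config \<Rightarrow> nat \<Rightarrow> int \<Rightarrow> (int \<times> nat) set" where
  "occ c t y = {w \<in> walkers c. pos c t w = y}"

abbreviation env :: "config \<Rightarrow> environment" where
  "env c \<equiv> environment_of (signed c)"

abbreviation vis :: "config \<Rightarrow> nat \<Rightarrow> int \<Rightarrow> nat" where
  "vis c t y \<equiv> visits (env c) (int t) y"

lemma step_cases: "step c t w = 1 \<or> step c t w = -1"
  by (simp add: step_def sg_def)

lemma pos_0 [simp]: "pos c 0 w = fst w"
  by (simp add: pos_def walk_def two_sided_walk_def)

lemma pos_eq_sum: "pos c t w = fst w + (\<Sum>s<t. step c s w)"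
proof -
  have "(\<Sum>s\<in>{0..<int t}. sg (snd c w s)) = (\<Sum>s<t. sg (snd c w (int s)))"
    by (rule sum.reindex_bij_witness[of _ int nat]) auto
  then show ?thesis
    by (simp add: pos_def walk_def two_sided_walk_def signed_def step_def)
qed

lemma pos_Suc: "pos c (Suc t) w = pos c t w + step c t w"
  by (simp add: pos_eq_sum)

lemma abs_pos_diff: "\<bar>pos c t w - fst w\<bar> \<le> int t"
proof (induction t)
  case (Suc t)
  then show ?case using step_cases[of c t w] by (auto simp: pos_Suc)
qed simp

lemma walk_signed: "walk (signed c) (fst w) (snd w) (int t) = pos c t w"
  "walk (signed c) (fst w) (snd w) (int t + 1) = pos c t w + step c t w"
  using pos_Suc[of c t w] by (simp_all add: pos_def add.commute)

lemma finite_occ [simp]: "finite (occ c t y)"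
proof (rule finite_subset)
  show "occ c t y \<subseteq> Sigma {y - int t..y + int t} (\<lambda>k. {1..fst c k})"
  proof
    fix w assume "w \<in> occ c t y"
    then show "w \<in> Sigma {y - int t..y + int t} (\<lambda>k. {1..fst c k})"
      using abs_pos_diff[of c t w] by (cases w) (auto simp: occ_def walkers_def)
  qed
qed auto

lemma crossings_signed: "crossings (signed c) (int t) y z = card {w \<in> occ c t y. y + step c t w = z}"
proof -
  have "{(k, i). 1 \<le> i \<and> i \<le> fst (signed c) k \<and> walk (signed c) k i (int t) = y \<and> walk (signed c) k i (int t + 1) = z}
      = {w \<in> occ c t y. y + step c t w = z}"
    using walk_signed[of c _ t] by (auto simp: occ_def walkers_def signed_def)
  then show ?thesis by (simp add: crossings_def)
qed

lemma e_plus_env: "e_plus (env c) (int t) y = card {w \<in> occ c t y. step c t w = 1}"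
  and e_minus_env: "e_minus (env c) (int t) y = card {w \<in> occ c t y. step c t w = -1}"
proof -
  have "y + s = y - 1 \<longleftrightarrow> s = -1" for s :: int by auto
  then show "e_plus (env c) (int t) y = card {w \<in> occ c t y. step c t w = 1}"
    "e_minus (env c) (int t) y = card {w \<in> occ c t y. step c t w = -1}"
    by (simp_all add: e_plus_def e_minus_def environment_of_def crossings_signed)
qed

lemma visits_env: "vis c t y = card (occ c t y)"
proof -
  have "card (occ c t y) = card ({w \<in> occ c t y. step c t w = 1} \<union> {w \<in> occ c t y. step c t w = -1})"
  proof (intro arg_cong[where f = card] set_eqI)
    fix w
    show "w \<in> occ c t y \<longleftrightarrow> w \<in> {w \<in> occ c t y. step c t w = 1} \<union> {w \<in> occ c t y. step c t w = -1}"
      using step_cases[of c t w] by auto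
  qed
  also have "\<dots> = card {w \<in> occ c t y. step c t w = 1} + card {w \<in> occ c t y. step c t w = -1}"
    by (rule card_Un_disjoint) auto
  finally have "card (occ c t y) = card {w \<in> occ c t y. step c t w = 1} + card {w \<in> occ c t y. step c t w = -1}" .
  then show ?thesis by (simp add: visits_def e_plus_env e_minus_env)
qed

text \<open>From an occupied site \<open>(t, y)\<close>, mass moves to the right in the proportion \<open>(1 + drift c t y) / 2\<close>.\<close>

definition drift :: "config \<Rightarrow> nat \<Rightarrow> int \<Rightarrow> real" where
  "drift c t y = (real (e_plus (env c) (int t) y) - real (e_minus (env c) (int t) y)) / real (vis c t y)"

lemma drift_eq: "drift c t y = real_of_int (\<Sum>w\<in>occ c t y. step c t w) / real (card (occ c t y))"
proof -
  have "(\<Sum>w\<in>occ c t y. step c t w) = (\<Sum>w\<in>occ c t y. (if step c t w = 1 then 1 else 0) - (if step c t w = -1 then 1 else 0))"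
  proof (rule sum.cong)
    fix w
    show "step c t w = (if step c t w = 1 then 1 else 0) - (if step c t w = -1 then 1 else 0)"
      using step_cases[of c t w] by auto
  qed simp
  also have "\<dots> = int (card {w \<in> occ c t y. step c t w = 1}) - int (card {w \<in> occ c t y. step c t w = -1})"
    by (simp add: sum_subtractf flip: sum.inter_filter)
  finally show ?thesis
    by (simp add: drift_def e_plus_env e_minus_env visits_env)
qed

lemma abs_drift_le: "\<bar>drift c t y\<bar> \<le> 1"
  by (simp add: drift_def visits_def divide_le_eq) linarith

section \<open>Conditional moments of the drift\<close>

definition agree :: "nat \<Rightarrow> config \<Rightarrow> config \<Rightarrow> bool" where
  "agree t c c' \<longleftrightarrow> fst c = fst c' \<and> (\<forall>w s. s < int t \<longrightarrow> sg (snd c w s) = sg (snd c' w s))"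

text \<open>A function is adapted if it depends on the initial numbers and on the steps before time \<open>t\<close>
only. Such a function is invariant under reversing a step made at time \<open>t\<close>, and this invariance
does the work of conditioning on the past.\<close>

definition adapted :: "nat \<Rightarrow> (config \<Rightarrow> 'a) \<Rightarrow> bool" where
  "adapted t H \<longleftrightarrow> (\<forall>c c'. agree t c c' \<longrightarrow> H c = H c')"

lemma adaptedD: "adapted t H \<Longrightarrow> agree t c c' \<Longrightarrow> H c = H c'"
  unfolding adapted_def by blast

lemma agree_le: "agree t c c' \<Longrightarrow> s \<le> t \<Longrightarrow> agree s c c'"
  by (auto simp: agree_def)

lemma agree_step: "agree t c c' \<Longrightarrow> s < t \<Longrightarrow> step c s w = step c' s w"
  unfolding agree_def step_def by (cases w) simp

lemma agree_pos: "agree t c c' \<Longrightarrow> pos c t w = pos c' t w"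
  by (auto simp: pos_eq_sum intro!: sum.cong agree_step)

lemma agree_occ: "agree t c c' \<Longrightarrow> occ c t y = occ c' t y"
  using agree_pos[of t c c'] by (auto simp: occ_def walkers_def agree_def)

lemma agree_visits: "agree t c c' \<Longrightarrow> vis c t y = visits (env c') (int t) y"
  by (simp add: visits_env agree_occ)

lemma agree_e_plus: "agree (Suc t) c c' \<Longrightarrow> e_plus (env c) (int t) y = e_plus (env c') (int t) y"
  and agree_e_minus: "agree (Suc t) c c' \<Longrightarrow> e_minus (env c) (int t) y = e_minus (env c') (int t) y"
  using agree_occ[OF agree_le, of "Suc t" c c' t] agree_step[of "Suc t" c c' t]
  by (simp_all add: e_plus_env e_minus_env)

lemma agree_drift: "agree (Suc t) c c' \<Longrightarrow> drift c t y = drift c' t y"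
  by (simp add: drift_def agree_e_plus agree_e_minus agree_visits[OF agree_le])

lemma agree_mass: "agree t c c' \<Longrightarrow> mass (env c) t y = mass (env c') t y"
proof (induction t arbitrary: y)
  case (Suc t)
  then show ?case
    by (simp add: agree_e_plus agree_e_minus agree_visits[OF agree_le] agree_le[of "Suc t"])
qed simp

lemma agree_flip: "agree t (N, x) (N, flip_path w (int t) x)"
  by (auto simp: agree_def flip_path_def)

lemma step_flip: "step (N, flip_path w (int t) x) t w' = (if w' = w then - step (N, x) t w' else step (N, x) t w')"
  by (auto simp: step_def flip_path_def sg_def)

lemma config_measure_eq: "config_measure = counts_measure \<Otimes>\<^sub>M paths_measure"
  by (simp add: config_measure_def)

lemma measurable_step_config [measurable]: "(\<lambda>c. step c t w) \<in> measurable config_measure (count_space UNIV)"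
  unfolding step_def by (rule measurable_compose[OF measurable_step]) simp

lemma measurable_signed [measurable]: "signed \<in> measurable config_measure config_measure"
proof -
  have f: "fst \<in> measurable config_measure counts_measure"
    unfolding config_measure_eq by simp
  have s: "(\<lambda>c w s. sg (snd c w s)) \<in> measurable config_measure paths_measure"
  proof (rule measurable_PiM_single')
    fix w :: "int \<times> nat"
    show "(\<lambda>c s. sg (snd c w s)) \<in> measurable config_measure path_measure"
    proof (rule measurable_PiM_single')
      fix s :: int
      have "(\<lambda>c. sg (snd c w s)) \<in> measurable config_measure (count_space UNIV)"
        by (rule measurable_compose[OF measurable_step]) simp
      then show "(\<lambda>c. sg (snd c w s)) \<in> measurable config_measure coin" by simp
    qed auto
  qed auto
  have "(\<lambda>c. (fst c, \<lambda>w s. sg (snd c w s))) \<in> measurable config_measure (counts_measure \<Otimes>\<^sub>M paths_measure)"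
    by (intro measurable_Pair f s)
  then show ?thesis by (simp add: signed_def[abs_def] config_measure_eq)
qed

lemma measurable_env [measurable]: "env \<in> measurable config_measure environment_space"
  by measurable

lemma measurable_e_plus [measurable]: "(\<lambda>\<omega>. e_plus \<omega> t y) \<in> measurable environment_space (count_space UNIV)"
  and measurable_e_minus [measurable]: "(\<lambda>\<omega>. e_minus \<omega> t y) \<in> measurable environment_space (count_space UNIV)"
proof -
  have *: "(\<lambda>\<omega>. \<omega> (t, y)) \<in> measurable environment_space (count_space UNIV)"
    unfolding environment_space_def by (rule measurable_component_singleton) simp
  show "(\<lambda>\<omega>. e_plus \<omega> t y) \<in> measurable environment_space (count_space UNIV)"
    "(\<lambda>\<omega>. e_minus \<omega> t y) \<in> measurable environment_space (count_space UNIV)"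
    unfolding e_plus_def e_minus_def by (rule measurable_compose[OF *], simp)+
qed

lemma measurable_visits [measurable]: "(\<lambda>\<omega>. visits \<omega> t y) \<in> measurable environment_space (count_space UNIV)"
  unfolding visits_def by measurable

lemma measurable_mass [measurable]: "(\<lambda>\<omega>. mass \<omega> t y) \<in> borel_measurable environment_space"
proof (induction t arbitrary: y)
  case (Suc t)
  note [measurable] = Suc.IH
  show ?case unfolding mass.simps by measurable
qed simp

lemma measurable_drift [measurable]: "observable (\<lambda>c. drift c t y)"
  unfolding drift_def by measurable

lemma measurable_pos [measurable]: "(\<lambda>c. pos c t w) \<in> measurable config_measure (count_space UNIV)"
  unfolding pos_def by measurable

lemma measurable_mem_occ [measurable]: "Measurable.pred config_measure (\<lambda>c. w \<in> occ c t y)"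
  unfolding occ_def walkers_def by measurable

lemma measurable_section:
  assumes "observable H"
  shows "(\<lambda>x. H (N, x)) \<in> borel_measurable paths_measure"
  using assms unfolding config_measure_eq by measurable

lemma integral_odd_eq_0:
  fixes G :: "(int \<times> nat \<Rightarrow> int \<Rightarrow> int) \<Rightarrow> real"
  assumes G: "G \<in> borel_measurable paths_measure"
    and odd: "\<And>x. G (flip_path w t x) = - G x"
  shows "integral\<^sup>L paths_measure G = 0"
proof -
  have "integral\<^sup>L paths_measure G = integral\<^sup>L (distr paths_measure paths_measure (flip_path w t)) G"
    by (simp add: distr_flip_path)
  also have "\<dots> = integral\<^sup>L paths_measure (\<lambda>x. - G x)"
    using G by (subst integral_distr[OF measurable_flip_path]) (simp_all add: odd)
  also have "\<dots> = - integral\<^sup>L paths_measure G" by simp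
  finally show ?thesis by simp
qed

lemma integrable_config:
  assumes "observable H" "\<And>c. \<bar>H c\<bar> \<le> (B::real)"
  shows "integrable config_measure H"
  using assms by (intro cfg.integrable_const_bound[where B = B]) auto

text \<open>By Fubini's theorem, identities between expectations may be verified for fixed initial
numbers \<open>N\<close>, where all sums over walkers are finite.\<close>

lemma integral_config_cong_sections:
  fixes F F' :: "config \<Rightarrow> real"
  assumes F: "observable F" "\<And>c. \<bar>F c\<bar> \<le> B"
    and F': "F' \<in> borel_measurable config_measure" "\<And>c. \<bar>F' c\<bar> \<le> B'"
    and eq: "\<And>N. (\<integral>x. F (N, x) \<partial>paths_measure) = (\<integral>x. F' (N, x) \<partial>paths_measure)"
  shows "integral\<^sup>L config_measure F = integral\<^sup>L config_measure F'"
proof -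
  interpret A: prob_space counts_measure by (rule prob_space_counts_measure)
  interpret B: prob_space paths_measure by (rule prob_space_paths_measure)
  interpret P: pair_prob_space counts_measure paths_measure ..
  have "integral\<^sup>L config_measure G = (\<integral>N. \<integral>x. G (N, x) \<partial>paths_measure \<partial>counts_measure)"
    if "integrable config_measure G" for G :: "config \<Rightarrow> real"
    using P.integral_fst'[of G] that by (simp add: config_measure_eq)
  with integrable_config[OF F] integrable_config[OF F'] show ?thesis by (simp add: eq)
qed

text \<open>The walkers that can be at \<open>y\<close> at time \<open>t\<close>. This set is finite and does not depend on the
steps, so that for given initial numbers a sum over the walkers at \<open>y\<close> can be integrated term by
term.\<close>

definition starters :: "(int \<Rightarrow> nat) \<Rightarrow> nat \<Rightarrow> int \<Rightarrow> (int \<times> nat) set" where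
  "starters N t y = Sigma {y - int t..y + int t} (\<lambda>k. {1..N k})"

lemma finite_starters [simp]: "finite (starters N t y)"
  by (simp add: starters_def)

lemma occ_subset_starters: "occ c t y \<subseteq> starters (fst c) t y"
proof
  fix w assume "w \<in> occ c t y"
  then show "w \<in> starters (fst c) t y"
    using abs_pos_diff[of c t w] by (cases w) (auto simp: occ_def walkers_def starters_def)
qed

lemma drift_eq_starters:
  "drift c t y = (\<Sum>w\<in>starters (fst c) t y. of_bool (w \<in> occ c t y) * real_of_int (step c t w) / real (card (occ c t y)))"
proof -
  have "(\<Sum>w\<in>occ c t y. real_of_int (step c t w)) = (\<Sum>w\<in>starters (fst c) t y. of_bool (w \<in> occ c t y) * real_of_int (step c t w))"
    using occ_subset_starters[of c t y] by (intro sum.mono_neutral_cong_left) auto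
  then show ?thesis by (simp only: drift_eq of_int_sum sum_divide_distrib)
qed

lemma card_occ_measurable [measurable]:
  "observable (\<lambda>c. real (card (occ c t y)))"
proof -
  have "observable (\<lambda>c. real (vis c t y))" by measurable
  then show ?thesis by (simp add: visits_env)
qed

text \<open>Reversing the step of one walker at time \<open>t\<close> changes the sign of its contribution to the
drift, and leaves \<open>H\<close>, its position and the number of walkers at \<open>y\<close> unchanged.\<close>

lemma expectation_adapted_drift:
  fixes H :: "config \<Rightarrow> real"
  assumes [measurable]: "observable H" and B: "\<And>c. \<bar>H c\<bar> \<le> B"
    and H: "adapted t H"
  shows "expect (\<lambda>c. H c * drift c t y) = 0"
proof -
  have "expect (\<lambda>c. H c * drift c t y) = expect (\<lambda>c. 0)"
  proof (rule integral_config_cong_sections)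
    show "\<bar>H c * drift c t y\<bar> \<le> B" for c
      using mult_mono[OF B abs_drift_le[of c t y]] B[of c] by (simp add: abs_mult)
  next
    fix N
    define G where "G w x = H (N, x) * (of_bool (w \<in> occ (N, x) t y) * real_of_int (step (N, x) t w) / real (card (occ (N, x) t y)))" for w x
    have Gm: "G w \<in> borel_measurable paths_measure" for w
    proof -
      have "observable (\<lambda>c. H c * (of_bool (w \<in> occ c t y) * real_of_int (step c t w) / real (card (occ c t y))))"
        by measurable
      from measurable_section[OF this, of N] show ?thesis by (simp add: G_def[abs_def])
    qed
    have Gb: "\<bar>G w x\<bar> \<le> B" for w x
    proof -
      have "\<bar>of_bool (w \<in> occ (N, x) t y) * real_of_int (step (N, x) t w) / real (card (occ (N, x) t y))\<bar> \<le> 1"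
        using step_cases[of "(N, x)" t w] by (cases "card (occ (N, x) t y)") auto
      from mult_mono[OF B this] B[of "(N,x)"] show ?thesis by (simp add: G_def abs_mult)
    qed
    have "integral\<^sup>L paths_measure (G w) = 0" for w
    proof (rule integral_odd_eq_0[OF Gm, where w = w and t = "int t"])
      fix x
      have "H (N, flip_path w (int t) x) = H (N, x)"
        using adaptedD[OF H agree_flip[of t N x w]] by simp
      then show "G w (flip_path w (int t) x) = - G w x"
        by (simp add: G_def step_flip agree_occ[OF agree_flip[of t N x w], symmetric])
    qed
    moreover have "integrable paths_measure (G w)" for w
      using prob_space_paths_measure Gm Gb
      by (intro finite_measure.integrable_const_bound[where B = B]) (auto simp: prob_space_def)
    ultimately have "(\<integral>x. (\<Sum>w\<in>starters N t y. G w x) \<partial>paths_measure) = 0"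
      by (subst Bochner_Integration.integral_sum) auto
    then show "(\<integral>x. H (N, x) * drift (N, x) t y \<partial>paths_measure) = (\<integral>x. 0 \<partial>paths_measure)"
      by (simp add: G_def drift_eq_starters sum_distrib_left)
  qed auto
  then show ?thesis by simp
qed

text \<open>In the product of two drifts, the terms of two different walkers vanish, by reversing the step
of one of them. A walker paired with itself is at one site only; at that site, each of the
\<open>visits\<close> walkers contributes \<open>1 / visits^2\<close>.\<close>

lemma expectation_adapted_drift2:
  fixes H :: "config \<Rightarrow> real"
  assumes [measurable]: "observable H" and B: "\<And>c. \<bar>H c\<bar> \<le> B"
    and H: "adapted t H"
  shows "expect (\<lambda>c. H c * (drift c t y * drift c t y'))
     = (if y = y' then expect (\<lambda>c. H c / real (vis c t y)) else 0)"
proof -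
  define D where "D c = (if y = y' then H c / real (card (occ c t y)) else 0)" for c
  have B0: "0 \<le> B" using B[of "(\<lambda>_. 0, \<lambda>_ _. 0)"] by simp
  have Dm [measurable]: "observable D" unfolding D_def by measurable
  have Db: "\<bar>D c\<bar> \<le> B" for c
  proof (cases "card (occ c t y)")
    case (Suc n)
    have "\<bar>H c\<bar> / real (Suc n) \<le> B / 1"
      using B[of c] by (intro frac_le) auto
    then show ?thesis using Suc B0 by (auto simp: D_def abs_mult)
  qed (auto simp: D_def B0)
  have "expect (\<lambda>c. H c * (drift c t y * drift c t y')) = expect (\<lambda>c. D c)"
  proof (rule integral_config_cong_sections)
    show "\<bar>H c * (drift c t y * drift c t y')\<bar> \<le> B" for c
      using mult_mono[OF B mult_mono[OF abs_drift_le[of c t y] abs_drift_le[of c t y']]] B0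
      by (simp add: abs_mult)
    show "\<bar>D c\<bar> \<le> B" for c by (rule Db)
  next
    fix N
    define g where "g w z c = of_bool (w \<in> occ c t z) * real_of_int (step c t w) / real (card (occ c t z))" for w z c
    define G where "G w w' x = H (N, x) * (g w y (N, x) * g w' y' (N, x))" for w w' x
    have gb: "\<bar>g w z c\<bar> \<le> 1" for w z c
      using step_cases[of c t w] by (cases "card (occ c t z)") (auto simp: g_def)
    have Gm: "G w w' \<in> borel_measurable paths_measure" for w w'
    proof -
      have "observable (\<lambda>c. H c * (g w y c * g w' y' c))"
        unfolding g_def by measurable
      from measurable_section[OF this, of N] show ?thesis by (simp add: G_def[abs_def])
    qed
    have Gb: "\<bar>G w w' x\<bar> \<le> B" for w w' x
      using mult_mono[OF B mult_mono[OF gb gb]] B0 by (simp add: G_def abs_mult)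
    have Gi: "integrable paths_measure (G w w')" for w w'
      using prob_space_paths_measure Gm Gb
      by (intro finite_measure.integrable_const_bound[where B = B]) (auto simp: prob_space_def)
    have off: "integral\<^sup>L paths_measure (G w w') = 0" if "w \<noteq> w'" for w w'
    proof (rule integral_odd_eq_0[OF Gm, where w = w and t = "int t"])
      fix x
      have "H (N, flip_path w (int t) x) = H (N, x)"
        using adaptedD[OF H agree_flip[of t N x w]] by simp
      then show "G w w' (flip_path w (int t) x) = - G w w' x"
        using that
        by (simp add: G_def g_def step_flip agree_occ[OF agree_flip[of t N x w], symmetric])
    qed
    have diag: "(\<Sum>w\<in>starters N t y. \<Sum>w'\<in>starters N t y'. of_bool (w = w') * G w w' x) = D (N, x)" for x
    proof -
      let ?c = "(N, x)"
      have "(\<Sum>w'\<in>starters N t y'. of_bool (w = w') * G w w' x)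
          = (if y = y' then H ?c * (of_bool (w \<in> occ ?c t y) / (real (card (occ ?c t y)))\<^sup>2) else 0)" (is "?l = ?r") for w
      proof -
        have 1: "?l = (\<Sum>w'\<in>starters N t y'. if w = w' then G w w' x else 0)"
          by (intro sum.cong) auto
        also have "\<dots> = (if w \<in> starters N t y' then G w w x else 0)" by simp
        also have "\<dots> = ?r"
        proof -
          have w: "w \<in> starters N t y'" if "w \<in> occ ?c t y'"
            using that occ_subset_starters[of ?c t y'] by auto
          have disj: "y = y'" if "w \<in> occ ?c t y" "w \<in> occ ?c t y'" using that by (auto simp: occ_def)
          have "real_of_int (step ?c t w) * real_of_int (step ?c t w) = 1" using step_cases[of ?c t w] by auto
          then show ?thesis
            using w disj by (auto simp: G_def g_def power2_eq_square)
        qed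
        finally show ?thesis .
      qed
      then have "(\<Sum>w\<in>starters N t y. \<Sum>w'\<in>starters N t y'. of_bool (w = w') * G w w' x)
         = (\<Sum>w\<in>starters N t y. if y = y' then H ?c * (of_bool (w \<in> occ ?c t y) / (real (card (occ ?c t y)))\<^sup>2) else 0)"
        by (rule sum.cong[OF refl])
      also have "\<dots> = (if y = y' then H ?c * ((\<Sum>w\<in>starters N t y. of_bool (w \<in> occ ?c t y)) / (real (card (occ ?c t y)))\<^sup>2) else 0)"
        by (cases "y = y'") (simp_all only: sum_distrib_left sum_divide_distrib if_True if_False sum.neutral_const simp_thms)
      also have "(\<Sum>w\<in>starters N t y. of_bool (w \<in> occ ?c t y)) = (\<Sum>w\<in>occ ?c t y. 1::real)"
        using occ_subset_starters[of ?c t y] by (intro sum.mono_neutral_cong_right) auto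
      finally show ?thesis by (simp add: D_def power2_eq_square)
    qed
    have "(\<integral>x. (\<Sum>w\<in>starters N t y. \<Sum>w'\<in>starters N t y'. G w w' x) \<partial>paths_measure)
        = (\<Sum>w\<in>starters N t y. \<Sum>w'\<in>starters N t y'. integral\<^sup>L paths_measure (G w w'))"
      using Gi by (subst Bochner_Integration.integral_sum) (auto intro!: sum.cong Bochner_Integration.integral_sum)
    also have "\<dots> = (\<Sum>w\<in>starters N t y. \<Sum>w'\<in>starters N t y'. integral\<^sup>L paths_measure (\<lambda>x. of_bool (w = w') * G w w' x))"
      using off by (intro sum.cong) auto
    also have "\<dots> = (\<integral>x. (\<Sum>w\<in>starters N t y. \<Sum>w'\<in>starters N t y'. of_bool (w = w') * G w w' x) \<partial>paths_measure)"
      using Gi by (subst Bochner_Integration.integral_sum)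
        (auto intro!: sum.cong Bochner_Integration.integral_sum[symmetric] integrable_mult_right Bochner_Integration.integrable_sum)
    also have "\<dots> = (\<integral>x. D (N, x) \<partial>paths_measure)" by (simp only: diag)
    also have "(\<lambda>x. \<Sum>w\<in>starters N t y. \<Sum>w'\<in>starters N t y'. G w w' x)
        = (\<lambda>x. H (N, x) * (drift (N, x) t y * drift (N, x) t y'))"
    proof
      fix x
      have "drift (N, x) t z = (\<Sum>w\<in>starters N t z. g w z (N, x))" for z
        unfolding drift_eq_starters g_def by simp
      then show "(\<Sum>w\<in>starters N t y. \<Sum>w'\<in>starters N t y'. G w w' x)
          = H (N, x) * (drift (N, x) t y * drift (N, x) t y')"
        by (simp only: G_def sum_product) (simp only: sum_distrib_left)
    qed
    finally show "(\<integral>x. H (N, x) * (drift (N, x) t y * drift (N, x) t y') \<partial>paths_measure) = (\<integral>x. D (N, x) \<partial>paths_measure)" .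
  qed measurable
  then show ?thesis by (auto simp: D_def visits_env)
qed

section \<open>Averages against the mass distribution\<close>

definition srw :: "(int \<Rightarrow> real) \<Rightarrow> int \<Rightarrow> real" where
  "srw h y = (h (y + 1) + h (y - 1)) / 2"

definition grad :: "(int \<Rightarrow> real) \<Rightarrow> int \<Rightarrow> real" where
  "grad h y = (h (y + 1) - h (y - 1)) / 2"

definition avg :: "environment \<Rightarrow> nat \<Rightarrow> (int \<Rightarrow> real) \<Rightarrow> real" where
  "avg \<omega> t h = (\<Sum>y\<in>{-int t..int t}. mass \<omega> t y * h y)"

lemma mass_nonneg [simp]: "0 \<le> mass \<omega> t y"
  by (induction t arbitrary: y) auto

lemma mass_outside: "int t < \<bar>y\<bar> \<Longrightarrow> mass \<omega> t y = 0"
proof (induction t arbitrary: y)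
  case (Suc t)
  then have "int t < \<bar>y + 1\<bar>" "int t < \<bar>y - 1\<bar>" by auto
  then show ?case using Suc.IH by simp
qed simp

lemma mass_parity: "odd (y + int t) \<Longrightarrow> mass \<omega> t y = 0"
proof (induction t arbitrary: y)
  case (Suc t)
  have "mass \<omega> t (y + 1) = 0" "mass \<omega> t (y - 1) = 0"
    using Suc.prems by (auto intro!: Suc.IH)
  then show ?case by simp
qed auto

lemma sum_window_shift:
  fixes F :: "int \<Rightarrow> real"
  assumes "\<And>y. int t < \<bar>y\<bar> \<Longrightarrow> F y = 0" "d = 1 \<or> d = -1"
  shows "(\<Sum>y\<in>{-int (Suc t)..int (Suc t)}. F (y + d)) = (\<Sum>y\<in>{-int t..int t}. F y)"
proof -
  have "(\<Sum>y\<in>{-int (Suc t)..int (Suc t)}. F (y + d)) = (\<Sum>y\<in>{-int (Suc t) + d..int (Suc t) + d}. F y)"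
    by (rule sum.reindex_bij_witness[of _ "\<lambda>y. y - d" "\<lambda>y. y + d"]) auto
  also have "\<dots> = (\<Sum>y\<in>{-int t..int t}. F y)"
    using assms(2) by (intro sum.mono_neutral_right) (auto intro!: assms(1))
  finally show ?thesis .
qed

lemma avg_Suc:
  "avg \<omega> (Suc t) h = avg \<omega> t (\<lambda>y. h (y - 1) * (real (e_minus \<omega> (int t) y) / real (visits \<omega> (int t) y))
      + h (y + 1) * (real (e_plus \<omega> (int t) y) / real (visits \<omega> (int t) y)))"
proof -
  define q where "q y = real (e_minus \<omega> (int t) y) / real (visits \<omega> (int t) y)" for y
  define r where "r y = real (e_plus \<omega> (int t) y) / real (visits \<omega> (int t) y)" for y
  let ?W = "{-int (Suc t)..int (Suc t)}"
  have "avg \<omega> (Suc t) h = (\<Sum>y\<in>?W. mass \<omega> t (y + 1) * (h y * q (y + 1))) + (\<Sum>y\<in>?W. mass \<omega> t (y - 1) * (h y * r (y - 1)))"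
    by (simp add: avg_def q_def r_def sum.distrib[symmetric] algebra_simps)
  also have "(\<Sum>y\<in>?W. mass \<omega> t (y + 1) * (h y * q (y + 1))) = avg \<omega> t (\<lambda>y. h (y - 1) * q y)"
    using sum_window_shift[of t "\<lambda>y. mass \<omega> t y * (h (y - 1) * q y)" 1] by (simp add: mass_outside avg_def)
  also have "(\<Sum>y\<in>?W. mass \<omega> t (y - 1) * (h y * r (y - 1))) = avg \<omega> t (\<lambda>y. h (y + 1) * r y)"
    using sum_window_shift[of t "\<lambda>y. mass \<omega> t y * (h (y + 1) * r y)" "-1"] by (simp add: mass_outside avg_def)
  finally show ?thesis by (simp add: avg_def q_def r_def sum.distrib[symmetric] algebra_simps)
qed

lemma avg_mono: "(\<And>y. h y \<le> h' y) \<Longrightarrow> avg \<omega> t h \<le> avg \<omega> t h'"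
  unfolding avg_def by (intro sum_mono mult_left_mono) auto

lemma avg_one_le: "avg \<omega> t (\<lambda>_. 1) \<le> 1"
proof (induction t)
  case (Suc t)
  have "avg \<omega> (Suc t) (\<lambda>_. 1) \<le> avg \<omega> t (\<lambda>_. 1)"
    unfolding avg_Suc
  proof (rule avg_mono)
    fix y
    show "1 * (real (e_minus \<omega> (int t) y) / real (visits \<omega> (int t) y)) + 1 * (real (e_plus \<omega> (int t) y) / real (visits \<omega> (int t) y)) \<le> 1"
      by (cases "visits \<omega> (int t) y = 0") (auto simp: visits_def field_simps)
  qed
  then show ?case using Suc by simp
qed (simp add: avg_def)

lemma mass_le_1: "mass \<omega> t y \<le> 1"
proof (cases "y \<in> {-int t..int t}")
  case True
  then have "mass \<omega> t y \<le> avg \<omega> t (\<lambda>_. 1)"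
    unfolding avg_def by (auto intro!: member_le_sum[of y _ "mass \<omega> t"])
  then show ?thesis using avg_one_le[of \<omega> t] by simp
next
  case False
  then have "int t < \<bar>y\<bar>" by auto
  then show ?thesis by (simp add: mass_outside)
qed

text \<open>Once the origin is occupied, mass is always carried by particles, and no mass is lost in a
vanishing denominator.\<close>

lemma visits_pos_if_mass:
  assumes "0 < fst c 0" "mass (env c) t y \<noteq> 0"
  shows "0 < vis c t y"
  using assms(2)
proof (induction t arbitrary: y)
  case 0
  then have "(0, 1) \<in> occ c 0 y"
    using assms(1) by (auto simp: occ_def walkers_def split: if_splits)
  then show ?case unfolding visits_env using card_gt_0_iff finite_occ by fastforce
next
  case (Suc t)
  have "e_minus (env c) (int t) (y + 1) \<noteq> 0 \<or> e_plus (env c) (int t) (y - 1) \<noteq> 0"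
    using Suc.prems by (auto simp: mass.simps)
  then have "(\<exists>w\<in>occ c t (y + 1). step c t w = -1) \<or> (\<exists>w\<in>occ c t (y - 1). step c t w = 1)"
    unfolding e_plus_env e_minus_env card_eq_0_iff by blast
  then obtain w where "w \<in> walkers c" "pos c t w + step c t w = y"
    unfolding occ_def by force
  then have "w \<in> occ c (Suc t) y"
    by (simp add: occ_def pos_Suc)
  then show ?case unfolding visits_env using card_gt_0_iff finite_occ by blast
qed

text \<open>One time step acts on test functions as the simple random walk, up to the random term with the
drift.\<close>

lemma avg_step:
  assumes "0 < fst c 0"
  shows "avg (env c) (Suc t) h = avg (env c) t (\<lambda>y. srw h y + drift c t y * grad h y)"
  unfolding avg_Suc unfolding avg_def
proof (rule sum.cong[OF refl])
  fix y
  show "mass (env c) t y * (h (y - 1) * (real (e_minus (env c) (int t) y) / real (vis c t y))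
      + h (y + 1) * (real (e_plus (env c) (int t) y) / real (vis c t y)))
    = mass (env c) t y * (srw h y + drift c t y * grad h y)"
  proof (cases "mass (env c) t y = 0")
    case False
    define a b where "a = real (e_plus (env c) (int t) y)" and "b = real (e_minus (env c) (int t) y)"
    have ab: "a + b > 0"
      using visits_pos_if_mass[OF assms False] unfolding visits_def a_def b_def by linarith
    have "h (y - 1) * (b / (a + b)) + h (y + 1) * (a / (a + b)) = srw h y + (a - b) / (a + b) * grad h y"
    proof -
      define u where "u = (a - b) / (a + b)"
      have "a / (a + b) = (1 + u) / 2" "b / (a + b) = (1 - u) / 2"
        using ab by (simp_all add: u_def field_simps)
      moreover have "h (y - 1) * ((1 - u) / 2) + h (y + 1) * ((1 + u) / 2) = srw h y + u * grad h y"
        by (simp add: srw_def grad_def field_simps)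
      ultimately show ?thesis by (simp only: u_def[symmetric])
    qed
    then show ?thesis by (simp add: drift_def visits_def a_def b_def)
  qed simp
qed

lemma measurable_avg [measurable]: "(\<lambda>\<omega>. avg \<omega> t h) \<in> borel_measurable environment_space"
  unfolding avg_def by measurable

lemma measurable_avg_env [measurable]: "observable (\<lambda>c. avg (env c) t h)"
  by (rule measurable_compose[OF measurable_env measurable_avg])

lemma agree_avg: "agree t c c' \<Longrightarrow> avg (env c) t h = avg (env c') t h"
  by (simp add: avg_def agree_mass)

definition occupied :: "config \<Rightarrow> real" where
  "occupied c = of_bool (0 < fst c 0)"

lemma measurable_occupied [measurable]: "observable occupied"
  unfolding occupied_def[abs_def] by measurable

lemma agree_occupied: "agree t c c' \<Longrightarrow> occupied c = occupied c'"
  by (simp add: occupied_def agree_def)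

lemma occupied_bounds: "0 \<le> occupied c" "occupied c \<le> 1" "\<bar>occupied c\<bar> \<le> 1"
  by (simp_all add: occupied_def)

lemma abs_avg_le: 
  assumes "\<And>y. \<bar>y\<bar> \<le> int t \<Longrightarrow> \<bar>h y\<bar> \<le> B"
  shows "\<bar>avg \<omega> t h\<bar> \<le> B"
proof -
  have B: "0 \<le> B" using assms[of 0] by auto
  have "\<bar>avg \<omega> t h\<bar> \<le> (\<Sum>y\<in>{-int t..int t}. mass \<omega> t y * B)"
    unfolding avg_def
    by (rule order_trans[OF sum_abs]) (auto intro!: sum_mono mult_left_mono assms simp: abs_mult)
  also have "\<dots> = avg \<omega> t (\<lambda>_. 1) * B" by (simp add: avg_def sum_distrib_right)
  also have "\<dots> \<le> 1 * B" using avg_one_le B by (intro mult_right_mono) auto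
  finally show ?thesis by simp
qed

lemma ex_bound_window: "\<exists>B. \<forall>y. \<bar>y\<bar> \<le> int t \<longrightarrow> \<bar>h y\<bar> \<le> (B::real)"
proof (intro exI allI impI)
  fix y :: int assume "\<bar>y\<bar> \<le> int t"
  then show "\<bar>h y\<bar> \<le> (\<Sum>z\<in>{-int t..int t}. \<bar>h z\<bar>)"
    by (intro member_le_sum) auto
qed

lemma integrable_avg_weighted:
  assumes "observable Z" "\<And>c. \<bar>Z c\<bar> \<le> (B::real)"
  shows "integrable config_measure (\<lambda>c. Z c * avg (env c) t h)"
proof -
  obtain C where C: "\<And>y. \<bar>y\<bar> \<le> int t \<Longrightarrow> \<bar>h y\<bar> \<le> C" using ex_bound_window[of t h] by auto
  have "0 \<le> B" using assms(2)[of "(\<lambda>_. 0, \<lambda>_ _. 0)"] by simp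
  then have "\<bar>Z c * avg (env c) t h\<bar> \<le> B * C" for c
    using mult_mono[OF assms(2)[of c] abs_avg_le[of t h C "env c", OF C]] by (simp add: abs_mult)
  then show ?thesis
    by (intro integrable_config[where B = "B * C"] borel_measurable_times assms(1) measurable_avg_env)
qed

lemma expectation_avg_Suc:
  "expect (\<lambda>c. occupied c * avg (env c) (Suc t) h) = expect (\<lambda>c. occupied c * avg (env c) t (srw h))"
proof -
  have meas: "observable (\<lambda>c. occupied c * (mass (env c) t y * grad h y))" for y
    by measurable
  have bnd: "\<bar>occupied c * (mass (env c) t y * grad h y)\<bar> \<le> \<bar>grad h y\<bar>" for c y
    using mass_le_1[of "env c" t y] by (auto simp: occupied_def abs_mult intro!: mult_left_le_one_le)
  have zero: "expect (\<lambda>c. (occupied c * (mass (env c) t y * grad h y)) * drift c t y) = 0" for y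
    by (rule expectation_adapted_drift[OF meas bnd])
      (auto simp: adapted_def agree_occupied agree_mass)
  have int: "integrable config_measure (\<lambda>c. (occupied c * (mass (env c) t y * grad h y)) * drift c t y)" for y
  proof (rule integrable_config)
    show "\<bar>(occupied c * (mass (env c) t y * grad h y)) * drift c t y\<bar> \<le> \<bar>grad h y\<bar>" for c
      using mult_mono[OF bnd[of c y] abs_drift_le[of c t y]] by (simp add: abs_mult)
  qed measurable
  have "expect (\<lambda>c. occupied c * avg (env c) (Suc t) h)
     = expect (\<lambda>c. occupied c * avg (env c) t (srw h) + (\<Sum>y\<in>{-int t..int t}. (occupied c * (mass (env c) t y * grad h y)) * drift c t y))"
  proof (rule Bochner_Integration.integral_cong[OF refl])
    fix c
    show "occupied c * avg (env c) (Suc t) h = occupied c * avg (env c) t (srw h) + (\<Sum>y\<in>{-int t..int t}. (occupied c * (mass (env c) t y * grad h y)) * drift c t y)"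
    proof (cases "0 < fst c 0")
      case True
      show ?thesis unfolding avg_step[OF True]
        by (simp add: avg_def sum.distrib[symmetric] sum_distrib_left algebra_simps)
    qed (simp add: occupied_def)
  qed
  also have "\<dots> = expect (\<lambda>c. occupied c * avg (env c) t (srw h))"
    using integrable_avg_weighted[OF measurable_occupied occupied_bounds(3)] int
    by (simp add: Bochner_Integration.integral_add Bochner_Integration.integral_sum zero)
  finally show ?thesis .
qed

lemma expectation_avg:
  "expect (\<lambda>c. occupied c * avg (env c) t h) = (srw ^^ t) h 0 * integral\<^sup>L config_measure occupied"
proof (induction t arbitrary: h)
  case 0
  show ?case by (simp add: avg_def mult.commute)
next
  case (Suc t)
  then show ?case by (simp only: expectation_avg_Suc funpow_Suc_right o_apply)
qed

lemma srw_mono: "(\<And>y. h y \<le> h' y) \<Longrightarrow> srw h y \<le> srw h' y"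
  by (simp add: srw_def add_mono)

lemma srw_funpow_mono: "(\<And>y. h y \<le> h' y) \<Longrightarrow> (srw ^^ n) h y \<le> (srw ^^ n) h' y"
  by (induction n arbitrary: y) (auto intro: srw_mono)

lemma srw_funpow_square: "(srw ^^ n) (\<lambda>y. a * (real_of_int y)\<^sup>2 + b) = (\<lambda>y. a * ((real_of_int y)\<^sup>2 + real n) + b)"
proof (induction n)
  case (Suc n)
  then show ?case by (auto simp: srw_def fun_eq_iff power2_eq_square algebra_simps)
qed (simp add: algebra_simps)

lemma srw_funpow_abs_le: "(srw ^^ n) (\<lambda>y. \<bar>real_of_int y\<bar>) 0 \<le> sqrt (real n)"
proof (cases "n = 0")
  case False
  then have s: "sqrt (real n) > 0" by simp
  have "\<bar>u\<bar> \<le> (1 / (2 * sqrt n)) * u\<^sup>2 + sqrt n / 2" for u :: real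
  proof -
    have "0 \<le> (\<bar>u\<bar> - sqrt n)\<^sup>2" by simp
    also have "(\<bar>u\<bar> - sqrt n)\<^sup>2 = u\<^sup>2 + sqrt n * sqrt n - 2 * sqrt n * \<bar>u\<bar>" by (simp add: power2_eq_square algebra_simps)
    finally show ?thesis using s by (simp add: field_simps)
  qed
  then have "(srw ^^ n) (\<lambda>y. \<bar>real_of_int y\<bar>) 0 \<le> (srw ^^ n) (\<lambda>y. (1 / (2 * sqrt n)) * (real_of_int y)\<^sup>2 + sqrt n / 2) 0"
    by (intro srw_funpow_mono)
  also have "\<dots> = n / (2 * sqrt n) + sqrt n / 2" by (subst srw_funpow_square) simp
  also have "\<dots> = sqrt n" using s by (simp add: field_simps)
  finally show ?thesis .
qed simp

section \<open>Mean distance of two walkers\<close>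

text \<open>The mean distance of two walkers that move independently in the same environment.\<close>

definition spread :: "environment \<Rightarrow> nat \<Rightarrow> real" where
  "spread \<omega> t = avg \<omega> t (\<lambda>y. avg \<omega> t (\<lambda>z. \<bar>real_of_int (y - z)\<bar>))"

text \<open>The expectation of \<open>f\<close> at the common position of two independent walkers in the environment
\<open>\<omega>\<close>, on the event that they are at the same site at time \<open>t\<close>.\<close>

definition mass2 :: "environment \<Rightarrow> nat \<Rightarrow> (int \<Rightarrow> real) \<Rightarrow> real" where
  "mass2 \<omega> t f = (\<Sum>y\<in>{-int t..int t}. (mass \<omega> t y)\<^sup>2 * f y)"

lemma srw_avg: "srw (\<lambda>y. avg \<omega> t (k y)) x = avg \<omega> t (\<lambda>z. srw (\<lambda>y. k y z) x)"
  and grad_avg: "grad (\<lambda>y. avg \<omega> t (k y)) x = avg \<omega> t (\<lambda>z. grad (\<lambda>y. k y z) x)"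
  unfolding srw_def grad_def avg_def sum.distrib[symmetric] sum_subtractf[symmetric] sum_divide_distrib
  by (intro sum.cong refl; simp add: field_simps)+

lemma two_point_expansion:
  "srw (\<lambda>y'. srw (k y') z + v * grad (k y') z) y + u * grad (\<lambda>y'. srw (k y') z + v * grad (k y') z) y
   = srw (\<lambda>y'. srw (k y') z) y + u * srw (\<lambda>z'. grad (\<lambda>y'. k y' z') y) z
     + v * srw (\<lambda>y'. grad (k y') z) y + u * v * grad (\<lambda>y'. grad (k y') z) y"
  by (simp add: srw_def grad_def field_simps)

text \<open>Sites of positive mass have the parity of \<open>t\<close>, so that the distance of two walkers is even. The
average of the absolute value over two independent fair steps exceeds its value by \<open>1\<close> at
distance \<open>0\<close>, and agrees with it at distances of at least \<open>2\<close>.\<close>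

lemma spread_Suc:
  assumes "0 < fst c 0"
  shows "spread (env c) (Suc t) = (\<Sum>y\<in>{-int t..int t}. \<Sum>z\<in>{-int t..int t}. mass (env c) t y * mass (env c) t z *
    (\<bar>real_of_int (y - z)\<bar> + of_bool (y = z)
      + drift c t y * (srw (\<lambda>z'. grad (\<lambda>y'. \<bar>real_of_int (y' - z')\<bar>) y) z)
      + drift c t z * (srw (\<lambda>y'. grad (\<lambda>z'. \<bar>real_of_int (y' - z')\<bar>) z) y)
      + drift c t y * drift c t z * (grad (\<lambda>y'. grad (\<lambda>z'. \<bar>real_of_int (y' - z')\<bar>) z) y)))"
proof -
  let ?d = "\<lambda>y z. \<bar>real_of_int (y - z)\<bar>"
  have "spread (env c) (Suc t) = avg (env c) t (\<lambda>y. srw (\<lambda>y'. avg (env c) t (\<lambda>z. srw (?d y') z + drift c t z * grad (?d y') z)) y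
     + drift c t y * grad (\<lambda>y'. avg (env c) t (\<lambda>z. srw (?d y') z + drift c t z * grad (?d y') z)) y)"
    by (simp add: spread_def avg_step[OF assms])
  also have "\<dots> = (\<Sum>y\<in>{-int t..int t}. \<Sum>z\<in>{-int t..int t}. mass (env c) t y * mass (env c) t z *
     (srw (\<lambda>y'. srw (?d y') z + drift c t z * grad (?d y') z) y + drift c t y * grad (\<lambda>y'. srw (?d y') z + drift c t z * grad (?d y') z) y))"
    unfolding srw_avg grad_avg
    unfolding avg_def sum_distrib_left sum.distrib[symmetric]
    by (intro sum.cong refl) (simp add: algebra_simps)
  also have "\<dots> = (\<Sum>y\<in>{-int t..int t}. \<Sum>z\<in>{-int t..int t}. mass (env c) t y * mass (env c) t z *
    (?d y z + of_bool (y = z) + drift c t y * (srw (\<lambda>z'. grad (\<lambda>y'. ?d y' z') y) z)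
      + drift c t z * (srw (\<lambda>y'. grad (\<lambda>z'. ?d y' z') z) y)
      + drift c t y * drift c t z * (grad (\<lambda>y'. grad (\<lambda>z'. ?d y' z') z) y)))"
  proof (intro sum.cong refl)
    fix y z
    show "mass (env c) t y * mass (env c) t z *
     (srw (\<lambda>y'. srw (?d y') z + drift c t z * grad (?d y') z) y + drift c t y * grad (\<lambda>y'. srw (?d y') z + drift c t z * grad (?d y') z) y)
     = mass (env c) t y * mass (env c) t z *
    (?d y z + of_bool (y = z) + drift c t y * (srw (\<lambda>z'. grad (\<lambda>y'. ?d y' z') y) z)
      + drift c t z * (srw (\<lambda>y'. grad (\<lambda>z'. ?d y' z') z) y)
      + drift c t y * drift c t z * (grad (\<lambda>y'. grad (\<lambda>z'. ?d y' z') z) y))"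
    proof (cases "odd (y - z)")
      case True
      then have "odd (y + int t) \<or> odd (z + int t)" by auto
      then show ?thesis using mass_parity by auto
    next
      case False
      have "srw (\<lambda>y'. srw (?d y') z) y = ?d y z + of_bool (y = z)"
      proof -
        have "y - z = 0 \<or> y - z \<ge> 2 \<or> y - z \<le> -2"
        proof -
          from False obtain k where k: "y - z = 2 * k" by (metis evenE)
          then show ?thesis by presburger
        qed
        then show ?thesis by (auto simp: srw_def) (simp_all add: field_simps)
      qed
      then show ?thesis by (simp only: two_point_expansion)
    qed
  qed
  finally show ?thesis .
qed

abbreviation mean_collisions :: "nat \<Rightarrow> real" where
  "mean_collisions t \<equiv> expect (\<lambda>c. occupied c * mass2 (env c) t (\<lambda>_. 1))"

text \<open>Two walkers at the same site separate unless they follow the same particle, which has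
probability \<open>1 / visits\<close>, or different ones in the same direction. In the expansion
\<open>spread_Suc\<close>, this is the diagonal term with the product of the drifts; the other terms with
drifts have mean zero.\<close>

lemma expectation_spread_Suc:
  "expect (\<lambda>c. occupied c * spread (env c) (Suc t))
   = expect (\<lambda>c. occupied c * spread (env c) t)
     + expect (\<lambda>c. occupied c * mass2 (env c) t (\<lambda>y. 1 - 1 / real (vis c t y)))"
proof -
  let ?W = "{-int t..int t}"
  let ?d = "\<lambda>y z. \<bar>real_of_int (y - z)\<bar>"
  define w where "w y z c = occupied c * (mass (env c) t y * mass (env c) t z)" for y z c
  define B where "B y z = srw (\<lambda>z'. grad (\<lambda>y'. ?d y' z') y) z" for y z
  define C where "C y z = srw (\<lambda>y'. grad (\<lambda>z'. ?d y' z') z) y" for y z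
  define D where "D y z = grad (\<lambda>y'. grad (\<lambda>z'. ?d y' z') z) y" for y z
  have wm [measurable]: "observable (w y z)" for y z
    unfolding w_def[abs_def] by measurable
  have w_bnd: "\<bar>w y z c * r\<bar> \<le> \<bar>r\<bar>" for y z c r
  proof -
    have "mass (env c) t y * mass (env c) t z \<le> 1"
      using mult_mono[OF mass_le_1 mass_le_1, of "env c" t z "env c" t y] by (simp add: mult.commute)
    then have "\<bar>w y z c\<bar> \<le> 1" by (auto simp: w_def occupied_def)
    then have "\<bar>w y z c\<bar> * \<bar>r\<bar> \<le> 1 * \<bar>r\<bar>" by (intro mult_right_mono) auto
    then show ?thesis by (simp add: abs_mult)
  qed
  have wa: "adapted t (\<lambda>c. w y z c * r)" for y z r
    by (auto simp: adapted_def w_def agree_occupied agree_mass)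
  have i1: "integrable config_measure (\<lambda>c. w y z c * r)" for y z r
    by (rule integrable_config[OF _ w_bnd]) measurable
  have i2: "integrable config_measure (\<lambda>c. w y z c * r * drift c t x)" for y z r x
  proof (rule integrable_config)
    show "\<bar>w y z c * r * drift c t x\<bar> \<le> \<bar>r\<bar>" for c
      using mult_mono[OF w_bnd[of y z c r] abs_drift_le[of c t x]] by (simp add: abs_mult)
  qed measurable
  have i3: "integrable config_measure (\<lambda>c. w y z c * r * (drift c t x * drift c t x'))" for y z r x x'
  proof (rule integrable_config)
    show "\<bar>w y z c * r * (drift c t x * drift c t x')\<bar> \<le> \<bar>r\<bar>" for c
      using mult_mono[OF w_bnd[of y z c r] mult_mono[OF abs_drift_le[of c t x] abs_drift_le[of c t x']]]
      by (simp add: abs_mult)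
  qed measurable
  have i4: "integrable config_measure (\<lambda>c. w y z c * (1 - 1 / real (vis c t y)))" for y z
  proof (rule integrable_config)
    fix c
    have "\<bar>1 - 1 / real (vis c t y)\<bar> \<le> 1"
      by (cases "vis c t y") (auto simp: divide_le_eq)
    with w_bnd[of y z c] show "\<bar>w y z c * (1 - 1 / real (vis c t y))\<bar> \<le> 1"
      by (rule order_trans)
  qed measurable
  have z1: "expect (\<lambda>c. w y z c * r * drift c t x) = 0" for y z r x
    by (rule expectation_adapted_drift[OF _ w_bnd wa]) measurable
  have z2: "expect (\<lambda>c. w y z c * r * (drift c t x * drift c t x'))
     = (if x = x' then expect (\<lambda>c. w y z c * r / real (vis c t x)) else 0)" for y z r x x'
    by (rule expectation_adapted_drift2[OF _ w_bnd wa]) measurable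
  have "expect (\<lambda>c. occupied c * spread (env c) (Suc t))
     = expect (\<lambda>c. (\<Sum>y\<in>?W. \<Sum>z\<in>?W. w y z c * (?d y z + of_bool (y = z)) + w y z c * B y z * drift c t y
        + w y z c * C y z * drift c t z + w y z c * D y z * (drift c t y * drift c t z)))"
  proof (rule Bochner_Integration.integral_cong[OF refl])
    fix c
    show "occupied c * spread (env c) (Suc t) = (\<Sum>y\<in>?W. \<Sum>z\<in>?W. w y z c * (?d y z + of_bool (y = z)) + w y z c * B y z * drift c t y
        + w y z c * C y z * drift c t z + w y z c * D y z * (drift c t y * drift c t z))"
    proof (cases "0 < fst c 0")
      case True
      show ?thesis
        unfolding spread_Suc[OF True] sum_distrib_left
        unfolding B_def[symmetric] C_def[symmetric] D_def[symmetric] w_def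
        by (intro sum.cong refl) (simp add: algebra_simps)
    qed (simp add: occupied_def w_def)
  qed
  also have "\<dots> = (\<Sum>y\<in>?W. \<Sum>z\<in>?W. (expect (\<lambda>c. w y z c * (?d y z + of_bool (y = z))))
       + (if y = z then expect (\<lambda>c. w y z c * D y z / real (vis c t y)) else 0))"
    by (simp only: Bochner_Integration.integral_sum Bochner_Integration.integral_add
        Bochner_Integration.integrable_add Bochner_Integration.integrable_sum i1 i2 i3 z1 z2 add_0_right)
  also have "\<dots> = (\<Sum>y\<in>?W. \<Sum>z\<in>?W. (expect (\<lambda>c. w y z c * ?d y z))
       + (if y = z then expect (\<lambda>c. w y z c * (1 - 1 / real (vis c t y))) else 0))"
  proof (intro sum.cong refl)
    fix y z
    show "expect (\<lambda>c. w y z c * (?d y z + of_bool (y = z)))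
       + (if y = z then expect (\<lambda>c. w y z c * D y z / real (vis c t y)) else 0)
       = expect (\<lambda>c. w y z c * ?d y z)
       + (if y = z then expect (\<lambda>c. w y z c * (1 - 1 / real (vis c t y))) else 0)"
    proof (cases "y = z")
      case True
      \<comment> \<open>On the diagonal the second difference of the absolute value is negative, which produces the loss 1 / visits.\<close>
      have D: "D y y = -1" by (simp add: D_def grad_def)
      have i5: "integrable config_measure (\<lambda>c. w y y c * D y y / real (vis c t y))"
        using Bochner_Integration.integrable_diff[OF i4[of y y] i1[of y y 1]] by (simp add: D algebra_simps)
      have "expect (\<lambda>c. w y y c * 1) + expect (\<lambda>c. w y y c * D y y / real (vis c t y))
        = expect (\<lambda>c. w y y c * (1 - 1 / real (vis c t y)))"
        using i1[of y y 1] i5 by (subst Bochner_Integration.integral_add[symmetric]) (auto simp: D algebra_simps)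
      then show ?thesis using True by simp
    qed simp
  qed
  also have "\<dots> = (\<Sum>y\<in>?W. \<Sum>z\<in>?W. (expect (\<lambda>c. w y z c * ?d y z)))
     + (\<Sum>y\<in>?W. (expect (\<lambda>c. w y y c * (1 - 1 / real (vis c t y)))))"
  proof -
    have "(\<Sum>z\<in>?W. if y = z then expect (\<lambda>c. w y z c * (1 - 1 / real (vis c t y))) else 0)
      = expect (\<lambda>c. w y y c * (1 - 1 / real (vis c t y)))" if "y \<in> ?W" for y
      using that by (subst sum.delta') auto
    then show ?thesis by (simp add: sum.distrib)
  qed
  also have "(\<Sum>y\<in>?W. \<Sum>z\<in>?W. (expect (\<lambda>c. w y z c * ?d y z))) = expect (\<lambda>c. (\<Sum>y\<in>?W. \<Sum>z\<in>?W. w y z c * ?d y z))"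
    by (simp only: Bochner_Integration.integral_sum Bochner_Integration.integrable_sum i1)
  also have "(\<lambda>c. \<Sum>y\<in>?W. \<Sum>z\<in>?W. w y z c * ?d y z) = (\<lambda>c. occupied c * spread (env c) t)"
    by (simp add: spread_def avg_def w_def sum_distrib_left mult.assoc del: of_int_diff)
  also have "(\<Sum>y\<in>?W. (expect (\<lambda>c. w y y c * (1 - 1 / real (vis c t y)))))
     = expect (\<lambda>c. (\<Sum>y\<in>?W. w y y c * (1 - 1 / real (vis c t y))))"
    by (simp add: Bochner_Integration.integral_sum i4)
  also have "(\<lambda>c. \<Sum>y\<in>?W. w y y c * (1 - 1 / real (vis c t y)))
     = (\<lambda>c. occupied c * mass2 (env c) t (\<lambda>y. 1 - 1 / real (vis c t y)))"
    by (simp add: mass2_def w_def sum_distrib_left mult.assoc power2_eq_square)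
  finally show ?thesis .
qed

lemma spread_le: "spread \<omega> t \<le> 2 * avg \<omega> t (\<lambda>y. \<bar>real_of_int y\<bar>)"
proof -
  let ?a = "avg \<omega> t (\<lambda>y. \<bar>real_of_int y\<bar>)"
  have a0: "0 \<le> ?a" unfolding avg_def by (intro sum_nonneg) auto
  have "avg \<omega> t (\<lambda>z. \<bar>real_of_int (y - z)\<bar>) \<le> \<bar>real_of_int y\<bar> + ?a" for y
  proof -
    have "avg \<omega> t (\<lambda>z. \<bar>real_of_int (y - z)\<bar>) \<le> avg \<omega> t (\<lambda>z. \<bar>real_of_int y\<bar> + \<bar>real_of_int z\<bar>)"
      by (rule avg_mono) auto
    also have "\<dots> = \<bar>real_of_int y\<bar> * avg \<omega> t (\<lambda>_. 1) + ?a"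
      by (simp add: avg_def sum.distrib sum_distrib_left algebra_simps)
    also have "\<dots> \<le> \<bar>real_of_int y\<bar> * 1 + ?a"
      by (intro add_right_mono mult_left_mono avg_one_le) auto
    finally show ?thesis by simp
  qed
  then have "spread \<omega> t \<le> avg \<omega> t (\<lambda>y. \<bar>real_of_int y\<bar> + ?a)"
    unfolding spread_def by (rule avg_mono)
  also have "\<dots> = ?a + ?a * avg \<omega> t (\<lambda>_. 1)"
  proof -
    have "avg \<omega> t (\<lambda>y. h y + a) = avg \<omega> t h + a * avg \<omega> t (\<lambda>_. 1)" for h a
      by (simp add: avg_def sum.distrib sum_distrib_left algebra_simps)
    then show ?thesis .
  qed
  also have "\<dots> \<le> ?a + ?a * 1"
    using a0 by (intro add_left_mono mult_left_mono avg_one_le) auto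
  finally show ?thesis by simp
qed

lemma spread_nonneg: "0 \<le> spread \<omega> t"
  unfolding spread_def avg_def by (intro sum_nonneg mult_nonneg_nonneg) auto

lemma expectation_spread_le: "expect (\<lambda>c. occupied c * spread (env c) t) \<le> 2 * sqrt (real t)"
proof -
  let ?a = "\<lambda>c. avg (env c) t (\<lambda>y. \<bar>real_of_int y\<bar>)"
  have i: "integrable config_measure (\<lambda>c. occupied c * ?a c)"
    by (rule integrable_avg_weighted[OF measurable_occupied occupied_bounds(3)])
  have "expect (\<lambda>c. occupied c * spread (env c) t) \<le> expect (\<lambda>c. 2 * (occupied c * ?a c))"
  proof (rule integral_mono_AE')
    show "integrable config_measure (\<lambda>c. 2 * (occupied c * ?a c))" using i by simp
    show "AE c in config_measure. occupied c * spread (env c) t \<le> 2 * (occupied c * ?a c)"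
      using mult_left_mono[OF spread_le occupied_bounds(1)] by (auto simp: algebra_simps)
    show "AE c in config_measure. 0 \<le> 2 * (occupied c * ?a c)"
      by (simp add: avg_def sum_nonneg occupied_bounds)
  qed
  also have "\<dots> = 2 * ((srw ^^ t) (\<lambda>y. \<bar>real_of_int y\<bar>) 0 * integral\<^sup>L config_measure occupied)"
    by (simp add: expectation_avg)
  also have "\<dots> \<le> 2 * (sqrt (real t) * 1)"
  proof -
    have "integral\<^sup>L config_measure occupied \<le> 1"
      using cfg.integral_le_const[of occupied 1] integrable_config[OF measurable_occupied occupied_bounds(3)]
      by (auto simp: occupied_bounds)
    moreover have "0 \<le> integral\<^sup>L config_measure occupied" by (intro integral_nonneg_AE) (simp add: occupied_bounds)
    ultimately show ?thesis
      using mult_mono[OF srw_funpow_abs_le[of t], of "integral\<^sup>L config_measure occupied" 1] by simp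
  qed
  finally show ?thesis by simp
qed

lemma sum_expectation_noncoalescing:
  "(\<Sum>s<T. expect (\<lambda>c. occupied c * mass2 (env c) s (\<lambda>y. 1 - 1 / real (vis c s y)))) \<le> 2 * sqrt (real T)"
proof -
  have "(\<Sum>s<T. expect (\<lambda>c. occupied c * mass2 (env c) s (\<lambda>y. 1 - 1 / real (vis c s y))))
    = expect (\<lambda>c. occupied c * spread (env c) T) - expect (\<lambda>c. occupied c * spread (env c) 0)"
    by (induction T) (simp_all add: expectation_spread_Suc)
  also have "\<dots> \<le> 2 * sqrt (real T) - 0"
    by (intro diff_mono expectation_spread_le integral_nonneg_AE) (simp add: spread_nonneg occupied_bounds)
  finally show ?thesis by simp
qed

section \<open>Charging meetings to crowded sites\<close>

text \<open>The value of \<open>f\<close> at the site which the mass from \<open>(t, y)\<close> reaches after \<open>n\<close> steps, if up to then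
it is carried by a single particle; otherwise \<open>0\<close>.\<close>

fun run :: "environment \<Rightarrow> nat \<Rightarrow> (nat \<Rightarrow> int \<Rightarrow> real) \<Rightarrow> nat \<Rightarrow> int \<Rightarrow> real" where
  "run \<omega> 0 f t y = f t y"
| "run \<omega> (Suc n) f t y = (if visits \<omega> (int t) y = 1
     then run \<omega> n f (Suc t) (if e_plus \<omega> (int t) y = 1 then y + 1 else y - 1) else 0)"

text \<open>From \<open>(t, y)\<close>, a particle is alone at all times from \<open>t\<close> to \<open>t + n\<close>.\<close>

definition lone :: "environment \<Rightarrow> nat \<Rightarrow> nat \<Rightarrow> int \<Rightarrow> bool" where
  "lone \<omega> n t y \<longleftrightarrow> run \<omega> n (\<lambda>s z. of_bool (visits \<omega> (int s) z = 1)) t y \<noteq> 0"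

lemma run_nonneg: "(\<And>s z. 0 \<le> f s z) \<Longrightarrow> 0 \<le> run \<omega> n f t y"
  by (induction n arbitrary: t y) auto

lemma mass2_mono: "(\<And>y. f y \<le> g y) \<Longrightarrow> mass2 \<omega> t f \<le> mass2 \<omega> t g"
  unfolding mass2_def by (intro sum_mono mult_left_mono) auto

text \<open>The mass at a site with one particle moves as a whole, and squares are superadditive where masses
merge.\<close>

lemma mass2_step:
  assumes g: "\<And>y. 0 \<le> g y"
  shows "mass2 \<omega> t (\<lambda>y. if visits \<omega> (int t) y = 1 then g (if e_plus \<omega> (int t) y = 1 then y + 1 else y - 1) else 0)
    \<le> mass2 \<omega> (Suc t) g"
proof -
  define a where "a y = real (e_minus \<omega> (int t) y) / real (visits \<omega> (int t) y)" for y
  define b where "b y = real (e_plus \<omega> (int t) y) / real (visits \<omega> (int t) y)" for y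
  have ab: "0 \<le> a y" "0 \<le> b y" for y by (simp_all add: a_def b_def)
  let ?W = "{-int (Suc t)..int (Suc t)}"
  have "mass2 \<omega> t (\<lambda>y. if visits \<omega> (int t) y = 1 then g (if e_plus \<omega> (int t) y = 1 then y + 1 else y - 1) else 0)
     \<le> mass2 \<omega> t (\<lambda>y. (a y)\<^sup>2 * g (y - 1) + (b y)\<^sup>2 * g (y + 1))"
  proof (rule mass2_mono)
    fix y
    show "(if visits \<omega> (int t) y = 1 then g (if e_plus \<omega> (int t) y = 1 then y + 1 else y - 1) else 0)
      \<le> (a y)\<^sup>2 * g (y - 1) + (b y)\<^sup>2 * g (y + 1)"
    proof (cases "visits \<omega> (int t) y = 1")
      case True
      then have "e_plus \<omega> (int t) y = 1 \<and> e_minus \<omega> (int t) y = 0 \<or> e_plus \<omega> (int t) y = 0 \<and> e_minus \<omega> (int t) y = 1"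
        by (auto simp: visits_def)
      then show ?thesis using True by (auto simp: a_def b_def)
    qed (simp add: g)
  qed
  also have "\<dots> = (\<Sum>y\<in>{-int t..int t}. (mass \<omega> t y * a y)\<^sup>2 * g (y - 1)) + (\<Sum>y\<in>{-int t..int t}. (mass \<omega> t y * b y)\<^sup>2 * g (y + 1))"
    by (simp add: mass2_def sum.distrib algebra_simps power_mult_distrib)
  also have "\<dots> = (\<Sum>y\<in>?W. (mass \<omega> t (y + 1) * a (y + 1))\<^sup>2 * g y) + (\<Sum>y\<in>?W. (mass \<omega> t (y - 1) * b (y - 1))\<^sup>2 * g y)"
    using sum_window_shift[of t "\<lambda>y. (mass \<omega> t y * a y)\<^sup>2 * g (y - 1)" 1]
      sum_window_shift[of t "\<lambda>y. (mass \<omega> t y * b y)\<^sup>2 * g (y + 1)" "-1"]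
    by (simp add: mass_outside)
  also have "\<dots> = (\<Sum>y\<in>?W. ((mass \<omega> t (y + 1) * a (y + 1))\<^sup>2 + (mass \<omega> t (y - 1) * b (y - 1))\<^sup>2) * g y)"
    by (simp only: sum.distrib distrib_right)
  also have "\<dots> \<le> (\<Sum>y\<in>?W. (mass \<omega> (Suc t) y)\<^sup>2 * g y)"
  proof (intro sum_mono mult_right_mono g)
    fix y
    show "(mass \<omega> t (y + 1) * a (y + 1))\<^sup>2 + (mass \<omega> t (y - 1) * b (y - 1))\<^sup>2 \<le> (mass \<omega> (Suc t) y)\<^sup>2"
      using ab[of "y + 1"] ab[of "y - 1"] by (simp add: a_def[symmetric] b_def[symmetric] power2_sum)
  qed
  finally show ?thesis by (simp add: mass2_def)
qed

lemma mass2_run: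
  assumes "\<And>s z. 0 \<le> f s z"
  shows "mass2 \<omega> t (run \<omega> n f t) \<le> mass2 \<omega> (t + n) (f (t + n))"
proof (induction n arbitrary: t)
  case 0
  show ?case by (simp add: mass2_def)
next
  case (Suc n)
  have "run \<omega> (Suc n) f t = (\<lambda>y. if visits \<omega> (int t) y = 1
      then run \<omega> n f (Suc t) (if e_plus \<omega> (int t) y = 1 then y + 1 else y - 1) else 0)"
    by (rule ext) simp
  then have "mass2 \<omega> t (run \<omega> (Suc n) f t) \<le> mass2 \<omega> (Suc t) (run \<omega> n f (Suc t))"
    by (simp only:) (rule mass2_step, rule run_nonneg, rule assms)
  also have "\<dots> \<le> mass2 \<omega> (Suc t + n) (f (Suc t + n))" by (rule Suc.IH)
  finally show ?case by (simp only: add_Suc add_Suc_right)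
qed

text \<open>Starting at \<open>(t, y)\<close>, follow the particle: either it is alone during \<open>n\<close> steps, or there is a
first time, after \<open>j\<close> of them, at which it is not.\<close>

lemma run_decomposition:
  "1 \<le> (\<Sum>j\<le>n. run \<omega> j (\<lambda>s z. of_bool (visits \<omega> (int s) z \<noteq> 1)) t y) + of_bool (lone \<omega> n t y)"
proof (induction n arbitrary: t y)
  case (Suc n)
  let ?f = "\<lambda>s z. of_bool (visits \<omega> (int s) z \<noteq> 1) :: real"
  show ?case
  proof (cases "visits \<omega> (int t) y = 1")
    case True
    let ?y = "if e_plus \<omega> (int t) y = 1 then y + 1 else y - 1"
    have "(\<Sum>j\<le>Suc n. run \<omega> j ?f t y) = (\<Sum>j\<le>n. run \<omega> j ?f (Suc t) ?y)"
      using True by (subst sum.atMost_Suc_shift) simp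
    moreover have "lone \<omega> (Suc n) t y = lone \<omega> n (Suc t) ?y" using True by (simp add: lone_def)
    ultimately show ?thesis using Suc.IH[of "Suc t" ?y] by simp
  next
    case False
    have "(\<Sum>j\<le>0. run \<omega> j ?f t y) \<le> (\<Sum>j\<le>Suc n. run \<omega> j ?f t y)"
      by (intro sum_mono2) (auto intro!: run_nonneg)
    then show ?thesis using False by (simp del: sum.atMost_Suc)
  qed
qed (simp add: lone_def)

lemma mass2_le_1: 
  assumes "\<And>y. f y \<le> 1" shows "mass2 \<omega> t f \<le> 1"
proof -
  have "mass2 \<omega> t f \<le> avg \<omega> t (\<lambda>_. 1)"
    unfolding mass2_def avg_def
  proof (rule sum_mono)
    fix y
    have "(mass \<omega> t y)\<^sup>2 * f y \<le> (mass \<omega> t y)\<^sup>2 * 1" by (intro mult_left_mono assms) auto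
    also have "\<dots> \<le> mass \<omega> t y * 1"
      unfolding power2_eq_square by (simp add: mult_left_le mass_le_1)
    finally show "(mass \<omega> t y)\<^sup>2 * f y \<le> mass \<omega> t y * 1" .
  qed
  then show ?thesis using avg_one_le[of \<omega> t] by simp
qed

text \<open>A meeting of the two walkers at a lone particle persists until this particle meets another one,
and is there counted as a meeting at a crowded site.\<close>

lemma mass2_le_crowded_plus_lone:
  "mass2 \<omega> t (\<lambda>_. 1) \<le> (\<Sum>j\<le>n. mass2 \<omega> (t + j) (\<lambda>y. of_bool (visits \<omega> (int (t + j)) y \<noteq> 1)))
     + of_bool (\<exists>y\<in>{-int t..int t}. lone \<omega> n t y)"
proof -
  let ?f = "\<lambda>s z. of_bool (visits \<omega> (int s) z \<noteq> 1) :: real"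
  have "mass2 \<omega> t (\<lambda>_. 1) \<le> mass2 \<omega> t (\<lambda>y. (\<Sum>j\<le>n. run \<omega> j ?f t y) + of_bool (lone \<omega> n t y))"
    by (rule mass2_mono) (rule run_decomposition)
  also have "\<dots> = (\<Sum>j\<le>n. mass2 \<omega> t (run \<omega> j ?f t)) + mass2 \<omega> t (\<lambda>y. of_bool (lone \<omega> n t y))"
    unfolding mass2_def distrib_left sum.distrib sum_distrib_left by (simp add: sum.swap[of _ "{..n}"])
  also have "\<dots> \<le> (\<Sum>j\<le>n. mass2 \<omega> (t + j) (?f (t + j))) + of_bool (\<exists>y\<in>{-int t..int t}. lone \<omega> n t y)"
  proof (intro add_mono sum_mono mass2_run)
    show "mass2 \<omega> t (\<lambda>y. of_bool (lone \<omega> n t y)) \<le> of_bool (\<exists>y\<in>{-int t..int t}. lone \<omega> n t y)"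
    proof (cases "\<exists>y\<in>{-int t..int t}. lone \<omega> n t y")
      case True
      then show ?thesis using mass2_le_1[of "\<lambda>y. of_bool (lone \<omega> n t y)" \<omega> t] by simp
    qed (simp add: mass2_def)
  qed auto
  finally show ?thesis .
qed

lemma measurable_lone [measurable]: "Measurable.pred environment_space (\<lambda>\<omega>. lone \<omega> n t y)"
proof (induction n arbitrary: t y)
  case 0
  show ?case unfolding lone_def by simp
next
  case (Suc n)
  have eq: "lone \<omega> (Suc n) t y \<longleftrightarrow> visits \<omega> (int t) y = 1 \<and>
     (if e_plus \<omega> (int t) y = 1 then lone \<omega> n (Suc t) (y + 1) else lone \<omega> n (Suc t) (y - 1))" for \<omega>
    by (simp add: lone_def)
  note [measurable] = Suc.IH
  show ?case unfolding eq by measurable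
qed

lemma measurable_mass2_1 [measurable]: "(\<lambda>\<omega>. mass2 \<omega> t (\<lambda>_. 1)) \<in> borel_measurable environment_space"
  unfolding mass2_def by measurable

lemma mass2_nonneg: "(\<And>y. 0 \<le> f y) \<Longrightarrow> 0 \<le> mass2 \<omega> t f"
  unfolding mass2_def by (intro sum_nonneg) auto

text \<open>Where there are at least two particles, \<open>1 - 1 / visits\<close> is at least \<open>1 / 2\<close>, so that the growth of
the mean distance counts the meetings at crowded sites.\<close>

lemma sum_expectation_crowded:
  "(\<Sum>s<T. expect (\<lambda>c. occupied c * mass2 (env c) s (\<lambda>y. of_bool (vis c s y \<noteq> 1)))) \<le> 4 * sqrt (real T)"
proof -
  have "expect (\<lambda>c. occupied c * mass2 (env c) s (\<lambda>y. of_bool (vis c s y \<noteq> 1)))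
    \<le> 2 * expect (\<lambda>c. occupied c * mass2 (env c) s (\<lambda>y. 1 - 1 / real (vis c s y)))" (is "_ \<le> 2 * integral\<^sup>L _ ?g") for s
  proof -
    have *: "occupied c * mass2 (env c) s (\<lambda>y. of_bool (vis c s y \<noteq> 1)) \<le> 2 * ?g c" for c
    proof (cases "0 < fst c 0")
      case True
      have "mass2 (env c) s (\<lambda>y. of_bool (vis c s y \<noteq> 1)) \<le> (\<Sum>y\<in>{-int s..int s}. 2 * ((mass (env c) s y)\<^sup>2 * (1 - 1 / real (vis c s y))))"
        unfolding mass2_def
      proof (rule sum_mono)
        fix y
        show "(mass (env c) s y)\<^sup>2 * of_bool (vis c s y \<noteq> 1) \<le> 2 * ((mass (env c) s y)\<^sup>2 * (1 - 1 / real (vis c s y)))"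
        proof (cases "mass (env c) s y = 0")
          case False
          let ?v = "vis c s y"
          have v: "0 < ?v" by (rule visits_pos_if_mass[OF True False])
          have "of_bool (?v \<noteq> 1) \<le> 2 * (1 - 1 / real ?v)"
          proof (cases "?v = 1")
            case False
            then have "2 \<le> real ?v" using v by linarith
            then show ?thesis using False by (simp add: field_simps)
          qed simp
          from mult_left_mono[OF this, of "(mass (env c) s y)\<^sup>2"] show ?thesis by (simp add: algebra_simps)
        qed simp
      qed
      also have "\<dots> = 2 * mass2 (env c) s (\<lambda>y. 1 - 1 / real (vis c s y))"
        by (simp add: mass2_def sum_distrib_left)
      finally show ?thesis using True by (simp add: occupied_def)
    qed (simp add: occupied_def)
    have g0: "0 \<le> 1 - 1 / real (visits \<omega> (int s) y)" for \<omega> y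
      by (cases "visits \<omega> (int s) y") auto
    have "integrable config_measure ?g"
    proof (rule integrable_config)
      show "observable ?g" unfolding mass2_def by measurable
      fix c
      have "0 \<le> mass2 (env c) s (\<lambda>y. 1 - 1 / real (vis c s y))" by (rule mass2_nonneg[OF g0])
      moreover have "mass2 (env c) s (\<lambda>y. 1 - 1 / real (vis c s y)) \<le> 1" by (rule mass2_le_1) auto
      ultimately show "\<bar>?g c\<bar> \<le> 1" by (simp add: occupied_def)
    qed
    then have "expect (\<lambda>c. occupied c * mass2 (env c) s (\<lambda>y. of_bool (vis c s y \<noteq> 1))) \<le> expect (\<lambda>c. 2 * ?g c)"
      using * g0 by (intro integral_mono_AE') (auto simp del: le_diff_eq diff_ge_0_iff_ge
          intro!: AE_I2 mult_nonneg_nonneg mass2_nonneg occupied_bounds)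
    then show ?thesis by simp
  qed
  then have "(\<Sum>s<T. expect (\<lambda>c. occupied c * mass2 (env c) s (\<lambda>y. of_bool (vis c s y \<noteq> 1))))
    \<le> 2 * (\<Sum>s<T. expect (\<lambda>c. occupied c * mass2 (env c) s (\<lambda>y. 1 - 1 / real (vis c s y))))"
    unfolding sum_distrib_left by (intro sum_mono)
  also have "\<dots> \<le> 2 * (2 * sqrt (real T))" by (intro mult_left_mono sum_expectation_noncoalescing) simp
  finally show ?thesis by simp
qed

text \<open>A meeting at a crowded site is charged at most \<open>n + 1\<close> times, once for each number of steps
\<open>j \<le> n\<close> for which the walkers may have travelled with a lone particle before.\<close>

lemma sum_expectation_mass2:
  "(\<Sum>s<T. mean_collisions s)
   \<le> real (Suc n) * (4 * sqrt (real (T + n)))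
     + (\<Sum>s<T. cfg.prob {c \<in> space config_measure. \<exists>y\<in>{-int s..int s}. lone (env c) n s y})"
proof -
  define G where "G s c = occupied c * mass2 (env c) s (\<lambda>y. of_bool (vis c s y \<noteq> 1))" for s c
  define L where "L s = {c \<in> space config_measure. \<exists>y\<in>{-int s..int s}. lone (env c) n s y}" for s
  have Lm [measurable]: "L s \<in> sets config_measure" for s unfolding L_def by measurable
  have G0: "0 \<le> G s c" for s c
    unfolding G_def by (intro mult_nonneg_nonneg mass2_nonneg occupied_bounds) auto
  have Gi: "integrable config_measure (G s)" for s
  proof (rule integrable_config)
    show "observable (G s)" unfolding G_def mass2_def by measurable
    fix c
    have "mass2 (env c) s (\<lambda>y. of_bool (vis c s y \<noteq> 1)) \<le> 1" by (rule mass2_le_1) auto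
    then have "G s c \<le> 1" by (simp add: G_def occupied_def)
    with G0[of s c] show "\<bar>G s c\<bar> \<le> 1" by simp
  qed
  have "mean_collisions s \<le> (\<Sum>j\<le>n. integral\<^sup>L config_measure (G (s + j))) + cfg.prob (L s)" for s
  proof -
    have "mean_collisions s \<le> expect (\<lambda>c. (\<Sum>j\<le>n. G (s + j) c) + indicator (L s) c)"
    proof (rule integral_mono_AE')
      show "integrable config_measure (\<lambda>c. (\<Sum>j\<le>n. G (s + j) c) + indicator (L s) c)"
        using Gi by (intro Bochner_Integration.integrable_add Bochner_Integration.integrable_sum) (auto simp: cfg.emeasure_eq_measure)
      show "AE c in config_measure. 0 \<le> (\<Sum>j\<le>n. G (s + j) c) + indicator (L s) c"
        by (intro AE_I2 add_nonneg_nonneg sum_nonneg G0) auto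
      show "AE c in config_measure. occupied c * mass2 (env c) s (\<lambda>_. 1) \<le> (\<Sum>j\<le>n. G (s + j) c) + indicator (L s) c"
      proof (rule AE_I2)
        fix c
        have "occupied c * mass2 (env c) s (\<lambda>_. 1) \<le> occupied c * ((\<Sum>j\<le>n. mass2 (env c) (s + j) (\<lambda>y. of_bool (vis c (s + j) y \<noteq> 1)))
          + of_bool (\<exists>y\<in>{-int s..int s}. lone (env c) n s y))"
          by (intro mult_left_mono mass2_le_crowded_plus_lone occupied_bounds)
        also have "\<dots> = (\<Sum>j\<le>n. G (s + j) c) + occupied c * indicator (L s) c"
          by (simp add: G_def L_def sum_distrib_left distrib_left)
        also have "\<dots> \<le> (\<Sum>j\<le>n. G (s + j) c) + 1 * indicator (L s) c"
          by (intro add_left_mono mult_right_mono occupied_bounds) auto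
        finally show "occupied c * mass2 (env c) s (\<lambda>_. 1) \<le> (\<Sum>j\<le>n. G (s + j) c) + indicator (L s) c" by simp
      qed
    qed
    also have "\<dots> = (\<Sum>j\<le>n. integral\<^sup>L config_measure (G (s + j))) + cfg.prob (L s)"
      using Gi by (subst Bochner_Integration.integral_add) (auto simp: Bochner_Integration.integral_sum cfg.emeasure_eq_measure)
    finally show ?thesis .
  qed
  then have "(\<Sum>s<T. mean_collisions s)
     \<le> (\<Sum>j\<le>n. \<Sum>s<T. integral\<^sup>L config_measure (G (s + j))) + (\<Sum>s<T. cfg.prob (L s))"
    by (subst sum.swap) (simp add: sum.distrib[symmetric] sum_mono)
  also have "(\<Sum>j\<le>n. \<Sum>s<T. integral\<^sup>L config_measure (G (s + j))) \<le> (\<Sum>j\<le>n. 4 * sqrt (real (T + n)))"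
  proof (rule sum_mono)
    fix j assume j: "j \<in> {..n}"
    have "(\<Sum>s<T. integral\<^sup>L config_measure (G (s + j))) = (\<Sum>s\<in>(\<lambda>s. s + j) ` {..<T}. integral\<^sup>L config_measure (G s))"
      by (subst sum.reindex) auto
    also have "\<dots> \<le> (\<Sum>s<T + n. integral\<^sup>L config_measure (G s))"
      using j by (intro sum_mono2) (auto intro!: integral_nonneg_AE simp: G0)
    also have "\<dots> \<le> 4 * sqrt (real (T + n))"
      unfolding G_def[abs_def] by (rule sum_expectation_crowded)
    finally show "(\<Sum>s<T. integral\<^sup>L config_measure (G (s + j))) \<le> 4 * sqrt (real (T + n))" .
  qed
  finally show ?thesis by (simp add: L_def)
qed

section \<open>Crossings of the path of a lone walker\<close>

definition psum :: "int \<Rightarrow> (int \<Rightarrow> int) \<Rightarrow> nat \<Rightarrow> int" where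
  "psum k q t = k + (\<Sum>s<t. sg (q (int s)))"

lemma pos_eq_psum: "pos c t w = psum (fst w) (snd c w) t"
  by (simp add: pos_eq_sum psum_def step_def)

text \<open>A walker with path \<open>q\<close> started from \<open>k\<close> is strictly on one side of \<open>y\<close> at time \<open>s\<close>, and at \<open>z\<close> or
on the other side of it at time \<open>s + n\<close>. By parity it meets every path from \<open>(s, y)\<close> to
\<open>(s + n, z)\<close>.\<close>

definition crosses :: "int \<Rightarrow> int \<Rightarrow> nat \<Rightarrow> nat \<Rightarrow> int \<Rightarrow> (int \<Rightarrow> int) \<Rightarrow> bool" where
  "crosses y z s n k q \<longleftrightarrow> even (psum k q s - y) \<and>
     (psum k q s < y \<and> z \<le> psum k q (s + n) \<or> y < psum k q s \<and> psum k q (s + n) \<le> z)"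

lemma card_1_eq_singleton: "card A = 1 \<Longrightarrow> a \<in> A \<Longrightarrow> A = {a}"
  by (metis card_1_singletonE singletonD)

lemma card_1_nonempty: "card A = 1 \<Longrightarrow> \<exists>a. a \<in> A"
  by (metis card_1_singletonE singletonI)

lemma lone_occ:
  assumes "lone (env c) n s y" "w0 \<in> occ c s y" "j \<le> n"
  shows "occ c (s + j) (pos c (s + j) w0) = {w0}"
  using assms
proof (induction n arbitrary: s y j)
  case 0
  then have "card (occ c s y) = 1" by (simp add: lone_def visits_env)
  then have "occ c s y = {w0}" by (rule card_1_eq_singleton) (rule 0(2))
  moreover have "pos c s w0 = y" using 0(2) by (simp add: occ_def)
  ultimately show ?case using 0(3) by simp
next
  case (Suc n)
  have v: "vis c s y = 1"
    using Suc.prems(1) by (auto simp: lone_def split: if_splits)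
  then have occ: "occ c s y = {w0}"
    unfolding visits_env by (rule card_1_eq_singleton) (rule Suc.prems(2))
  have y: "pos c s w0 = y" using Suc.prems(2) by (simp add: occ_def)
  have next_eq: "(if e_plus (env c) (int s) y = 1 then y + 1 else y - 1) = pos c (Suc s) w0"
  proof (cases "step c s w0 = 1")
    case True
    then have "{w \<in> occ c s y. step c s w = 1} = {w0}" using occ by auto
    then show ?thesis using True y by (simp add: e_plus_env pos_Suc)
  next
    case False
    then have "{w \<in> occ c s y. step c s w = 1} = {}" using occ by auto
    then have "e_plus (env c) (int s) y = 0" unfolding e_plus_env by (simp only: card.empty)
    then show ?thesis using False y step_cases[of c s w0] by (auto simp: pos_Suc)
  qed
  have l: "lone (env c) n (Suc s) (pos c (Suc s) w0)"
    using Suc.prems(1) v unfolding lone_def run.simps next_eq by simp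
  have o: "w0 \<in> occ c (Suc s) (pos c (Suc s) w0)"
    using Suc.prems(2) by (simp add: occ_def)
  show ?case
  proof (cases j)
    case 0
    then show ?thesis using occ y by simp
  next
    case (Suc i)
    then show ?thesis using Suc.IH[OF l o, of i] Suc.prems(3) by simp
  qed
qed

text \<open>The difference of two walkers of the same parity cannot jump over zero.\<close>

lemma int_path_hits_zero:
  fixes d :: "nat \<Rightarrow> int"
  assumes even: "even (d 0)" and inc: "\<And>j. d (Suc j) - d j \<in> {-2, 0, 2}"
    and sign: "d 0 < 0 \<and> 0 \<le> d n \<or> 0 < d 0 \<and> d n \<le> 0"
  shows "\<exists>j\<le>n. d j = 0"
proof -
  have ev: "even (d j)" for j
  proof (induction j)
    case (Suc j)
    have "even a" if "a - b \<in> {-2, 0, 2}" "even b" for a b :: int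
    proof -
      have "a = b - 2 \<or> a = b \<or> a = b + 2" using that(1) by auto
      then show ?thesis using that(2) by auto
    qed
    from this[OF inc Suc] show ?case .
  qed (rule even)
  define f where "f j = d j div 2" for j
  have d: "d j = 2 * f j" for j using ev[of j] by (simp add: f_def)
  have f1: "\<bar>f (i + 1) - f i\<bar> \<le> 1" for i using inc[of i] by (auto simp: d)
  from sign show ?thesis
  proof
    assume "d 0 < 0 \<and> 0 \<le> d n"
    then have "\<exists>i\<le>n. f i = 0" using f1 by (intro nat0_intermed_int_val) (auto simp: d)
    then show ?thesis by (auto simp: d)
  next
    assume "0 < d 0 \<and> d n \<le> 0"
    then have "\<exists>i\<le>n. - f i = 0" using f1 by (intro nat0_intermed_int_val) (auto simp: d abs_minus_commute)
    then show ?thesis by (auto simp: d)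
  qed
qed

text \<open>Only the endpoint \<open>z\<close> of the path of the lone particle enters the right-hand side. This is what
makes a union bound over \<open>z\<close> possible, in place of conditioning on the path. The lone particle
itself does not cross, because it is at \<open>y\<close> at time \<open>s\<close>.\<close>

lemma lone_imp_uncrossed:
  assumes "lone (env c) n s y"
  shows "\<exists>z\<in>{y - int n..y + int n}. \<forall>w\<in>walkers c. \<not> crosses y z s n (fst w) (snd c w)"
proof -
  have "vis c s y = 1"
    using assms by (cases n) (auto simp: lone_def split: if_splits)
  then obtain w0 where w0: "w0 \<in> occ c s y"
    unfolding visits_env using card_1_nonempty[of "occ c s y"] by auto
  then have y: "pos c s w0 = y" by (simp add: occ_def)
  define z where "z = pos c (s + n) w0"
  have "\<bar>pos c (s + j) w0 - pos c s w0\<bar> \<le> int j" for j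
  proof (induction j)
    case (Suc j)
    then show ?case using step_cases[of c "s + j" w0] by (auto simp: pos_Suc)
  qed simp
  from this[of n] have "z \<in> {y - int n..y + int n}" by (auto simp: z_def y)
  moreover have "\<not> crosses y z s n (fst w) (snd c w)" if w: "w \<in> walkers c" for w
  proof
    assume "crosses y z s n (fst w) (snd c w)"
    then have cr: "even (pos c s w - y)" "pos c s w < y \<and> z \<le> pos c (s + n) w \<or> y < pos c s w \<and> pos c (s + n) w \<le> z"
      by (auto simp: crosses_def pos_eq_psum)
    have "\<exists>j\<le>n. pos c (s + j) w - pos c (s + j) w0 = 0"
    proof (rule int_path_hits_zero)
      show "even (pos c (s + 0) w - pos c (s + 0) w0)" using cr y by simp
      show "pos c (s + Suc j) w - pos c (s + Suc j) w0 - (pos c (s + j) w - pos c (s + j) w0) \<in> {-2, 0, 2}" for j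
        using step_cases[of c "s + j" w] step_cases[of c "s + j" w0] by (auto simp: pos_Suc)
    qed (use cr y z_def in auto)
    then obtain j where j: "j \<le> n" "pos c (s + j) w = pos c (s + j) w0" by auto
    then have "w \<in> occ c (s + j) (pos c (s + j) w0)" using w by (simp add: occ_def)
    then have "w = w0" using lone_occ[OF assms w0 j(1)] by simp
    then show False using cr y by auto
  qed
  ultimately show ?thesis by blast
qed

section \<open>Markov property of a single walker\<close>

lemma expectation_adapted_step:
  fixes H :: "config \<Rightarrow> real"
  assumes [measurable]: "observable H" and B: "\<And>c. \<bar>H c\<bar> \<le> B"
    and H: "adapted t H"
  shows "expect (\<lambda>c. H c * real_of_int (step c t w)) = 0"
proof -
  have "expect (\<lambda>c. H c * real_of_int (step c t w)) = expect (\<lambda>c. 0)"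
  proof (rule integral_config_cong_sections)
    show "\<bar>H c * real_of_int (step c t w)\<bar> \<le> B" for c
      using B[of c] step_cases[of c t w] by (auto simp: abs_mult)
  next
    fix N
    have m: "observable (\<lambda>c. H c * real_of_int (step c t w))" by measurable
    have "(\<integral>x. H (N, x) * real_of_int (step (N, x) t w) \<partial>paths_measure) = 0"
    proof (rule integral_odd_eq_0[where w = w and t = "int t"])
      show "(\<lambda>x. H (N, x) * real_of_int (step (N, x) t w)) \<in> borel_measurable paths_measure"
        using measurable_section[OF m] .
      show "H (N, flip_path w (int t) x) * real_of_int (step (N, flip_path w (int t) x) t w) = - (H (N, x) * real_of_int (step (N, x) t w))" for x
        using adaptedD[OF H agree_flip[of t N x w]] by (simp add: step_flip)
    qed
    then show "(\<integral>x. H (N, x) * real_of_int (step (N, x) t w) \<partial>paths_measure) = (\<integral>x. 0 \<partial>paths_measure)" by simp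
  qed auto
  then show ?thesis by simp
qed

lemma measurable_fun_pos [measurable]: "observable (\<lambda>c. (f :: int \<Rightarrow> real) (pos c t w))"
  by (rule measurable_compose[OF measurable_pos]) simp

lemma srw_bounded: "(\<And>y. \<bar>f y\<bar> \<le> (C::real)) \<Longrightarrow> \<bar>srw f y\<bar> \<le> C"
  using abs_triangle_ineq[of "f (y + 1)" "f (y - 1)"] by (simp add: srw_def) (smt (verit))

lemma expectation_srw_step:
  fixes H :: "config \<Rightarrow> real"
  assumes Hm [measurable]: "observable H" and B: "\<And>c. \<bar>H c\<bar> \<le> B"
    and H: "adapted t H" and C: "\<And>y. \<bar>f y\<bar> \<le> C"
  shows "expect (\<lambda>c. H c * f (pos c (Suc t) w)) = expect (\<lambda>c. H c * srw f (pos c t w))"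
proof -
  have B0: "0 \<le> B" using B[of "(\<lambda>_. 0, \<lambda>_ _. 0)"] by simp
  have C0: "0 \<le> C" using C[of 0] by simp
  have g: "\<bar>grad f y\<bar> \<le> C" for y
    using C[of "y + 1"] C[of "y - 1"] by (auto simp: grad_def abs_le_iff)
  have b1: "\<bar>H c * srw f (pos c t w)\<bar> \<le> B * C" for c
    using mult_mono[OF B[of c] srw_bounded[of f C "pos c t w", OF C]] B0 by (simp add: abs_mult)
  have b2: "\<bar>H c * grad f (pos c t w)\<bar> \<le> B * C" for c
    using mult_mono[OF B[of c] g[of "pos c t w"]] B0 by (simp add: abs_mult)
  have b3: "\<bar>H c * grad f (pos c t w) * real_of_int (step c t w)\<bar> \<le> B * C" for c
    using b2[of c] step_cases[of c t w] by (auto simp: abs_mult)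
  have i1: "integrable config_measure (\<lambda>c. H c * srw f (pos c t w))"
    by (rule integrable_config[OF _ b1]) measurable
  have i3: "integrable config_measure (\<lambda>c. H c * grad f (pos c t w) * real_of_int (step c t w))"
    by (rule integrable_config[OF _ b3]) measurable
  have "expect (\<lambda>c. H c * f (pos c (Suc t) w))
      = expect (\<lambda>c. H c * srw f (pos c t w) + H c * grad f (pos c t w) * real_of_int (step c t w))"
  proof (rule Bochner_Integration.integral_cong[OF refl])
    fix c
    show "H c * f (pos c (Suc t) w) = H c * srw f (pos c t w) + H c * grad f (pos c t w) * real_of_int (step c t w)"
      using step_cases[of c t w] by (auto simp: pos_Suc srw_def grad_def field_simps)
  qed
  also have "\<dots> = expect (\<lambda>c. H c * srw f (pos c t w)) + expect (\<lambda>c. H c * grad f (pos c t w) * real_of_int (step c t w))"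
    by (rule Bochner_Integration.integral_add[OF i1 i3])
  also have "expect (\<lambda>c. H c * grad f (pos c t w) * real_of_int (step c t w)) = 0"
    by (rule expectation_adapted_step[OF _ b2]) (auto simp: adapted_def adaptedD[OF H] agree_pos)
  finally show ?thesis by simp
qed

lemma srw_funpow_bounded: "(\<And>y. \<bar>f y\<bar> \<le> (C::real)) \<Longrightarrow> \<bar>(srw ^^ n) f y\<bar> \<le> C"
  by (induction n arbitrary: y) (auto intro: srw_bounded)

lemma adapted_mono: "adapted s H \<Longrightarrow> s \<le> t \<Longrightarrow> adapted t H"
  unfolding adapted_def using agree_le by blast

text \<open>The Markov property of a single walker, with past events entering through an adapted weight.\<close>

lemma expectation_srw_funpow:
  fixes H :: "config \<Rightarrow> real"
  assumes Hm: "observable H" and B: "\<And>c. \<bar>H c\<bar> \<le> B"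
    and H: "adapted t H" and C: "\<And>y. \<bar>f y\<bar> \<le> C"
  shows "expect (\<lambda>c. H c * f (pos c (t + n) w)) = expect (\<lambda>c. H c * (srw ^^ n) f (pos c t w))"
  using C
proof (induction n arbitrary: f)
  case (Suc n)
  have "expect (\<lambda>c. H c * f (pos c (t + Suc n) w)) = expect (\<lambda>c. H c * srw f (pos c (t + n) w))"
    using expectation_srw_step[OF Hm B adapted_mono[OF H], of "t + n" f C w] Suc.prems by simp
  also have "\<dots> = expect (\<lambda>c. H c * (srw ^^ n) (srw f) (pos c t w))"
    by (rule Suc.IH) (rule srw_bounded[OF Suc.prems])
  finally show ?case by (simp only: funpow_Suc_right o_apply)
qed simp

lemma expectation_pos:
  assumes "\<And>y. \<bar>f y\<bar> \<le> C"
  shows "expect (\<lambda>c. f (pos c n w)) = (srw ^^ n) f (fst w)"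
proof -
  have "expect (\<lambda>c. 1 * f (pos c (0 + n) w)) = expect (\<lambda>c. 1 * (srw ^^ n) f (pos c 0 w))"
    by (rule expectation_srw_funpow[where B = 1, OF _ _ _ assms]) (auto simp: adapted_def)
  then show ?thesis using cfg.prob_space by simp
qed

section \<open>Lone walkers are rare\<close>

lemma measurable_psum [measurable]: "(\<lambda>q. psum k q t) \<in> measurable path_measure (count_space UNIV)"
proof -
  have "(\<lambda>q. sg (q s)) \<in> measurable path_measure (count_space UNIV)" for s
  proof -
    have "(\<lambda>q. q s) \<in> measurable path_measure coin" by (rule measurable_component_singleton) simp
    then have "(\<lambda>q. q s) \<in> measurable path_measure (count_space UNIV)" by simp
    then show ?thesis by (rule measurable_compose) simp
  qed
  note [measurable] = measurable_sum_int[OF this, of "{..<t}" "\<lambda>s. int s"]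
  show ?thesis unfolding psum_def by measurable
qed

lemma measurable_crosses [measurable]: "Measurable.pred path_measure (\<lambda>q. crosses y z s n k q)"
  unfolding crosses_def by measurable

definition cross_prob :: "int \<Rightarrow> int \<Rightarrow> nat \<Rightarrow> nat \<Rightarrow> int \<Rightarrow> real" where
  "cross_prob y z s n k = measure path_measure {q. crosses y z s n k q}"

lemma nn_integral_poisson_power:
  assumes "0 \<le> a"
  shows "(\<integral>\<^sup>+n. ennreal a ^ n \<partial>measure_pmf (poisson_pmf 1)) = ennreal (exp (a - 1))"
proof -
  have "(\<integral>\<^sup>+n. ennreal a ^ n \<partial>measure_pmf (poisson_pmf 1)) = (\<integral>\<^sup>+n. ennreal (pmf (poisson_pmf 1) n) * ennreal a ^ n \<partial>count_space UNIV)"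
    by (rule nn_integral_measure_pmf)
  also have "\<dots> = (\<Sum>n. ennreal (a ^ n /\<^sub>R fact n * exp (-1)))"
    using assms by (subst nn_integral_count_space_nat)
      (auto intro!: suminf_cong simp: ennreal_power ennreal_mult[symmetric] field_simps)
  also have "\<dots> = ennreal (exp a * exp (-1))"
    using assms by (intro suminf_ennreal_eq sums_mult2 exp_converges) auto
  finally show ?thesis by (simp add: exp_diff exp_minus field_simps)
qed

lemma nn_integral_counts_prod:
  assumes "finite W"
  shows "(\<integral>\<^sup>+N. (\<Prod>k\<in>W. f k (N k)) \<partial>counts_measure) = (\<Prod>k\<in>W. \<integral>\<^sup>+n. f k n \<partial>measure_pmf (poisson_pmf 1))"
proof -
  interpret P: product_prob_space "\<lambda>k::int. measure_pmf (poisson_pmf 1)" UNIV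
    by unfold_locales
  have m: "(\<lambda>x. \<Prod>k\<in>W. f k (x k)) \<in> borel_measurable (\<Pi>\<^sub>M k\<in>W. measure_pmf (poisson_pmf 1))"
    by measurable
  have "(\<integral>\<^sup>+N. (\<Prod>k\<in>W. f k (N k)) \<partial>counts_measure) = (\<integral>\<^sup>+N. (\<Prod>k\<in>W. f k (restrict N W k)) \<partial>counts_measure)"
    by (intro nn_integral_cong prod.cong) auto
  also have "\<dots> = (\<integral>\<^sup>+x. (\<Prod>k\<in>W. f k (x k)) \<partial>distr counts_measure (\<Pi>\<^sub>M k\<in>W. measure_pmf (poisson_pmf 1)) (\<lambda>x. restrict x W))"
    using m by (intro nn_integral_distr[symmetric] measurable_restrict_subset) auto
  also have "\<dots> = (\<integral>\<^sup>+x. (\<Prod>k\<in>W. f k (x k)) \<partial>(\<Pi>\<^sub>M k\<in>W. measure_pmf (poisson_pmf 1)))"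
    using assms by (subst P.distr_PiM_restrict_finite) auto
  also have "\<dots> = (\<Prod>k\<in>W. \<integral>\<^sup>+n. f k n \<partial>measure_pmf (poisson_pmf 1))"
    using assms by (intro P.product_nn_integral_prod) auto
  finally show ?thesis .
qed

text \<open>Thinning of Poisson variables: the walkers from \<open>k\<close> that cross are Poisson distributed with mean
\<open>cross_prob y z s n k\<close>. For given \<open>N\<close> the probability that none of them crosses is a product of
powers \<open>(1 - cross_prob y z s n k) ^ N k\<close>, and the generating function of the Poisson distribution
turns their means into exponentials.\<close>

lemma prob_uncrossed:
  assumes W: "finite W"
  shows "cfg.prob {c. \<forall>w\<in>walkers c. fst w \<in> W \<longrightarrow> \<not> crosses y z s n (fst w) (snd c w)}
     = exp (- (\<Sum>k\<in>W. cross_prob y z s n k))"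
    and "{c. \<forall>w\<in>walkers c. fst w \<in> W \<longrightarrow> \<not> crosses y z s n (fst w) (snd c w)} \<in> sets config_measure"
proof -
  interpret D: prob_space path_measure by (rule prob_space_path_measure)
  interpret A: prob_space counts_measure by (rule prob_space_counts_measure)
  interpret B: prob_space paths_measure by (rule prob_space_paths_measure)
  interpret P: product_prob_space "\<lambda>w::int\<times>nat. path_measure" UNIV
    by unfold_locales
  let ?r = "cross_prob y z s n"
  let ?E = "{c. \<forall>w\<in>walkers c. fst w \<in> W \<longrightarrow> \<not> crosses y z s n (fst w) (snd c w)}"
  have [measurable]: "(\<lambda>c. snd c w) \<in> measurable config_measure path_measure" for w
    unfolding config_measure_eq by measurable
  have "{c \<in> space config_measure. \<forall>w. 1 \<le> snd w \<and> snd w \<le> fst c (fst w) \<longrightarrow> fst w \<in> W \<longrightarrow> \<not> crosses y z s n (fst w) (snd c w)} \<in> sets config_measure"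
    by measurable
  also have "{c \<in> space config_measure. \<forall>w. 1 \<le> snd w \<and> snd w \<le> fst c (fst w) \<longrightarrow> fst w \<in> W \<longrightarrow> \<not> crosses y z s n (fst w) (snd c w)} = ?E"
    by (auto simp: walkers_def)
  finally show E: "?E \<in> sets config_measure" .
  have r: "?r k \<le> 1" "0 \<le> ?r k" for k by (simp_all add: cross_prob_def)
  have compl: "emeasure path_measure {q. \<not> crosses y z s n k q} = ennreal (1 - ?r k)" for k
  proof -
    have m: "{q \<in> space path_measure. crosses y z s n k q} \<in> sets path_measure" by measurable
    have "{q. \<not> crosses y z s n k q} = space path_measure - {q \<in> space path_measure. crosses y z s n k q}" by auto
    then show ?thesis using D.prob_compl[OF m] by (simp add: D.emeasure_eq_measure cross_prob_def)
  qed
  have inner: "emeasure paths_measure (Pair N -` ?E) = (\<Prod>k\<in>W. ennreal (1 - ?r k) ^ N k)" for N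
  proof -
    let ?J = "Sigma W (\<lambda>k. {1..N k})"
    have "Pair N -` ?E = {x \<in> space paths_measure. \<forall>w\<in>?J. x w \<in> {q. \<not> crosses y z s n (fst w) q}}"
      by (auto simp: walkers_def)
    also have "emeasure paths_measure \<dots> = (\<Prod>w\<in>?J. emeasure path_measure {q. \<not> crosses y z s n (fst w) q})"
    proof (rule P.emeasure_PiM_Collect)
      fix w
      have "{q \<in> space path_measure. \<not> crosses y z s n (fst w) q} \<in> sets path_measure" by measurable
      then show "{q. \<not> crosses y z s n (fst w) q} \<in> sets path_measure" by simp
    qed (use W in auto)
    also have "\<dots> = (\<Prod>w\<in>?J. ennreal (1 - ?r (fst w)))" by (simp add: compl)
    also have "\<dots> = (\<Prod>k\<in>W. \<Prod>i\<in>{1..N k}. ennreal (1 - ?r k))"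
      using W by (subst prod.Sigma) (auto intro!: prod.cong)
    finally show ?thesis by simp
  qed
  have "emeasure config_measure ?E = (\<integral>\<^sup>+N. emeasure paths_measure (Pair N -` ?E) \<partial>counts_measure)"
    using E unfolding config_measure_eq by (rule B.emeasure_pair_measure_alt)
  also have "\<dots> = (\<Prod>k\<in>W. \<integral>\<^sup>+n. ennreal (1 - ?r k) ^ n \<partial>measure_pmf (poisson_pmf 1))"
    unfolding inner by (rule nn_integral_counts_prod[OF W])
  also have "\<dots> = (\<Prod>k\<in>W. ennreal (exp (- ?r k)))"
    using r by (simp add: nn_integral_poisson_power)
  also have "\<dots> = ennreal (exp (- (\<Sum>k\<in>W. ?r k)))"
    using W by (simp add: prod_ennreal exp_sum sum_negf[symmetric])
  finally show "cfg.prob ?E = exp (- (\<Sum>k\<in>W. ?r k))"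
    by (simp add: cfg.emeasure_eq_measure)
qed

lemma srw_funpow_Suc: "(srw ^^ Suc n) f x = ((srw ^^ n) f (x + 1) + (srw ^^ n) f (x - 1)) / 2"
  by (simp only: funpow.simps o_apply srw_def)

lemma srw_funpow_mono_window:
  "(\<And>u. \<bar>u - x\<bar> \<le> int n \<Longrightarrow> f u \<le> g u) \<Longrightarrow> (srw ^^ n) f x \<le> (srw ^^ n) g x"
proof (induction n arbitrary: x)
  case (Suc n)
  have "(srw ^^ n) f (x + 1) \<le> (srw ^^ n) g (x + 1)" "(srw ^^ n) f (x - 1) \<le> (srw ^^ n) g (x - 1)"
    by (intro Suc; auto intro!: Suc.prems)+
  then show ?case unfolding srw_funpow_Suc by simp
qed simp

lemma srw_funpow_const: "(srw ^^ n) (\<lambda>_. a) = (\<lambda>_. a)"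
  by (induction n) (simp_all add: srw_def)

lemma srw_funpow_eq_0: "(\<And>u. \<bar>u - x\<bar> \<le> int n \<Longrightarrow> f u = 0) \<Longrightarrow> (srw ^^ n) f x = 0"
  using srw_funpow_mono_window[of x n f "\<lambda>_. 0"] srw_funpow_mono_window[of x n "\<lambda>_. 0" f]
  by (simp add: srw_funpow_const)

lemma srw_funpow_add: "(srw ^^ n) (\<lambda>u. f u + g u) x = (srw ^^ n) f x + (srw ^^ n) g x"
  by (induction n arbitrary: x) (simp_all add: srw_def field_simps)

lemma srw_funpow_cmult: "(srw ^^ n) (\<lambda>u. a * f u) x = a * (srw ^^ n) f x"
  by (induction n arbitrary: x) (simp_all add: srw_def field_simps)

lemma srw_funpow_sum: "(srw ^^ n) (\<lambda>u. \<Sum>i\<in>A. f i u) x = (\<Sum>i\<in>A. (srw ^^ n) (f i) x)"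
  by (induction n arbitrary: x) (simp_all add: srw_def sum.distrib[symmetric] sum_divide_distrib[symmetric])

lemma srw_funpow_translate: "(srw ^^ n) f (a + x) = (srw ^^ n) (\<lambda>u. f (a + u)) x"
  by (induction n arbitrary: x) (simp_all add: srw_def add.assoc add_diff_eq[symmetric])

text \<open>Cosines are eigenfunctions of the simple random walk. They serve twice: as characteristic functions
in the central limit theorem, and in a lower bound for the mean distance from a point.\<close>

lemma srw_funpow_cos: "(srw ^^ n) (\<lambda>u. cos (\<theta> * (real_of_int u - a))) x = cos \<theta> ^ n * cos (\<theta> * (real_of_int x - a))"
proof (induction n arbitrary: x)
  case (Suc n)
  have "cos (\<theta> * (real_of_int x + 1 - a)) + cos (\<theta> * (real_of_int x - 1 - a)) = 2 * cos \<theta> * cos (\<theta> * (real_of_int x - a))"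
    using cos_add[of "\<theta> * (real_of_int x - a)" \<theta>] cos_diff[of "\<theta> * (real_of_int x - a)" \<theta>]
    by (simp add: algebra_simps)
  then have "cos \<theta> ^ n * (cos (\<theta> * (real_of_int x + 1 - a)) + cos (\<theta> * (real_of_int x - 1 - a))) / 2 = cos \<theta> ^ n * (cos \<theta> * cos (\<theta> * (real_of_int x - a)))"
    by simp
  then show ?case unfolding srw_funpow_Suc Suc by (simp add: distrib_left)
qed simp

text \<open>Counting measure is invariant for the simple random walk. Therefore the mean number of walkers that
cross does not depend on \<open>s\<close>.\<close>

lemma sum_srw_funpow:
  assumes "\<And>x. x \<notin> {l..u} \<Longrightarrow> g x = 0"
  shows "(\<Sum>k\<in>{l - int n..u + int n}. (srw ^^ n) g k) = (\<Sum>x\<in>{l..u}. g x)"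
proof (induction n)
  case (Suc n)
  let ?G = "(srw ^^ n) g"
  have G0: "?G k = 0" if "k \<notin> {l - int n..u + int n}" for k
    using that by (intro srw_funpow_eq_0 assms) auto
  let ?W = "{l - int (Suc n)..u + int (Suc n)}"
  have shift: "(\<Sum>k\<in>?W. ?G (k + d)) = (\<Sum>k\<in>{l - int n..u + int n}. ?G k)" if "d = 1 \<or> d = -1" for d
  proof -
    have "(\<Sum>k\<in>?W. ?G (k + d)) = (\<Sum>k\<in>{l - int (Suc n) + d..u + int (Suc n) + d}. ?G k)"
      by (rule sum.reindex_bij_witness[of _ "\<lambda>k. k - d" "\<lambda>k. k + d"]) auto
    also have "\<dots> = (\<Sum>k\<in>{l - int n..u + int n}. ?G k)"
      using that by (intro sum.mono_neutral_right) (auto intro!: G0)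
    finally show ?thesis .
  qed
  have "(\<Sum>k\<in>?W. (srw ^^ Suc n) g k) = ((\<Sum>k\<in>?W. ?G (k + 1)) + (\<Sum>k\<in>?W. ?G (k + -1))) / 2"
    by (simp add: srw_def sum.distrib[symmetric] sum_divide_distrib[symmetric])
  then show ?case using shift[of 1] shift[of "-1"] Suc by simp
qed simp

text \<open>The probability that a walker which is at \<open>x\<close> at time \<open>s\<close> crosses.\<close>

definition cross_start :: "int \<Rightarrow> int \<Rightarrow> nat \<Rightarrow> int \<Rightarrow> real" where
  "cross_start y z n x = of_bool (even (x - y) \<and> x < y) * (srw ^^ n) (\<lambda>b. of_bool (z \<le> b)) x
     + of_bool (even (x - y) \<and> y < x) * (srw ^^ n) (\<lambda>b. of_bool (b \<le> z)) x"

lemma cross_prob_eq: "cross_prob y z s n k = (srw ^^ s) (cross_start y z n) k"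
proof -
  interpret D: prob_space path_measure by (rule prob_space_path_measure)
  interpret B: prob_space paths_measure by (rule prob_space_paths_measure)
  interpret A: prob_space counts_measure by (rule prob_space_counts_measure)
  let ?w = "(k, 0::nat)"
  have m [measurable]: "(\<lambda>c. snd c ?w) \<in> measurable config_measure path_measure"
    unfolding config_measure_eq by measurable
  have Q: "{q. crosses y z s n k q} \<in> sets path_measure"
  proof -
    have "{q \<in> space path_measure. crosses y z s n k q} \<in> sets path_measure" by measurable
    then show ?thesis by simp
  qed
  have "emeasure path_measure {q. crosses y z s n k q} = emeasure paths_measure ((\<lambda>x. x ?w) -` {q. crosses y z s n k q})"
  proof -
    have "path_measure = distr paths_measure path_measure (\<lambda>x. x ?w)"
      by (rule distr_PiM_component[symmetric]) (auto intro: prob_space_path_measure)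
    then have "emeasure path_measure {q. crosses y z s n k q} = emeasure (distr paths_measure path_measure (\<lambda>x. x ?w)) {q. crosses y z s n k q}"
      by simp
    also have "\<dots> = emeasure paths_measure ((\<lambda>x. x ?w) -` {q. crosses y z s n k q} \<inter> space paths_measure)"
      using Q by (intro emeasure_distr) auto
    finally show ?thesis by simp
  qed
  also have "\<dots> = emeasure config_measure {c. crosses y z s n k (snd c ?w)}"
  proof -
    have "(\<lambda>x. x ?w) -` {q. crosses y z s n k q} \<inter> space paths_measure \<in> sets paths_measure"
      using Q by (intro measurable_sets[of _ _ path_measure]) auto
    then have "emeasure config_measure (UNIV \<times> ((\<lambda>x. x ?w) -` {q. crosses y z s n k q}))
       = emeasure counts_measure UNIV * emeasure paths_measure ((\<lambda>x. x ?w) -` {q. crosses y z s n k q})"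
      using sets.top[of counts_measure] unfolding config_measure_eq by (intro B.emeasure_pair_measure_Times) auto
    also have "\<dots> = emeasure paths_measure ((\<lambda>x. x ?w) -` {q. crosses y z s n k q})"
      using A.emeasure_space_1 by simp
    also have "UNIV \<times> ((\<lambda>x. x ?w) -` {q. crosses y z s n k q}) = {c. crosses y z s n k (snd c ?w)}" by auto
    finally show ?thesis by (rule sym)
  qed
  finally have "cross_prob y z s n k = cfg.prob {c. crosses y z s n k (snd c ?w)}"
    by (simp add: cross_prob_def measure_def)
  also have "\<dots> = expect (\<lambda>c. indicator {c \<in> space config_measure. crosses y z s n k (snd c ?w)} c)"
    by simp
  also have "\<dots> = expect (\<lambda>c. of_bool (even (pos c s ?w - y) \<and> pos c s ?w < y) * of_bool (z \<le> pos c (s + n) ?w)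
       + of_bool (even (pos c s ?w - y) \<and> y < pos c s ?w) * of_bool (pos c (s + n) ?w \<le> z))"
    by (intro Bochner_Integration.integral_cong) (auto simp: crosses_def pos_eq_psum indicator_def)
  also have "\<dots> = expect (\<lambda>c. of_bool (even (pos c s ?w - y) \<and> pos c s ?w < y) * (srw ^^ n) (\<lambda>b. of_bool (z \<le> b)) (pos c s ?w)
       + of_bool (even (pos c s ?w - y) \<and> y < pos c s ?w) * (srw ^^ n) (\<lambda>b. of_bool (b \<le> z)) (pos c s ?w))"
  proof -
    have fm: "observable (\<lambda>c. f (pos c t ?w))" for f :: "int \<Rightarrow> real" and t
      by (rule measurable_fun_pos)
    have p: "\<bar>(srw ^^ n) (\<lambda>b. of_bool (P b)) x\<bar> \<le> (1::real)" for P x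
      by (rule srw_funpow_bounded) simp
    have i: "integrable config_measure (\<lambda>c. of_bool (P (pos c s ?w)) * g (pos c t ?w))" if "\<And>x. \<bar>g x\<bar> \<le> (1::real)" for P t g
      using that by (intro integrable_config[where B = 1] borel_measurable_times fm[of "\<lambda>x. of_bool (P x)"] fm) (auto simp: abs_mult)
    have e: "expect (\<lambda>c. of_bool (P (pos c s ?w)) * of_bool (R (pos c (s + n) ?w)))
       = expect (\<lambda>c. of_bool (P (pos c s ?w)) * (srw ^^ n) (\<lambda>b. of_bool (R b)) (pos c s ?w))" for P R
      by (rule expectation_srw_funpow[where B = 1 and C = 1 and f = "\<lambda>b. of_bool (R b)", OF fm[of "\<lambda>x. of_bool (P x)"]])
        (auto simp: adapted_def agree_pos)
    have i1: "integrable config_measure (\<lambda>c. of_bool (P (pos c s ?w)) * of_bool (R (pos c (s + n) ?w)) :: real)" for P R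
      by (rule i) simp
    have i2: "integrable config_measure (\<lambda>c. of_bool (P (pos c s ?w)) * (srw ^^ n) (\<lambda>b. of_bool (R b)) (pos c s ?w))" for P R
      by (rule i[OF p])
    let ?P = "\<lambda>x. even (x - y) \<and> x < y" and ?P' = "\<lambda>x. even (x - y) \<and> y < x"
    show ?thesis
      by (rule trans[OF Bochner_Integration.integral_add[OF i1[of ?P "\<lambda>b. z \<le> b"] i1[of ?P' "\<lambda>b. b \<le> z"]]
          trans[OF arg_cong2[where f = "(+)", OF e[of ?P "\<lambda>b. z \<le> b"] e[of ?P' "\<lambda>b. b \<le> z"]]
            Bochner_Integration.integral_add[OF i2[of ?P "\<lambda>b. z \<le> b"] i2[of ?P' "\<lambda>b. b \<le> z"], symmetric]]])
  qed
  also have "\<dots> = expect (\<lambda>c. cross_start y z n (pos c s ?w))"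
    by (simp add: cross_start_def)
  also have "\<dots> = (srw ^^ s) (cross_start y z n) (fst ?w)"
  proof (rule expectation_pos)
    show "\<bar>cross_start y z n x\<bar> \<le> 1" for x
      using srw_funpow_bounded[of "\<lambda>b. of_bool (z \<le> b)" 1 n x] srw_funpow_bounded[of "\<lambda>b. of_bool (b \<le> z)" 1 n x]
      by (auto simp: cross_start_def)
  qed
  finally show ?thesis by simp
qed

text \<open>If a walker makes the displacement \<open>u\<close> while the lone particle makes the displacement \<open>z - y\<close>, it
crosses for every start on the appropriate side of \<open>y\<close>, of the right parity, and at distance at
most \<open>\<bar>u - (z - y)\<bar>\<close>. The numerator has \<open>- 1\<close> to allow for an odd difference.\<close>

lemma card_crossing_starts:
  fixes y z u :: int
  assumes "\<bar>u\<bar> \<le> int n" "\<bar>z - y\<bar> \<le> int n"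
  shows "(\<bar>real_of_int (u - (z - y))\<bar> - 1) / 2
    \<le> (\<Sum>x\<in>{y - 2 * int n..y + 2 * int n}. of_bool (even (x - y) \<and> x < y) * of_bool (z \<le> x + u)
         + of_bool (even (x - y) \<and> y < x) * of_bool (x + u \<le> z))"
    (is "_ \<le> sum ?f ?W")
proof -
  define d where "d = u - (z - y)"
  define m where "m = nat (\<bar>d\<bar> div 2)"
  \<comment> \<open>A walker that moves further to the right than the lone particle must start on its left.\<close>
  define \<sigma> where "\<sigma> = (if d > 0 then -1 else 1 :: int)"
  let ?S = "(\<lambda>j. y + \<sigma> * (2 * int j)) ` {1..m}"
  have m: "2 * int m \<le> \<bar>d\<bar>" "\<bar>d\<bar> \<le> 2 * int m + 1" by (auto simp: m_def)
  have f0: "0 \<le> ?f x" for x by simp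
  have f1: "1 \<le> ?f x" if "x \<in> ?S" for x
  proof -
    from that obtain j where j: "1 \<le> j" "j \<le> m" and x: "x = y + \<sigma> * (2 * int j)" by auto
    have "2 * int j \<le> \<bar>d\<bar>" using j m by linarith
    then show ?thesis using j by (auto simp: x \<sigma>_def d_def)
  qed
  have "(\<bar>real_of_int d\<bar> - 1) / 2 \<le> real m"
  proof -
    have "real_of_int \<bar>d\<bar> \<le> real_of_int (2 * int m + 1)" using m by (simp only: of_int_le_iff)
    then show ?thesis by simp
  qed
  also have "real m = real (card ?S)"
    by (subst card_image) (auto simp: inj_on_def \<sigma>_def)
  also have "\<dots> = (\<Sum>x\<in>?S. 1)" by simp
  also have "\<dots> \<le> sum ?f ?S" by (rule sum_mono) (rule f1)
  also have "\<dots> \<le> sum ?f ?W"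
  proof (rule sum_mono2)
    show "?S \<subseteq> ?W"
    proof
      fix x assume "x \<in> ?S"
      then obtain j where j: "1 \<le> j" "j \<le> m" and x: "x = y + \<sigma> * (2 * int j)" by auto
      have "2 * int j \<le> \<bar>d\<bar>" using j m by linarith
      also have "\<bar>d\<bar> \<le> 2 * int n" using assms by (auto simp: d_def)
      finally show "x \<in> ?W" by (auto simp: x \<sigma>_def)
    qed
  qed (auto simp: f0)
  finally show ?thesis by (simp add: d_def)
qed

abbreviation (input) dist_from :: "real \<Rightarrow> int \<Rightarrow> real" where
  "dist_from a \<equiv> (\<lambda>u. \<bar>real_of_int u - a\<bar>)"

text \<open>After exchanging the sum over the starts with the average over the displacement, the count of
starts is applied to each displacement.\<close>

lemma sum_cross_start_ge:
  assumes z: "\<bar>z - y\<bar> \<le> int n"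
  shows "((srw ^^ n) (dist_from (real_of_int (z - y))) 0 - 1) / 2
     \<le> (\<Sum>x\<in>{y - 2 * int n..y + 2 * int n}. cross_start y z n x)"
proof -
  let ?W = "{y - 2 * int n..y + 2 * int n}"
  define A where "A x = (of_bool (even (x - y) \<and> x < y) :: real)" for x
  define B where "B x = (of_bool (even (x - y) \<and> y < x) :: real)" for x
  have "((srw ^^ n) (dist_from (real_of_int (z - y))) 0 - 1) / 2
     = (srw ^^ n) (\<lambda>u. (1 / 2) * \<bar>real_of_int u - real_of_int (z - y)\<bar> + (- 1 / 2)) 0"
    unfolding srw_funpow_add srw_funpow_cmult srw_funpow_const by simp
  also have "\<dots> \<le> (srw ^^ n) (\<lambda>u. \<Sum>x\<in>?W. A x * of_bool (z \<le> x + u) + B x * of_bool (x + u \<le> z)) 0"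
  proof (rule srw_funpow_mono_window)
    fix u :: int assume "\<bar>u - 0\<bar> \<le> int n"
    then show "(1 / 2) * \<bar>real_of_int u - real_of_int (z - y)\<bar> + (- 1 / 2) \<le> (\<Sum>x\<in>?W. A x * of_bool (z \<le> x + u) + B x * of_bool (x + u \<le> z))"
      using card_crossing_starts[OF _ z, of u] unfolding A_def B_def by (simp add: diff_divide_distrib)
  qed
  also have "\<dots> = (\<Sum>x\<in>?W. A x * (srw ^^ n) (\<lambda>u. of_bool (z \<le> x + u)) 0 + B x * (srw ^^ n) (\<lambda>u. of_bool (x + u \<le> z)) 0)"
    by (simp only: srw_funpow_sum srw_funpow_add srw_funpow_cmult)
  also have "\<dots> = (\<Sum>x\<in>?W. cross_start y z n x)"
  proof (rule sum.cong[OF refl])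
    fix x
    show "A x * (srw ^^ n) (\<lambda>u. of_bool (z \<le> x + u)) 0 + B x * (srw ^^ n) (\<lambda>u. of_bool (x + u \<le> z)) 0 = cross_start y z n x"
      using srw_funpow_translate[of n "\<lambda>b. of_bool (z \<le> b)" x 0] srw_funpow_translate[of n "\<lambda>b. of_bool (b \<le> z)" x 0]
      by (simp add: cross_start_def A_def B_def)
  qed
  finally show ?thesis .
qed

lemma sum_cross_prob_ge:
  assumes z: "\<bar>z - y\<bar> \<le> int n"
  shows "((srw ^^ n) (dist_from (real_of_int (z - y))) 0 - 1) / 2
     \<le> (\<Sum>k\<in>{y - 2 * int n - int s..y + 2 * int n + int s}. cross_prob y z s n k)"
proof -
  have "cross_start y z n x = 0" if x: "x \<notin> {y - 2 * int n..y + 2 * int n}" for x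
  proof -
    have "(srw ^^ n) (\<lambda>b. of_bool (z \<le> b)) x = (0::real)" if "x < y"
      using that x z by (intro srw_funpow_eq_0) auto
    moreover have "(srw ^^ n) (\<lambda>b. of_bool (b \<le> z)) x = (0::real)" if "y < x"
      using that x z by (intro srw_funpow_eq_0) auto
    ultimately show ?thesis by (auto simp: cross_start_def)
  qed
  then show ?thesis
    using sum_cross_start_ge[OF z] unfolding cross_prob_eq by (subst sum_srw_funpow) auto
qed

lemma cos_power_tendsto:
  fixes \<theta> :: real
  shows "(\<lambda>n. cos (\<theta> / sqrt (real n)) ^ n) \<longlonglongrightarrow> exp (- \<theta>\<^sup>2 / 2)"
proof -
  have pos: "(\<lambda>n. cos (a / sqrt (real n)) ^ n) \<longlonglongrightarrow> exp (- (a * a / 2))" if "0 < a" for a :: real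
    using that by real_asymp
  consider "\<theta> = 0" | "0 < \<theta>" | "0 < - \<theta>" by linarith
  then show ?thesis
    using pos[of \<theta>] pos[of "- \<theta>"] by cases (simp_all add: power2_eq_square)
qed

lemma one_minus_cos_le: "1 - cos x \<le> \<bar>x::real\<bar>"
proof -
  have "1 - cos x = 2 * \<bar>sin (x / 2)\<bar> * \<bar>sin (x / 2)\<bar>"
    using cos_double_sin[of "x / 2"] by (simp add: power2_eq_square)
  also have "\<dots> \<le> 2 * \<bar>sin (x / 2)\<bar> * 1" by (intro mult_left_mono) auto
  also have "\<dots> \<le> \<bar>x\<bar>" using abs_sin_x_le_abs_x[of "x / 2"] by simp
  finally show ?thesis .
qed

text \<open>Since \<open>1 - cos x \<le> \<bar>x\<bar>\<close>, the mean of \<open>\<bar>u - a\<bar>\<close> is bounded below by that of an eigenfunction;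
the frequency \<open>1 / sqrt n\<close> makes the eigenvalue after \<open>n\<close> steps close to \<open>exp (- 1 / 2)\<close>.\<close>

lemma srw_mean_distance_ge:
  "\<forall>\<^sub>F n in sequentially. \<forall>a. sqrt (real n) / 4 \<le> (srw ^^ n) (dist_from a) 0"
proof -
  have "exp (- 1\<^sup>2 / 2) < (3 / 4 :: real)"
  proof -
    have "1 + 1 / 2 \<le> exp (1 / 2 :: real)" by (rule exp_ge_add_one_self)
    then show ?thesis by (simp add: exp_minus field_simps)
  qed
  then have "\<forall>\<^sub>F n in sequentially. cos (1 / sqrt (real n)) ^ n < 3 / 4"
    by (rule order_tendstoD(2)[OF cos_power_tendsto])
  then show ?thesis using eventually_ge_at_top[of 1]
  proof eventually_elim
    case (elim n)
    define \<theta> where "\<theta> = 1 / sqrt (real n)"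
    have \<theta>: "0 < \<theta>" "\<theta> \<le> 1" using elim by (auto simp: \<theta>_def)
    then have "0 \<le> cos \<theta>" using pi_ge_two by (intro cos_ge_zero) auto
    then have cn: "0 \<le> cos \<theta> ^ n" by simp
    show ?case
    proof
      fix a :: real
      have "1 / 4 \<le> 1 - cos \<theta> ^ n * cos (\<theta> * (real_of_int 0 - a))"
      proof -
        have "cos \<theta> ^ n * cos (\<theta> * (real_of_int 0 - a)) \<le> cos \<theta> ^ n * 1"
          using cn by (intro mult_left_mono) auto
        then show ?thesis using elim by (simp add: \<theta>_def)
      qed
      also have "\<dots> = (srw ^^ n) (\<lambda>u. 1 + (-1) * cos (\<theta> * (real_of_int u - a))) 0"
        unfolding srw_funpow_add srw_funpow_cmult srw_funpow_const srw_funpow_cos by simp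
      also have "\<dots> \<le> (srw ^^ n) (\<lambda>u. \<theta> * \<bar>real_of_int u - a\<bar>) 0"
      proof (rule srw_funpow_mono)
        fix u
        show "1 + (-1) * cos (\<theta> * (real_of_int u - a)) \<le> \<theta> * \<bar>real_of_int u - a\<bar>"
          using one_minus_cos_le[of "\<theta> * (real_of_int u - a)"] \<theta> by (simp add: abs_mult)
      qed
      also have "\<dots> = (srw ^^ n) (dist_from a) 0 / sqrt (real n)"
        unfolding srw_funpow_cmult by (simp add: \<theta>_def)
      finally show "sqrt (real n) / 4 \<le> (srw ^^ n) (dist_from a) 0"
        using elim by (simp add: field_simps)
    qed
  qed
qed

lemma prob_lone_le:
  assumes "\<And>a. sqrt (real n) / 4 \<le> (srw ^^ n) (dist_from a) 0"
  shows "cfg.prob {c \<in> space config_measure. lone (env c) n s y} \<le> real (2 * n + 1) * exp (1 / 2 - sqrt (real n) / 8)"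
proof -
  let ?W = "{y - 2 * int n - int s..y + 2 * int n + int s}"
  let ?E = "\<lambda>z. {c. \<forall>w\<in>walkers c. fst w \<in> ?W \<longrightarrow> \<not> crosses y z s n (fst w) (snd c w)}"
  have E: "?E z \<in> sets config_measure" for z by (rule prob_uncrossed) simp
  have "cfg.prob {c \<in> space config_measure. lone (env c) n s y} \<le> cfg.prob (\<Union>z\<in>{y - int n..y + int n}. ?E z)"
  proof (rule cfg.finite_measure_mono)
    show "{c \<in> space config_measure. lone (env c) n s y} \<subseteq> (\<Union>z\<in>{y - int n..y + int n}. ?E z)"
    proof
      fix c assume "c \<in> {c \<in> space config_measure. lone (env c) n s y}"
      then have "lone (env c) n s y" by simp
      from lone_imp_uncrossed[OF this] show "c \<in> (\<Union>z\<in>{y - int n..y + int n}. ?E z)" by blast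
    qed
  qed (use E in auto)
  also have "\<dots> \<le> (\<Sum>z\<in>{y - int n..y + int n}. cfg.prob (?E z))"
    using E by (intro cfg.finite_measure_subadditive_finite) auto
  also have "\<dots> \<le> (\<Sum>z\<in>{y - int n..y + int n}. exp (1 / 2 - sqrt (real n) / 8))"
  proof (rule sum_mono)
    fix z assume "z \<in> {y - int n..y + int n}"
    then have "\<bar>z - y\<bar> \<le> int n" by auto
    have "(sqrt (real n) / 4 - 1) / 2 \<le> ((srw ^^ n) (dist_from (real_of_int (z - y))) 0 - 1) / 2"
      by (intro divide_right_mono diff_right_mono assms) simp
    also have "\<dots> \<le> (\<Sum>k\<in>?W. cross_prob y z s n k)"
      by (rule sum_cross_prob_ge) fact
    finally have "- (\<Sum>k\<in>?W. cross_prob y z s n k) \<le> 1 / 2 - sqrt (real n) / 8"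
      by (simp add: field_simps)
    then show "cfg.prob (?E z) \<le> exp (1 / 2 - sqrt (real n) / 8)"
      by (subst prob_uncrossed) auto
  qed
  also have "\<dots> = real (2 * n + 1) * exp (1 / 2 - sqrt (real n) / 8)" by simp
  finally show ?thesis .
qed

lemma prob_ex_lone_le:
  assumes "\<And>a. sqrt (real n) / 4 \<le> (srw ^^ n) (dist_from a) 0"
  shows "cfg.prob {c \<in> space config_measure. \<exists>y\<in>{-int s..int s}. lone (env c) n s y}
    \<le> real (2 * s + 1) * (real (2 * n + 1) * exp (1 / 2 - sqrt (real n) / 8))"
proof -
  have m: "{c \<in> space config_measure. lone (env c) n s y} \<in> sets config_measure" for y by measurable
  have "{c \<in> space config_measure. \<exists>y\<in>{-int s..int s}. lone (env c) n s y} = (\<Union>y\<in>{-int s..int s}. {c \<in> space config_measure. lone (env c) n s y})"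
    by auto
  then have "cfg.prob {c \<in> space config_measure. \<exists>y\<in>{-int s..int s}. lone (env c) n s y}
     \<le> (\<Sum>y\<in>{-int s..int s}. cfg.prob {c \<in> space config_measure. lone (env c) n s y})"
    using m by (simp only:) (intro cfg.finite_measure_subadditive_finite; auto)
  also have "\<dots> \<le> (\<Sum>y\<in>{-int s..int s}. real (2 * n + 1) * exp (1 / 2 - sqrt (real n) / 8))"
    by (intro sum_mono prob_lone_le assms)
  also have "\<dots> = real (2 * s + 1) * (real (2 * n + 1) * exp (1 / 2 - sqrt (real n) / 8))" by simp
  finally show ?thesis .
qed

section \<open>A maximal inequality\<close>

text \<open>If the origin is occupied, this is the conditional expectation of the average of \<open>f\<close> at time \<open>T\<close>,
given the environment before time \<open>t\<close>.\<close>

definition mart :: "nat \<Rightarrow> (int \<Rightarrow> real) \<Rightarrow> config \<Rightarrow> nat \<Rightarrow> real" where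
  "mart T f c t = avg (env c) t ((srw ^^ (T - t)) f)"

definition incr :: "nat \<Rightarrow> (int \<Rightarrow> real) \<Rightarrow> config \<Rightarrow> nat \<Rightarrow> real" where
  "incr T f c t = (\<Sum>y\<in>{-int t..int t}. mass (env c) t y * grad ((srw ^^ (T - Suc t)) f) y * drift c t y)"

lemma mart_Suc:
  assumes "0 < fst c 0" "t < T"
  shows "mart T f c (Suc t) = mart T f c t + incr T f c t"
proof -
  have "T - t = Suc (T - Suc t)" using assms by simp
  then have "(srw ^^ (T - t)) f = srw ((srw ^^ (T - Suc t)) f)" by simp
  then show ?thesis
    unfolding mart_def incr_def avg_step[OF assms(1)] unfolding avg_def sum.distrib[symmetric]
    by (intro sum.cong refl) (simp add: algebra_simps)
qed

text \<open>The transition operator commutes with the difference operator and does not increase the supremum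
norm.\<close>

lemma abs_grad_srw_le:
  assumes "\<And>y. \<bar>grad f y\<bar> \<le> L"
  shows "\<bar>grad ((srw ^^ n) f) y\<bar> \<le> L"
proof -
  have "grad ((srw ^^ n) f) = (srw ^^ n) (grad f)"
  proof (induction n)
    case (Suc n)
    have "grad (srw h) = srw (grad h)" for h by (simp add: fun_eq_iff grad_def srw_def field_simps)
    then show ?case using Suc by simp
  qed simp
  then show ?thesis using srw_funpow_bounded[of "grad f" L n y, OF assms] by simp
qed

lemma measurable_incr [measurable]: "observable (\<lambda>c. incr T f c t)"
  unfolding incr_def by measurable

lemma measurable_mart [measurable]: "observable (\<lambda>c. mart T f c t)"
  unfolding mart_def by (rule measurable_avg_env)

lemma agree_incr: "agree (Suc t) c c' \<Longrightarrow> incr T f c t = incr T f c' t"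
  by (simp add: incr_def agree_drift agree_mass[OF agree_le])

lemma agree_mart: "agree t c c' \<Longrightarrow> mart T f c t = mart T f c' t"
  by (simp add: mart_def agree_avg)

lemma abs_incr_le:
  assumes "\<And>y. \<bar>grad f y\<bar> \<le> L"
  shows "\<bar>incr T f c t\<bar> \<le> L"
proof -
  have "incr T f c t = avg (env c) t (\<lambda>y. grad ((srw ^^ (T - Suc t)) f) y * drift c t y)"
    by (simp add: incr_def avg_def mult.assoc)
  also have "\<bar>\<dots>\<bar> \<le> L"
  proof (rule abs_avg_le)
    fix y
    have "0 \<le> L" using assms[of 0] by simp
    then show "\<bar>grad ((srw ^^ (T - Suc t)) f) y * drift c t y\<bar> \<le> L"
      using mult_mono[OF abs_grad_srw_le[OF assms, of "T - Suc t" y] abs_drift_le[of c t y]] by (simp add: abs_mult)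
  qed
  finally show ?thesis .
qed

lemma expectation_adapted_incr:
  assumes Zm [measurable]: "observable Z" and B: "\<And>c. \<bar>Z c\<bar> \<le> B" and Z: "adapted t Z"
  shows "expect (\<lambda>c. Z c * incr T f c t) = 0"
proof -
  define g where "g y = grad ((srw ^^ (T - Suc t)) f) y" for y
  define H where "H y c = Z c * (mass (env c) t y * g y)" for y c
  have B0: "0 \<le> B" using B[of "(\<lambda>_. 0, \<lambda>_ _. 0)"] by simp
  have Hm [measurable]: "observable (H y)" for y
    unfolding H_def[abs_def] by measurable
  have Hb: "\<bar>H y c\<bar> \<le> B * \<bar>g y\<bar>" for y c
  proof -
    have "\<bar>mass (env c) t y * g y\<bar> \<le> 1 * \<bar>g y\<bar>"
      unfolding abs_mult by (intro mult_right_mono) (auto simp: mass_le_1)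
    from mult_mono[OF B[of c] this] B0 show ?thesis by (simp add: H_def abs_mult)
  qed
  have Ha: "adapted t (H y)" for y
    by (auto simp: adapted_def H_def adaptedD[OF Z] agree_mass)
  have "expect (\<lambda>c. Z c * incr T f c t) = expect (\<lambda>c. (\<Sum>y\<in>{-int t..int t}. H y c * drift c t y))"
    by (simp add: incr_def H_def g_def sum_distrib_left mult.assoc)
  also have "\<dots> = (\<Sum>y\<in>{-int t..int t}. expect (\<lambda>c. H y c * drift c t y))"
  proof (rule Bochner_Integration.integral_sum)
    fix y
    have "\<bar>H y c * drift c t y\<bar> \<le> B * \<bar>g y\<bar>" for c
      using mult_mono[OF Hb[of y c] abs_drift_le[of c t y]] B0 by (simp add: abs_mult)
    then show "integrable config_measure (\<lambda>c. H y c * drift c t y)"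
      by (rule integrable_config[rotated]) measurable
  qed
  also have "\<dots> = 0" by (simp add: expectation_adapted_drift[OF Hm Hb Ha])
  finally show ?thesis .
qed

text \<open>By orthogonality of the drifts at different sites, only the squares of the masses
remain.\<close>

lemma expectation_adapted_incr_square_le:
  assumes Zm [measurable]: "observable Z" and Z0: "\<And>c. 0 \<le> Z c" and Zo: "\<And>c. Z c \<le> occupied c"
    and Z: "adapted t Z" and L: "\<And>y. \<bar>grad f y\<bar> \<le> L"
  shows "expect (\<lambda>c. Z c * (incr T f c t)\<^sup>2) \<le> L\<^sup>2 * mean_collisions t"
proof -
  let ?W = "{-int t..int t}"
  define g where "g y = grad ((srw ^^ (T - Suc t)) f) y" for y
  have g: "\<bar>g y\<bar> \<le> L" for y unfolding g_def by (rule abs_grad_srw_le[OF L])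
  have L0: "0 \<le> L" using g[of 0] by simp
  have Z1: "\<bar>Z c\<bar> \<le> 1" for c using Z0[of c] Zo[of c] occupied_bounds(2)[of c] by simp
  define H where "H y z c = Z c * ((mass (env c) t y * g y) * (mass (env c) t z * g z))" for y z c
  have Hm [measurable]: "observable (H y z)" for y z
    unfolding H_def[abs_def] by measurable
  have mg: "\<bar>mass (env c) t y * g y\<bar> \<le> 1 * L" for c y
    unfolding abs_mult by (intro mult_mono g) (auto simp: mass_le_1)
  have Hb: "\<bar>H y z c\<bar> \<le> L * L" for y z c
    using mult_mono[OF Z1[of c] mult_mono[OF mg[of c y] mg[of c z]]] L0 by (simp add: H_def abs_mult)
  have Ha: "adapted t (H y z)" for y z
    by (auto simp: adapted_def H_def adaptedD[OF Z] agree_mass)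
  have Hv: "integrable config_measure (\<lambda>c. H y y c / real (vis c t y))" for y
  proof (rule integrable_config)
    fix c
    have "\<bar>1 / real (vis c t y)\<bar> \<le> 1"
      by (cases "vis c t y") (auto simp: divide_le_eq)
    from mult_mono[OF Hb[of y y c] this] L0
    show "\<bar>H y y c / real (vis c t y)\<bar> \<le> L * L" by (simp add: abs_mult)
  qed measurable
  have "expect (\<lambda>c. Z c * (incr T f c t)\<^sup>2) = expect (\<lambda>c. (\<Sum>y\<in>?W. \<Sum>z\<in>?W. H y z c * (drift c t y * drift c t z)))"
  proof (rule Bochner_Integration.integral_cong[OF refl])
    fix c
    show "Z c * (incr T f c t)\<^sup>2 = (\<Sum>y\<in>?W. \<Sum>z\<in>?W. H y z c * (drift c t y * drift c t z))"
      unfolding incr_def power2_eq_square sum_product unfolding sum_distrib_left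
      by (intro sum.cong refl) (simp add: H_def g_def)
  qed
  also have "\<dots> = (\<Sum>y\<in>?W. \<Sum>z\<in>?W. expect (\<lambda>c. H y z c * (drift c t y * drift c t z)))"
  proof -
    have "integrable config_measure (\<lambda>c. H y z c * (drift c t y * drift c t z))" for y z
    proof (rule integrable_config)
      show "\<bar>H y z c * (drift c t y * drift c t z)\<bar> \<le> L * L" for c
        using mult_mono[OF Hb[of y z c] mult_mono[OF abs_drift_le[of c t y] abs_drift_le[of c t z]]] L0 by (simp add: abs_mult)
    qed measurable
    then show ?thesis
      by (simp only: Bochner_Integration.integral_sum Bochner_Integration.integrable_sum)
  qed
  also have "\<dots> = (\<Sum>y\<in>?W. \<Sum>z\<in>?W. if y = z then expect (\<lambda>c. H y z c / real (vis c t y)) else 0)"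
    by (simp only: expectation_adapted_drift2[OF Hm Hb Ha])
  also have "\<dots> = (\<Sum>y\<in>?W. expect (\<lambda>c. H y y c / real (vis c t y)))"
    by (intro sum.cong refl) (subst sum.delta', auto)
  also have "\<dots> = expect (\<lambda>c. (\<Sum>y\<in>?W. H y y c / real (vis c t y)))"
    by (rule Bochner_Integration.integral_sum[symmetric]) (rule Hv)
  also have "\<dots> \<le> expect (\<lambda>c. L\<^sup>2 * (occupied c * mass2 (env c) t (\<lambda>_. 1)))"
  proof (rule integral_mono)
    show "integrable config_measure (\<lambda>c. \<Sum>y\<in>?W. H y y c / real (vis c t y))"
      by (rule Bochner_Integration.integrable_sum) (rule Hv)
    have "\<bar>occupied c * mass2 (env c) t (\<lambda>_. 1)\<bar> \<le> 1" for c
      using mass2_le_1[of "\<lambda>_. 1" "env c" t] mass2_nonneg[of "\<lambda>_. 1" "env c" t] by (simp add: occupied_def)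
    then show "integrable config_measure (\<lambda>c. L\<^sup>2 * (occupied c * mass2 (env c) t (\<lambda>_. 1)))"
      by (intro integrable_mult_right integrable_config[of "\<lambda>c. occupied c * mass2 (env c) t (\<lambda>_. 1)" 1]) measurable
    fix c
    show "(\<Sum>y\<in>?W. H y y c / real (vis c t y)) \<le> L\<^sup>2 * (occupied c * mass2 (env c) t (\<lambda>_. 1))"
      unfolding mass2_def sum_distrib_left
    proof (rule sum_mono)
      fix y
      have gg: "(g y)\<^sup>2 \<le> L\<^sup>2" using power_mono[OF g[of y], of 2] by simp
      have "H y y c / real (vis c t y) \<le> H y y c"
      proof -
        have "0 \<le> H y y c" using Z0[of c] by (simp add: H_def)
        then show ?thesis by (cases "vis c t y") (auto simp: divide_le_eq mult_le_cancel_left1)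
      qed
      also have "H y y c = Z c * ((mass (env c) t y)\<^sup>2 * (g y)\<^sup>2)" by (simp add: H_def power2_eq_square)
      also have "\<dots> \<le> occupied c * ((mass (env c) t y)\<^sup>2 * L\<^sup>2)"
        using Zo[of c] gg by (intro mult_mono mult_left_mono) (auto simp: occupied_bounds)
      finally show "H y y c / real (vis c t y) \<le> L\<^sup>2 * (occupied c * ((mass (env c) t y)\<^sup>2 * 1))"
        by (simp add: mult_ac)
    qed
  qed
  finally show ?thesis by simp
qed

definition alive :: "nat \<Rightarrow> (int \<Rightarrow> real) \<Rightarrow> real \<Rightarrow> config \<Rightarrow> nat \<Rightarrow> real" where
  "alive T f a c t = of_bool (0 < fst c 0 \<and> (\<forall>s\<le>t. \<bar>mart T f c s - mart T f c 0\<bar> < a))"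

text \<open>The martingale, centred at its initial value and stopped when it leaves the interval of
radius \<open>a\<close>.\<close>

definition stopped :: "nat \<Rightarrow> (int \<Rightarrow> real) \<Rightarrow> real \<Rightarrow> config \<Rightarrow> nat \<Rightarrow> real" where
  "stopped T f a c t = (\<Sum>s<t. alive T f a c s * incr T f c s)"

lemma measurable_alive [measurable]: "observable (\<lambda>c. alive T f a c t)"
  unfolding alive_def by measurable

lemma measurable_stopped [measurable]: "observable (\<lambda>c. stopped T f a c t)"
  unfolding stopped_def by measurable

lemma adapted_alive: "adapted t (\<lambda>c. alive T f a c t)"
proof -
  have "alive T f a c t = alive T f a c' t" if "agree t c c'" for c c'
  proof -
    have "mart T f c s = mart T f c' s" if "s \<le> t" for s
      by (rule agree_mart[OF agree_le[OF \<open>agree t c c'\<close> that]])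
    moreover have "fst c = fst c'" using that by (simp add: agree_def)
    ultimately show ?thesis by (simp add: alive_def)
  qed
  then show ?thesis by (auto simp: adapted_def)
qed

lemma adapted_stopped: "adapted t (\<lambda>c. stopped T f a c t)"
proof -
  have "stopped T f a c t = stopped T f a c' t" if "agree t c c'" for c c'
    unfolding stopped_def
  proof (rule sum.cong[OF refl])
    fix s assume "s \<in> {..<t}"
    then have s: "s < t" by simp
    have "alive T f a c s = alive T f a c' s"
      using adaptedD[OF adapted_alive agree_le[OF that]] s by auto
    moreover have "incr T f c s = incr T f c' s"
      by (rule agree_incr[OF agree_le[OF that]]) (use s in simp)
    ultimately show "alive T f a c s * incr T f c s = alive T f a c' s * incr T f c' s" by simp
  qed
  then show ?thesis by (auto simp: adapted_def)
qed

lemma alive_bounds: "0 \<le> alive T f a c t" "alive T f a c t \<le> occupied c" "\<bar>alive T f a c t\<bar> \<le> 1"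
  "(alive T f a c t)\<^sup>2 = alive T f a c t"
  by (simp_all add: alive_def occupied_def)

lemma abs_stopped_le:
  assumes "\<And>y. \<bar>grad f y\<bar> \<le> L"
  shows "\<bar>stopped T f a c t\<bar> \<le> real t * L"
proof -
  have "\<bar>stopped T f a c t\<bar> \<le> (\<Sum>s<t. 1 * L)"
    unfolding stopped_def
    by (rule order_trans[OF sum_abs]) (unfold abs_mult, intro sum_mono mult_mono alive_bounds(3) abs_incr_le assms, auto)
  then show ?thesis by simp
qed

lemma expectation_stopped_square_le:
  assumes L: "\<And>y. \<bar>grad f y\<bar> \<le> L"
  shows "expect (\<lambda>c. (stopped T f a c t)\<^sup>2) \<le> L\<^sup>2 * (\<Sum>s<t. mean_collisions s)"
proof (induction t)
  case 0
  then show ?case by (simp add: stopped_def)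
next
  case (Suc t)
  let ?S = "\<lambda>c. stopped T f a c t" and ?A = "\<lambda>c. alive T f a c t" and ?I = "\<lambda>c. incr T f c t"
  have L0: "0 \<le> L" using L[of 0] by simp
  have S: "\<bar>?S c\<bar> \<le> real t * L" for c by (rule abs_stopped_le[OF L])
  have I: "\<bar>?I c\<bar> \<le> L" for c by (rule abs_incr_le[OF L])
  have SA: "\<bar>?S c * ?A c\<bar> \<le> real t * L" for c
    using mult_mono[OF S[of c] alive_bounds(3)[of T f a c t]] L0 by (simp add: abs_mult)
  have z: "expect (\<lambda>c. (?S c * ?A c) * ?I c) = 0"
  proof (rule expectation_adapted_incr[OF _ SA])
    show "adapted t (\<lambda>c. ?S c * ?A c)"
      using adaptedD[OF adapted_stopped[of t T f a]] adaptedD[OF adapted_alive[of t T f a]]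
      unfolding adapted_def by metis
  qed measurable
  have i1: "integrable config_measure (\<lambda>c. (?S c)\<^sup>2)"
  proof (rule integrable_config)
    show "\<bar>(?S c)\<^sup>2\<bar> \<le> (real t * L)\<^sup>2" for c
      using power_mono[OF S[of c], of 2] by simp
  qed measurable
  have i2: "integrable config_measure (\<lambda>c. (?S c * ?A c) * ?I c)"
  proof (rule integrable_config)
    show "\<bar>(?S c * ?A c) * ?I c\<bar> \<le> real t * L * L" for c
      using mult_mono[OF SA[of c] I[of c]] L0 by (simp add: abs_mult)
  qed measurable
  have i3: "integrable config_measure (\<lambda>c. ?A c * (?I c)\<^sup>2)"
  proof (rule integrable_config)
    show "\<bar>?A c * (?I c)\<^sup>2\<bar> \<le> 1 * L\<^sup>2" for c
      using mult_mono[OF alive_bounds(3)[of T f a c t] power_mono[OF I[of c], of 2]] by (simp add: abs_mult)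
  qed measurable
  have "(stopped T f a c (Suc t))\<^sup>2 = (?S c)\<^sup>2 + 2 * ((?S c * ?A c) * ?I c) + ?A c * (?I c)\<^sup>2" for c
  proof -
    have "(stopped T f a c (Suc t))\<^sup>2 = (?S c + ?A c * ?I c)\<^sup>2" by (simp add: stopped_def)
    also have "\<dots> = (?S c)\<^sup>2 + 2 * ((?S c * ?A c) * ?I c) + (?A c)\<^sup>2 * (?I c)\<^sup>2"
      by (simp add: power2_eq_square algebra_simps)
    finally show ?thesis by (simp only: alive_bounds(4))
  qed
  then have "expect (\<lambda>c. (stopped T f a c (Suc t))\<^sup>2)
     = expect (\<lambda>c. (?S c)\<^sup>2 + 2 * ((?S c * ?A c) * ?I c) + ?A c * (?I c)\<^sup>2)" by simp
  also have "\<dots> = expect (\<lambda>c. (?S c)\<^sup>2) + 2 * expect (\<lambda>c. (?S c * ?A c) * ?I c) + expect (\<lambda>c. ?A c * (?I c)\<^sup>2)"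
    by (simp only: Bochner_Integration.integral_add[OF Bochner_Integration.integrable_add[OF i1 integrable_mult_right[OF i2]] i3]
      Bochner_Integration.integral_add[OF i1 integrable_mult_right[OF i2]] Bochner_Integration.integral_mult_right[OF i2])
  also have "\<dots> = expect (\<lambda>c. (?S c)\<^sup>2) + expect (\<lambda>c. ?A c * (?I c)\<^sup>2)"
    using z by simp
  also have "\<dots> \<le> L\<^sup>2 * (\<Sum>s<t. mean_collisions s) + L\<^sup>2 * mean_collisions t"
    by (intro add_mono Suc.IH expectation_adapted_incr_square_le[OF measurable_alive alive_bounds(1,2) adapted_alive L])
  finally show ?case by (simp add: distrib_left)
qed

lemma stopped_at_exit:
  assumes "0 < fst c 0" "t \<le> T" "a \<le> \<bar>mart T f c t - mart T f c 0\<bar>"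
  shows "a \<le> \<bar>stopped T f a c T\<bar>"
proof -
  define P where "P s \<longleftrightarrow> a \<le> \<bar>mart T f c s - mart T f c 0\<bar>" for s
  define m where "m = (LEAST s. P s)"
  have Pm: "P m" using assms(3) unfolding m_def by (intro LeastI[of P t]) (simp add: P_def)
  have mt: "m \<le> T" using assms unfolding m_def by (intro order_trans[OF Least_le[of P t]]) (auto simp: P_def)
  have less: "\<not> P s" if "s < m" for s using that unfolding m_def by (rule not_less_Least)
  have alive: "alive T f a c s = of_bool (s < m)" for s
  proof (cases "s < m")
    case True
    have "\<bar>mart T f c r - mart T f c 0\<bar> < a" if "r \<le> s" for r
      using less[of r] True that by (auto simp: P_def)
    then show ?thesis using True assms(1) by (auto simp: alive_def)
  next
    case False
    then have "\<exists>r\<le>s. \<not> \<bar>mart T f c r - mart T f c 0\<bar> < a"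
      using Pm by (intro exI[of _ m]) (auto simp: P_def)
    then have "\<not> (\<forall>r\<le>s. \<bar>mart T f c r - mart T f c 0\<bar> < a)" by blast
    then show ?thesis using False by (simp only: alive_def simp_thms of_bool_eq)
  qed
  have "stopped T f a c T = (\<Sum>s<T. if s < m then incr T f c s else 0)"
    unfolding stopped_def by (intro sum.cong refl) (auto simp: alive)
  also have "\<dots> = (\<Sum>s<m. incr T f c s)"
    using mt by (intro sum.mono_neutral_cong_right) auto
  also have "\<dots> = mart T f c m - mart T f c 0"
  proof -
    have "n \<le> T \<Longrightarrow> (\<Sum>s<n. incr T f c s) = mart T f c n - mart T f c 0" for n
      by (induction n) (auto simp: mart_Suc[OF assms(1)])
    then show ?thesis using mt by blast
  qed
  finally show ?thesis using Pm by (simp add: P_def)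
qed

text \<open>Kolmogorov's inequality: on the event in question the stopped martingale has absolute value
at least \<open>a\<close> at time \<open>T\<close>.\<close>

lemma maximal_inequality:
  assumes L: "\<And>y. \<bar>grad f y\<bar> \<le> L" and a: "0 < a"
  shows "cfg.prob {c \<in> space config_measure. 0 < fst c 0 \<and> (\<exists>t\<le>T. a \<le> \<bar>mart T f c t - mart T f c 0\<bar>)}
     \<le> L\<^sup>2 / a\<^sup>2 * (\<Sum>s<T. mean_collisions s)"
proof -
  have i: "integrable config_measure (\<lambda>c. (stopped T f a c T)\<^sup>2)"
  proof (rule integrable_config)
    show "\<bar>(stopped T f a c T)\<^sup>2\<bar> \<le> (real T * L)\<^sup>2" for c
      using power_mono[OF abs_stopped_le[OF L, of T a c T], of 2] by simp
  qed measurable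
  have "cfg.prob {c \<in> space config_measure. 0 < fst c 0 \<and> (\<exists>t\<le>T. a \<le> \<bar>mart T f c t - mart T f c 0\<bar>)}
    \<le> cfg.prob {c \<in> space config_measure. a\<^sup>2 \<le> (stopped T f a c T)\<^sup>2}"
  proof (rule cfg.finite_measure_mono)
    show "{c \<in> space config_measure. 0 < fst c 0 \<and> (\<exists>t\<le>T. a \<le> \<bar>mart T f c t - mart T f c 0\<bar>)}
       \<subseteq> {c \<in> space config_measure. a\<^sup>2 \<le> (stopped T f a c T)\<^sup>2}"
    proof
      fix c assume "c \<in> {c \<in> space config_measure. 0 < fst c 0 \<and> (\<exists>t\<le>T. a \<le> \<bar>mart T f c t - mart T f c 0\<bar>)}"
      then obtain t where "0 < fst c 0" "t \<le> T" "a \<le> \<bar>mart T f c t - mart T f c 0\<bar>" by blast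
      from stopped_at_exit[OF this] have "a\<^sup>2 \<le> (stopped T f a c T)\<^sup>2"
        using power_mono[of a "\<bar>stopped T f a c T\<bar>" 2] a by simp
      then show "c \<in> {c \<in> space config_measure. a\<^sup>2 \<le> (stopped T f a c T)\<^sup>2}" by simp
    qed
  qed measurable
  also have "\<dots> \<le> expect (\<lambda>c. (stopped T f a c T)\<^sup>2) / a\<^sup>2"
    using a by (intro integral_Markov_inequality_measure[OF i, where A = "{}"]) auto
  also have "\<dots> \<le> (L\<^sup>2 * (\<Sum>s<T. mean_collisions s)) / a\<^sup>2"
    by (intro divide_right_mono expectation_stopped_square_le L) auto
  finally show ?thesis by simp
qed

section \<open>Almost sure convergence of averages of test functions\<close>

abbreviation (input) gauss :: "real measure" where
  "gauss \<equiv> std_normal_distribution"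

abbreviation scaled :: "(real \<Rightarrow> real) \<Rightarrow> nat \<Rightarrow> int \<Rightarrow> real" where
  "scaled \<phi> T y \<equiv> \<phi> (real_of_int y / sqrt (real T))"

abbreviation oscillation :: "(real \<Rightarrow> real) \<Rightarrow> config \<Rightarrow> nat \<Rightarrow> nat \<Rightarrow> real" where
  "oscillation \<phi> c m t \<equiv> \<bar>mart (m ^ 8) (scaled \<phi> (m ^ 8)) c t - mart (m ^ 8) (scaled \<phi> (m ^ 8)) c 0\<bar>"

text \<open>The choice of the scales: time \<open>m ^ 8\<close> and lone runs of \<open>m^2\<close> steps. The first term on the right
is of order \<open>m ^ 6\<close> and the second one decays exponentially. Division by \<open>m ^ 8\<close> leaves a summable
sequence.\<close>

lemma sum_expectation_mass2_block:
  assumes "\<And>a. sqrt (real (m\<^sup>2)) / 4 \<le> (srw ^^ (m\<^sup>2)) (dist_from a) 0"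
  shows "(\<Sum>s<m ^ 8. mean_collisions s)
    \<le> (real m ^ 2 + 1) * (4 * sqrt (real m ^ 8 + real m ^ 2))
      + real m ^ 8 * ((2 * real m ^ 8 + 1) * ((2 * real m ^ 2 + 1) * exp (1 / 2 - real m / 8)))"
proof -
  have "(\<Sum>s<m ^ 8. cfg.prob {c \<in> space config_measure. \<exists>y\<in>{-int s..int s}. lone (env c) (m\<^sup>2) s y})
    \<le> (\<Sum>s<m ^ 8. (2 * real m ^ 8 + 1) * ((2 * real m ^ 2 + 1) * exp (1 / 2 - real m / 8)))"
  proof (rule sum_mono)
    fix s assume s: "s \<in> {..<m ^ 8}"
    have "cfg.prob {c \<in> space config_measure. \<exists>y\<in>{-int s..int s}. lone (env c) (m\<^sup>2) s y}
      \<le> real (2 * s + 1) * (real (2 * m\<^sup>2 + 1) * exp (1 / 2 - sqrt (real (m\<^sup>2)) / 8))"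
      by (rule prob_ex_lone_le[OF assms])
    also have "\<dots> \<le> real (2 * m ^ 8 + 1) * (real (2 * m\<^sup>2 + 1) * exp (1 / 2 - sqrt (real (m\<^sup>2)) / 8))"
      using s by (intro mult_right_mono) (auto simp del: of_nat_power)
    finally show "cfg.prob {c \<in> space config_measure. \<exists>y\<in>{-int s..int s}. lone (env c) (m\<^sup>2) s y}
      \<le> (2 * real m ^ 8 + 1) * ((2 * real m ^ 2 + 1) * exp (1 / 2 - real m / 8))"
      by (simp add: add.commute)
  qed
  then show ?thesis
    using sum_expectation_mass2[of "m ^ 8" "m\<^sup>2"] by (simp add: add.commute)
qed

lemma grad_scaled_le:
  assumes lip: "\<And>x y. \<bar>\<phi> x - \<phi> y\<bar> \<le> L * \<bar>x - y\<bar>"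
  shows "\<bar>grad (scaled \<phi> T) y\<bar> \<le> L / sqrt (real T)"
proof -
  have "\<bar>scaled \<phi> T (y + 1) - scaled \<phi> T (y - 1)\<bar> \<le> L * \<bar>real_of_int (y + 1) / sqrt (real T) - real_of_int (y - 1) / sqrt (real T)\<bar>"
    by (rule lip)
  also have "real_of_int (y + 1) / sqrt (real T) - real_of_int (y - 1) / sqrt (real T) = 2 / sqrt (real T)"
    by (simp add: diff_divide_distrib[symmetric])
  finally show ?thesis by (simp add: grad_def)
qed

lemma AE_mart_oscillation:
  assumes lip: "\<And>x y. \<bar>\<phi> x - \<phi> y\<bar> \<le> L * \<bar>x - y\<bar>" and a: "0 < a"
  shows "AE c in config_measure. 0 < fst c 0 \<longrightarrow>
    (\<forall>\<^sub>F m in sequentially. \<forall>t\<le>m ^ 8. oscillation \<phi> c m t < a)"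
proof -
  define bad where "bad m = {c \<in> space config_measure. 0 < fst c 0 \<and>
    (\<exists>t\<le>m ^ 8. a \<le> oscillation \<phi> c m t)}" for m
  define b where "b m = ((real m ^ 2 + 1) * (4 * sqrt (real m ^ 8 + real m ^ 2))
      + real m ^ 8 * ((2 * real m ^ 8 + 1) * ((2 * real m ^ 2 + 1) * exp (1 / 2 - real m / 8)))) / real m ^ 8" for m :: nat
  have "filterlim (\<lambda>m::nat. m\<^sup>2) at_top sequentially"
    by (rule filterlim_at_top_mono[OF filterlim_ident]) (auto simp: power2_eq_square eventually_sequentially)
  from filterlim_iff[THEN iffD1, OF this, rule_format, OF srw_mean_distance_ge]
  have "\<forall>\<^sub>F m in sequentially. norm (cfg.prob (bad m)) \<le> L\<^sup>2 / a\<^sup>2 * b m"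
    using eventually_ge_at_top[of 1]
  proof eventually_elim
    case (elim m)
    have "cfg.prob (bad m) \<le> (L / sqrt (real (m ^ 8)))\<^sup>2 / a\<^sup>2 * (\<Sum>s<m ^ 8. mean_collisions s)"
      unfolding bad_def by (rule maximal_inequality[OF grad_scaled_le[OF lip] a])
    also have "\<dots> \<le> (L / sqrt (real (m ^ 8)))\<^sup>2 / a\<^sup>2 * (b m * real m ^ 8)"
      using elim sum_expectation_mass2_block[of m]
      by (intro mult_left_mono) (auto simp: b_def)
    also have "\<dots> = L\<^sup>2 / a\<^sup>2 * b m"
      using elim by (simp add: power_divide field_simps)
    finally show ?case by simp
  qed
  moreover have "summable (\<lambda>m. L\<^sup>2 / a\<^sup>2 * b m)"
  proof (rule summable_mult, rule summable_comparison_test_bigo)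
    show "summable (\<lambda>m. norm (1 / real m ^ 2))"
      using inverse_power_summable[of 2, where 'a = real] by (simp add: field_simps)
    show "b \<in> O(\<lambda>m. 1 / real m ^ 2)"
      unfolding b_def by real_asymp
  qed
  ultimately have "summable (\<lambda>m. cfg.prob (bad m))"
    by (rule summable_comparison_test_ev)
  moreover have "bad m \<in> sets config_measure" for m
    unfolding bad_def by measurable
  ultimately have "AE c in config_measure. \<forall>\<^sub>F m in sequentially. c \<in> space config_measure - bad m"
    by (intro borel_cantelli_AE1) (auto simp: cfg.emeasure_eq_measure)
  then show ?thesis
  proof (rule AE_mp, intro AE_I2 impI)
    fix c assume ev: "\<forall>\<^sub>F m in sequentially. c \<in> space config_measure - bad m" and c: "0 < fst c 0"
    show "\<forall>\<^sub>F m in sequentially. \<forall>t\<le>m ^ 8. oscillation \<phi> c m t < a"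
      using ev
    proof eventually_elim
      case (elim m)
      then have "\<not> (\<exists>t\<le>m ^ 8. a \<le> oscillation \<phi> c m t)"
        using c unfolding bad_def by blast
      then show ?case by (meson not_le)
    qed
  qed
qed

lemma srw_funpow_lipschitz:
  assumes "\<And>u v. \<bar>f u - f v\<bar> \<le> K * \<bar>real_of_int (u - v)\<bar>"
  shows "\<bar>(srw ^^ n) f x - f x\<bar> \<le> K * sqrt (real n)"
proof -
  have K: "0 \<le> K" using assms[of 1 0] by simp
  have eq: "(srw ^^ n) f x - f x = (srw ^^ n) (\<lambda>u. f (x + u) + - f x) 0"
    unfolding srw_funpow_add srw_funpow_const using srw_funpow_translate[of n f x 0] by simp
  have "(srw ^^ n) (\<lambda>u. f (x + u) + - f x) 0 \<le> (srw ^^ n) (\<lambda>u. K * \<bar>real_of_int u\<bar>) 0"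
    by (rule srw_funpow_mono) (use assms[of "x + _" x] in \<open>auto simp: abs_le_iff\<close>)
  moreover have "(srw ^^ n) (\<lambda>u. (- K) * \<bar>real_of_int u\<bar>) 0 \<le> (srw ^^ n) (\<lambda>u. f (x + u) + - f x) 0"
  proof (rule srw_funpow_mono)
    fix u
    show "- K * \<bar>real_of_int u\<bar> \<le> f (x + u) + - f x"
      using assms[of "x + u" x] by (simp add: abs_le_iff)
  qed
  moreover have "K * (srw ^^ n) (\<lambda>u. \<bar>real_of_int u\<bar>) 0 \<le> K * sqrt (real n)"
    by (intro mult_left_mono srw_funpow_abs_le K)
  ultimately show ?thesis unfolding eq srw_funpow_cmult by (simp add: abs_le_iff)
qed

text \<open>The characteristic function of \<open>n\<close> steps of the walk, scaled by \<open>sqrt n\<close>, is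
\<open>cos (t / sqrt n) ^ n\<close>.\<close>

lemma srw_central_limit:
  assumes cont: "\<And>x. isCont \<phi> x" and bnd: "\<And>x. \<bar>\<phi> x\<bar> \<le> B"
  shows "(\<lambda>n. (srw ^^ n) (scaled \<phi> n) 0) \<longlonglongrightarrow> integral\<^sup>L gauss \<phi>"
proof -
  let ?w = "(0::int, 0::nat)"
  define X where "X n c = real_of_int (pos c n ?w) / sqrt (real n)" for n c
  have Xm [measurable]: "observable (X n)" for n
    unfolding X_def[abs_def] by measurable
  define \<nu> where "\<nu> n = distr config_measure borel (X n)" for n
  have \<nu>: "real_distribution (\<nu> n)" for n
    unfolding \<nu>_def by (rule cfg.real_distribution_distr) measurable
  have exp_bdd: "expect (\<lambda>c. g (X n c)) = (srw ^^ n) (scaled g n) 0" if "\<And>x. \<bar>g x\<bar> \<le> C" for g :: "real \<Rightarrow> real" and C n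
    using expectation_pos[of "scaled g n" C n ?w] that by (simp add: X_def)
  have "weak_conv_m \<nu> gauss"
  proof (rule levy_continuity[OF \<nu> real_dist_normal_dist])
    fix t :: real
    have "char (\<nu> n) t = complex_of_real (cos (t / sqrt (real n)) ^ n)" for n
    proof -
      let ?\<theta> = "t / sqrt (real n)"
      have c: "expect (\<lambda>c. cos (t * X n c)) = cos ?\<theta> ^ n"
        using exp_bdd[of "\<lambda>x. cos (t * x)" 1 n] srw_funpow_cos[of n ?\<theta> 0 0] by simp
      have s: "expect (\<lambda>c. sin (t * X n c)) = 0"
      proof (cases "?\<theta> = 0")
        case False
        \<comment> \<open>The shift by a quarter period turns the sine into a cosine.\<close>
        define a where "a = pi / 2 / ?\<theta>"
        have \<theta>a: "?\<theta> * a = pi / 2" using False by (simp add: a_def)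
        have "sin (?\<theta> * real_of_int u) = cos (?\<theta> * (real_of_int u - a))" for u
          unfolding right_diff_distrib \<theta>a by (simp add: cos_diff)
        then have "(srw ^^ n) (\<lambda>u. sin (t * (real_of_int u / sqrt (real n)))) 0 = (srw ^^ n) (\<lambda>u. cos (?\<theta> * (real_of_int u - a))) 0"
          by (intro arg_cong[where f = "\<lambda>h. (srw ^^ n) h 0"]) (auto simp: field_simps)
        also have "\<dots> = cos ?\<theta> ^ n * cos (?\<theta> * (real_of_int 0 - a))" by (rule srw_funpow_cos)
        also have "\<dots> = 0" unfolding right_diff_distrib \<theta>a by simp
        finally show ?thesis using exp_bdd[of "\<lambda>x. sin (t * x)" 1 n] by simp
      qed (use exp_bdd[of "\<lambda>x. sin (t * x)" 1 n] in \<open>auto simp: X_def\<close>)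
      have ic: "integrable config_measure (\<lambda>c. cos (t * X n c))" "integrable config_measure (\<lambda>c. sin (t * X n c))"
        by (rule integrable_config[where B = 1]; simp)+
      have "char (\<nu> n) t = (\<integral>c. iexp (t * X n c) \<partial>config_measure)"
        unfolding char_def \<nu>_def by (rule integral_distr) measurable
      also have "\<dots> = (\<integral>c. complex_of_real (cos (t * X n c)) + \<i> * complex_of_real (sin (t * X n c)) \<partial>config_measure)"
        by (intro Bochner_Integration.integral_cong refl) (simp add: exp_Euler cos_of_real sin_of_real del: of_real_mult)
      also have "\<dots> = complex_of_real (expect (\<lambda>c. cos (t * X n c))) + \<i> * complex_of_real (expect (\<lambda>c. sin (t * X n c)))"
        using ic by (subst Bochner_Integration.integral_add) (auto simp: integral_complex_of_real)
      finally show ?thesis by (simp add: c s)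
    qed
    then show "(\<lambda>n. char (\<nu> n) t) \<longlonglongrightarrow> char gauss t"
      using tendsto_of_real[OF cos_power_tendsto[of t], where 'a = complex]
      by (simp add: char_std_normal_distribution)
  qed
  then have "(\<lambda>n. integral\<^sup>L (\<nu> n) \<phi>) \<longlonglongrightarrow> integral\<^sup>L gauss \<phi>"
    using cont bnd by (intro weak_conv_imp_integral_bdd_continuous_conv[where B = B] \<nu> real_dist_normal_dist) auto
  moreover have "integral\<^sup>L (\<nu> n) \<phi> = (srw ^^ n) (scaled \<phi> n) 0" for n
  proof -
    have "\<phi> \<in> borel_measurable borel"
      by (intro borel_measurable_continuous_onI continuous_at_imp_continuous_on) (use cont in auto)
    then have "integral\<^sup>L (\<nu> n) \<phi> = expect (\<lambda>c. \<phi> (X n c))"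
      unfolding \<nu>_def by (intro integral_distr) measurable
    then show ?thesis using exp_bdd[of \<phi> B n, OF bnd] by simp
  qed
  ultimately show ?thesis by simp
qed

text \<open>Scaling changes arguments by a small factor only. On the support of \<open>\<phi>\<close> this is a small
change of the argument, uniformly.\<close>

lemma scaled_change:
  assumes lip: "\<And>x y. \<bar>\<phi> x - \<phi> y\<bar> \<le> L * \<bar>x - y\<bar>" and supp: "\<And>x. R < \<bar>x\<bar> \<Longrightarrow> \<phi> x = 0"
    and R: "0 \<le> R" and t: "0 < t" "t \<le> T"
  shows "\<bar>scaled \<phi> t y - scaled \<phi> T y\<bar> \<le> L * R * (sqrt (real T / real t) - 1)"
proof -
  define x where "x = real_of_int y"
  have L: "0 \<le> L" using lip[of 1 0] by simp
  have st: "0 < sqrt (real t)" "sqrt (real t) \<le> sqrt (real T)" using t by auto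
  then have sT: "0 < sqrt (real T)" by linarith
  have r1: "1 \<le> sqrt (real T / real t)" using t by simp
  show ?thesis
  proof (cases "\<bar>x\<bar> \<le> R * sqrt (real T)")
    case True
    have "\<bar>scaled \<phi> t y - scaled \<phi> T y\<bar> \<le> L * \<bar>x / sqrt (real t) - x / sqrt (real T)\<bar>"
      unfolding x_def by (rule lip)
    also have "\<bar>x / sqrt (real t) - x / sqrt (real T)\<bar> = \<bar>x\<bar> * (1 / sqrt (real t) - 1 / sqrt (real T))"
    proof -
      have "x / sqrt (real t) - x / sqrt (real T) = x * (1 / sqrt (real t) - 1 / sqrt (real T))" by (simp add: algebra_simps)
      moreover have "0 \<le> 1 / sqrt (real t) - 1 / sqrt (real T)" using st by (simp add: frac_le)
      ultimately show ?thesis by (simp add: abs_mult)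
    qed
    also have "\<dots> \<le> (R * sqrt (real T)) * (1 / sqrt (real t) - 1 / sqrt (real T))"
      using st by (intro mult_right_mono True) (simp add: frac_le)
    also have "\<dots> = R * (sqrt (real T / real t) - 1)"
      using st sT by (simp add: real_sqrt_divide field_simps)
    finally show ?thesis using L by (simp add: mult_left_mono mult.assoc)
  next
    case False
    then have "R < \<bar>x / sqrt (real T)\<bar>" using sT by (simp add: field_simps)
    moreover have "\<bar>x / sqrt (real T)\<bar> \<le> \<bar>x / sqrt (real t)\<bar>" using st by (simp add: frac_le)
    ultimately have "\<phi> (x / sqrt (real T)) = 0" "\<phi> (x / sqrt (real t)) = 0" using supp by auto
    moreover have "0 \<le> L * R * (sqrt (real T / real t) - 1)" using L R r1 by simp
    ultimately show ?thesis by (simp add: x_def)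
  qed
qed

lemma avg_diff_le:
  assumes "\<And>y. \<bar>h y - h' y\<bar> \<le> B"
  shows "\<bar>avg \<omega> t h - avg \<omega> t h'\<bar> \<le> B"
proof -
  have "avg \<omega> t h - avg \<omega> t h' = avg \<omega> t (\<lambda>y. h y - h' y)"
    by (simp add: avg_def sum_subtractf[symmetric] algebra_simps)
  then show ?thesis using abs_avg_le[of t "\<lambda>y. h y - h' y" B \<omega>] assms by simp
qed

text \<open>For \<open>t\<close> between \<open>(m - 1) ^ 8\<close> and \<open>m ^ 8\<close>, four errors are added: from replacing the scale
\<open>sqrt t\<close> by that of \<open>m ^ 8\<close>, from letting the simple random walk run from \<open>t\<close> to \<open>m ^ 8\<close>, from the
oscillation of the martingale, and from the central limit theorem for the simple random walk at
time \<open>m ^ 8\<close>.\<close>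

lemma avg_tendsto:
  assumes lip: "\<And>x y. \<bar>\<phi> x - \<phi> y\<bar> \<le> L * \<bar>x - y\<bar>" and supp: "\<And>x. R < \<bar>x\<bar> \<Longrightarrow> \<phi> x = 0" and R: "0 \<le> R"
    and bnd: "\<And>x. \<bar>\<phi> x\<bar> \<le> B"
    and osc: "\<And>a. 0 < a \<Longrightarrow> \<exists>a'. 0 < a' \<and> a' \<le> a \<and> (\<forall>\<^sub>F m in sequentially. \<forall>t\<le>m ^ 8. oscillation \<phi> c m t < a')"
  shows "(\<lambda>t. avg (env c) t (scaled \<phi> t)) \<longlonglongrightarrow> integral\<^sup>L gauss \<phi>"
proof -
  let ?I = "integral\<^sup>L gauss \<phi>"
  define M where "M m t = mart (m ^ 8) (scaled \<phi> (m ^ 8)) c t" for m t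
  define E where "E m = L * R * (sqrt (real m ^ 8 / (real m - 1) ^ 8) - 1) + L * (sqrt (real m ^ 8 - (real m - 1) ^ 8) / sqrt (real m ^ 8)) + \<bar>M m 0 - ?I\<bar>" for m :: nat
  have L: "0 \<le> L" using lip[of 1 0] by simp
  have cont: "isCont \<phi> x" for x
  proof -
    have "L-lipschitz_on UNIV \<phi>" by (intro lipschitz_onI) (auto simp: dist_real_def lip L)
    then show ?thesis using lipschitz_on_continuous_on continuous_on_eq_continuous_at open_UNIV by blast
  qed
  have key: "\<bar>avg (env c) t (scaled \<phi> t) - ?I\<bar> \<le> E m + \<bar>M m t - M m 0\<bar>"
    if m: "2 \<le> m" "(m - 1) ^ 8 < t" "t \<le> m ^ 8" for m t
  proof -
    have t0: "0 < t" using m(2) by simp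
    have mt: "(real m - 1) ^ 8 \<le> real t"
    proof -
      have "real ((m - 1) ^ 8) \<le> real t" using m(2) by (intro of_nat_mono) simp
      then show ?thesis using m(1) by (simp add: of_nat_diff)
    qed
    have m1: "0 < (real m - 1) ^ 8" using m(1) by simp
    have 1: "\<bar>avg (env c) t (scaled \<phi> t) - avg (env c) t (scaled \<phi> (m ^ 8))\<bar> \<le> L * R * (sqrt (real m ^ 8 / (real m - 1) ^ 8) - 1)"
    proof (rule avg_diff_le)
      fix y
      have "\<bar>scaled \<phi> t y - scaled \<phi> (m ^ 8) y\<bar> \<le> L * R * (sqrt (real (m ^ 8) / real t) - 1)"
        by (rule scaled_change[OF lip supp R t0 m(3)])
      also have "\<dots> \<le> L * R * (sqrt (real m ^ 8 / (real m - 1) ^ 8) - 1)"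
        using mt m1 L R t0 by (intro mult_left_mono diff_right_mono) (auto intro!: frac_le)
      finally show "\<bar>scaled \<phi> t y - scaled \<phi> (m ^ 8) y\<bar> \<le> L * R * (sqrt (real m ^ 8 / (real m - 1) ^ 8) - 1)" .
    qed
    have 2: "\<bar>avg (env c) t (scaled \<phi> (m ^ 8)) - M m t\<bar> \<le> L * (sqrt (real m ^ 8 - (real m - 1) ^ 8) / sqrt (real m ^ 8))"
      unfolding M_def mart_def
    proof (rule avg_diff_le)
      fix y
      have "\<bar>(srw ^^ (m ^ 8 - t)) (scaled \<phi> (m ^ 8)) y - scaled \<phi> (m ^ 8) y\<bar> \<le> (L / sqrt (real (m ^ 8))) * sqrt (real (m ^ 8 - t))"
      proof (rule srw_funpow_lipschitz)
        fix u v
        have "\<bar>scaled \<phi> (m ^ 8) u - scaled \<phi> (m ^ 8) v\<bar> \<le> L * \<bar>real_of_int u / sqrt (real (m ^ 8)) - real_of_int v / sqrt (real (m ^ 8))\<bar>"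
          by (rule lip)
        also have "\<dots> = L / sqrt (real (m ^ 8)) * \<bar>real_of_int (u - v)\<bar>"
          by (simp add: diff_divide_distrib[symmetric] abs_divide)
        finally show "\<bar>scaled \<phi> (m ^ 8) u - scaled \<phi> (m ^ 8) v\<bar> \<le> L / sqrt (real (m ^ 8)) * \<bar>real_of_int (u - v)\<bar>" .
      qed
      also have "\<dots> \<le> (L / sqrt (real (m ^ 8))) * sqrt (real m ^ 8 - (real m - 1) ^ 8)"
        using mt m(3) L by (intro mult_left_mono) (auto simp: of_nat_diff)
      finally show "\<bar>scaled \<phi> (m ^ 8) y - (srw ^^ (m ^ 8 - t)) (scaled \<phi> (m ^ 8)) y\<bar> \<le> L * (sqrt (real m ^ 8 - (real m - 1) ^ 8) / sqrt (real m ^ 8))"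
        by (simp add: abs_minus_commute)
    qed
    show ?thesis using 1 2 unfolding E_def by linarith
  qed
  have E: "E \<longlonglongrightarrow> 0"
  proof -
    have e1: "(\<lambda>m::nat. sqrt (real m ^ 8 / (real m - 1) ^ 8) - 1) \<longlonglongrightarrow> 0" by real_asymp
    have e2: "(\<lambda>m::nat. sqrt (real m ^ 8 - (real m - 1) ^ 8) / sqrt (real m ^ 8)) \<longlonglongrightarrow> 0" by real_asymp
    have pw: "filterlim (\<lambda>m::nat. m ^ 8) at_top sequentially"
      by (rule filterlim_at_top_mono[OF filterlim_ident]) (auto simp: eventually_sequentially intro!: exI[of _ 1] self_le_power)
    have "(\<lambda>m. M m 0) \<longlonglongrightarrow> ?I"
      using filterlim_compose[OF srw_central_limit[OF cont bnd] pw] by (simp add: M_def mart_def avg_def)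
    then have "(\<lambda>m. \<bar>M m 0 - ?I\<bar>) \<longlonglongrightarrow> 0"
      by (simp add: LIM_zero tendsto_rabs_zero)
    then have "(\<lambda>m. L * R * (sqrt (real m ^ 8 / (real m - 1) ^ 8) - 1) + L * (sqrt (real m ^ 8 - (real m - 1) ^ 8) / sqrt (real m ^ 8)) + \<bar>M m 0 - ?I\<bar>) \<longlonglongrightarrow> L * R * 0 + L * 0 + 0"
      by (intro tendsto_add tendsto_mult tendsto_const e1 e2)
    then show ?thesis by (simp add: E_def[abs_def])
  qed
  show ?thesis
  proof (rule LIMSEQ_I)
    fix r :: real assume r: "0 < r"
    from osc[of "r / 2"] r obtain a' where a': "0 < a'" "a' \<le> r / 2" and ev: "\<forall>\<^sub>F m in sequentially. \<forall>t\<le>m ^ 8. \<bar>M m t - M m 0\<bar> < a'"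
      unfolding M_def by auto
    have "\<forall>\<^sub>F m in sequentially. E m < r / 2"
      using order_tendstoD(2)[OF E, of "r / 2"] r by simp
    with ev have "\<forall>\<^sub>F m in sequentially. E m < r / 2 \<and> (\<forall>t\<le>m ^ 8. \<bar>M m t - M m 0\<bar> < a')"
      by eventually_elim simp
    then obtain m0 where m0: "\<And>m. m0 \<le> m \<Longrightarrow> E m < r / 2 \<and> (\<forall>t\<le>m ^ 8. \<bar>M m t - M m 0\<bar> < a')"
      by (auto simp: eventually_sequentially)
    show "\<exists>t0. \<forall>t\<ge>t0. norm (avg (env c) t (scaled \<phi> t) - ?I) < r"
    proof (intro exI allI impI)
      fix t assume t: "(m0 + 2) ^ 8 \<le> t"
      \<comment> \<open>The block that contains t.\<close>
      define m where "m = (LEAST m. t \<le> m ^ 8)"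
      have ex: "t \<le> t ^ 8" by (cases "t = 0") (auto intro: self_le_power)
      have m3: "t \<le> m ^ 8" unfolding m_def by (rule LeastI[of "\<lambda>m. t \<le> m ^ 8", OF ex])
      have "(m0 + 2) ^ 8 \<le> m ^ 8" using t m3 by (rule order_trans)
      then have m1: "m0 + 2 \<le> m" by (simp add: power_mono_iff)
      have "\<not> t \<le> (m - 1) ^ 8" unfolding m_def using m1 by (intro not_less_Least) (auto simp: m_def[symmetric])
      then have m2: "(m - 1) ^ 8 < t" by simp
      have "\<bar>avg (env c) t (scaled \<phi> t) - ?I\<bar> \<le> E m + \<bar>M m t - M m 0\<bar>"
        using m1 m2 m3 by (intro key) auto
      also have "\<dots> < r / 2 + a'" using m0[of m] m1 m3 by (intro add_strict_mono) auto
      also have "\<dots> \<le> r" using a' by simp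
      finally show "norm (avg (env c) t (scaled \<phi> t) - ?I) < r" by simp
    qed
  qed
qed

lemma AE_avg_tendsto:
  assumes lip: "\<And>x y. \<bar>\<phi> x - \<phi> y\<bar> \<le> L * \<bar>x - y\<bar>" and supp: "\<And>x. R < \<bar>x\<bar> \<Longrightarrow> \<phi> x = 0" and R: "0 \<le> R"
    and bnd: "\<And>x. \<bar>\<phi> x\<bar> \<le> B"
  shows "AE c in config_measure. 0 < fst c 0 \<longrightarrow> (\<lambda>t. avg (env c) t (scaled \<phi> t)) \<longlonglongrightarrow> integral\<^sup>L gauss \<phi>"
proof -
  have "AE c in config_measure. \<forall>j. 0 < fst c 0 \<longrightarrow>
    (\<forall>\<^sub>F m in sequentially. \<forall>t\<le>m ^ 8. oscillation \<phi> c m t < 1 / real (Suc j))"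
    unfolding AE_all_countable by (intro allI AE_mart_oscillation[OF lip]) auto
  then show ?thesis
  proof (rule AE_mp, intro AE_I2 impI)
    fix c assume ev: "\<forall>j. 0 < fst c 0 \<longrightarrow>
      (\<forall>\<^sub>F m in sequentially. \<forall>t\<le>m ^ 8. oscillation \<phi> c m t < 1 / real (Suc j))"
      and c: "0 < fst c 0"
    show "(\<lambda>t. avg (env c) t (scaled \<phi> t)) \<longlonglongrightarrow> integral\<^sup>L gauss \<phi>"
    proof (rule avg_tendsto[OF lip supp R bnd])
      fix a :: real assume "0 < a"
      then obtain j where "1 / real (Suc j) < a" using reals_Archimedean[of a] by (auto simp: inverse_eq_divide)
      then show "\<exists>a'. 0 < a' \<and> a' \<le> a \<and> (\<forall>\<^sub>F m in sequentially. \<forall>t\<le>m ^ 8. oscillation \<phi> c m t < a')"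
        using ev c by (intro exI[of _ "1 / real (Suc j)"]) auto
    qed
  qed
qed

section \<open>From test functions to distribution functions\<close>

definition trapezoid :: "real \<Rightarrow> real \<Rightarrow> nat \<Rightarrow> real \<Rightarrow> real" where
  "trapezoid a b k x = max 0 (min 1 (real k * min (x - a) (b - x)))"

lemma trapezoid_bounds: "0 \<le> trapezoid a b k x" "trapezoid a b k x \<le> 1" "\<bar>trapezoid a b k x\<bar> \<le> 1"
  by (auto simp: trapezoid_def)

lemma trapezoid_eq_0: "x \<le> a \<or> b \<le> x \<Longrightarrow> trapezoid a b k x = 0"
  by (auto simp: trapezoid_def mult_le_0_iff min_le_iff_disj)

lemma trapezoid_eq_1: "1 \<le> real k * \<delta> \<Longrightarrow> a \<le> x - \<delta> \<Longrightarrow> x + \<delta> \<le> b \<Longrightarrow> trapezoid a b k x = 1"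
proof -
  assume a: "1 \<le> real k * \<delta>" "a \<le> x - \<delta>" "x + \<delta> \<le> b"
  have "real k * \<delta> \<le> real k * min (x - a) (b - x)" using a by (intro mult_left_mono) auto
  then show ?thesis using a by (simp add: trapezoid_def)
qed

lemma trapezoid_lipschitz: "\<bar>trapezoid a b k x - trapezoid a b k y\<bar> \<le> real k * \<bar>x - y\<bar>"
proof -
  have "\<bar>trapezoid a b k x - trapezoid a b k y\<bar> \<le> \<bar>real k * min (x - a) (b - x) - real k * min (y - a) (b - y)\<bar>"
    unfolding trapezoid_def by (auto simp: max_def min_def)
  also have "\<dots> = real k * \<bar>min (x - a) (b - x) - min (y - a) (b - y)\<bar>"
    by (simp add: right_diff_distrib[symmetric] abs_mult)
  also have "\<dots> \<le> real k * \<bar>x - y\<bar>" by (intro mult_left_mono) (auto simp: min_def)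
  finally show ?thesis .
qed

lemma trapezoid_support: "\<bar>a\<bar> + \<bar>b\<bar> < \<bar>x\<bar> \<Longrightarrow> trapezoid a b k x = 0"
  by (rule trapezoid_eq_0) linarith

lemma measurable_trapezoid [measurable]: "trapezoid a b k \<in> borel_measurable borel"
  unfolding trapezoid_def[abs_def] by measurable

lemma cdf_mass_distribution:
  assumes "0 < t"
  shows "cdf (mass_distribution \<omega> t) u = avg \<omega> t (scaled (\<lambda>x. of_bool (x \<le> u)) t)"
proof -
  define g where "g y = ennreal (rescaled_mass \<omega> t y)" for y
  define \<eta> where "\<eta> y = real_of_int y / sqrt (real t)" for y
  have st: "0 < sqrt (real t)" using assms by simp
  have g\<eta>: "g (\<eta> y) = ennreal (mass \<omega> t y)" for y
    using st by (simp add: g_def \<eta>_def rescaled_mass_def)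
  have inj: "inj \<eta>" using st by (auto simp: inj_on_def \<eta>_def)
  have supp: "x \<in> \<eta> ` {-int t..int t}" if "0 < g x" for x
  proof -
    have "sqrt (real t) * x \<in> \<int>" "mass \<omega> t \<lfloor>sqrt (real t) * x\<rfloor> \<noteq> 0"
      using that by (auto simp: g_def rescaled_mass_def split: if_splits)
    then obtain y where y: "sqrt (real t) * x = real_of_int y" "mass \<omega> t y \<noteq> 0"
      by (auto elim!: Ints_cases)
    have "x = \<eta> y" using y(1) st by (simp add: \<eta>_def field_simps)
    moreover have "y \<in> {-int t..int t}"
    proof (rule ccontr)
      assume "y \<notin> {-int t..int t}"
      then have "int t < \<bar>y\<bar>" by auto
      then show False using y(2) mass_outside by blast
    qed
    ultimately show ?thesis by blast
  qed
  have fin: "finite {a \<in> {..u}. 0 < g a}"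
    by (rule finite_subset[of _ "\<eta> ` {-int t..int t}"]) (use supp in auto)
  have "emeasure (mass_distribution \<omega> t) {..u} = emeasure (point_measure UNIV g) {..u}"
    unfolding mass_distribution_def g_def[symmetric]
    by (subst emeasure_distr) (auto simp: measurable_point_measure_eq1 space_point_measure)
  also have "\<dots> = (\<Sum>a | a \<in> {..u} \<and> 0 < g a. g a)"
    by (rule emeasure_point_measure[OF fin]) simp
  also have "\<dots> = (\<Sum>x\<in>\<eta> ` {-int t..int t}. if x \<le> u then g x else 0)"
    using supp by (intro sum.mono_neutral_cong_left) auto
  also have "\<dots> = (\<Sum>y\<in>{-int t..int t}. if \<eta> y \<le> u then g (\<eta> y) else 0)"
    using inj by (subst sum.reindex) (auto intro: inj_on_subset)
  also have "\<dots> = (\<Sum>y\<in>{-int t..int t}. ennreal (mass \<omega> t y * of_bool (\<eta> y \<le> u)))"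
    by (intro sum.cong refl) (auto simp: g\<eta>)
  also have "\<dots> = ennreal (avg \<omega> t (scaled (\<lambda>x. of_bool (x \<le> u)) t))"
    unfolding avg_def \<eta>_def by (rule sum_ennreal) auto
  finally show ?thesis
    by (simp add: cdf_def measure_def avg_def sum_nonneg)
qed

lemma trapezoid_le_cdf:
  assumes "0 < t" "b \<le> u"
  shows "avg \<omega> t (scaled (trapezoid a b k) t) \<le> cdf (mass_distribution \<omega> t) u"
  unfolding cdf_mass_distribution[OF assms(1)]
proof (rule avg_mono)
  fix y
  show "scaled (trapezoid a b k) t y \<le> scaled (\<lambda>x. of_bool (x \<le> u)) t y"
    using trapezoid_bounds(2)[of a b k "real_of_int y / sqrt (real t)"]
      trapezoid_eq_0[of "real_of_int y / sqrt (real t)" a b k] assms(2)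
    by (cases "real_of_int y / sqrt (real t) \<le> u") auto
qed

text \<open>The half-line up to \<open>u\<close> and the trapezoid to the right of \<open>u\<close> share the total mass, which is at
most \<open>1\<close>.\<close>

lemma cdf_le_one_minus_trapezoid:
  assumes "0 < t" "u \<le> a"
  shows "cdf (mass_distribution \<omega> t) u \<le> 1 - avg \<omega> t (scaled (trapezoid a b k) t)"
proof -
  have "avg \<omega> t (scaled (\<lambda>x. of_bool (x \<le> u)) t) + avg \<omega> t (scaled (trapezoid a b k) t)
     = avg \<omega> t (\<lambda>y. scaled (\<lambda>x. of_bool (x \<le> u)) t y + scaled (trapezoid a b k) t y)"
    unfolding avg_def by (simp only: distrib_left sum.distrib)
  also have "\<dots> \<le> avg \<omega> t (\<lambda>_. 1)"
  proof (rule avg_mono)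
    fix y
    show "scaled (\<lambda>x. of_bool (x \<le> u)) t y + scaled (trapezoid a b k) t y \<le> 1"
      using trapezoid_bounds(2)[of a b k "real_of_int y / sqrt (real t)"]
        trapezoid_eq_0[of "real_of_int y / sqrt (real t)" a b k] assms(2)
      by (cases "real_of_int y / sqrt (real t) \<le> u") auto
  qed
  also have "\<dots> \<le> 1" by (rule avg_one_le)
  finally show ?thesis unfolding cdf_mass_distribution[OF assms(1)] by simp
qed

lemma integral_trapezoid_tendsto:
  fixes a b :: "nat \<Rightarrow> real"
  assumes inside: "\<And>x. x \<in> A \<Longrightarrow> \<exists>\<delta>>0. \<forall>\<^sub>F j in sequentially. a j \<le> x - \<delta> \<and> x + \<delta> \<le> b j"
    and outside: "\<And>x j. x \<notin> A \<Longrightarrow> x \<le> a j \<or> b j \<le> x"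
    and A [measurable]: "A \<in> sets borel"
  shows "(\<lambda>j. \<integral>x. trapezoid (a j) (b j) j x \<partial>gauss) \<longlonglongrightarrow> measure gauss A"
proof -
  interpret N: real_distribution gauss by (rule real_dist_normal_dist)
  have "(\<lambda>j. \<integral>x. trapezoid (a j) (b j) j x \<partial>gauss) \<longlonglongrightarrow> (\<integral>x. indicator A x \<partial>gauss)"
  proof (rule integral_dominated_convergence[where w = "\<lambda>_. 1"])
    show "AE x in gauss. (\<lambda>j. trapezoid (a j) (b j) j x) \<longlonglongrightarrow> indicator A x"
    proof (rule AE_I2)
      fix x
      show "(\<lambda>j. trapezoid (a j) (b j) j x) \<longlonglongrightarrow> indicator A x"
      proof (cases "x \<in> A")
        case True
        from inside[OF this] obtain \<delta> where \<delta>: "0 < \<delta>" and ev: "\<forall>\<^sub>F j in sequentially. a j \<le> x - \<delta> \<and> x + \<delta> \<le> b j" by blast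
        have "\<forall>\<^sub>F j in sequentially. 1 / \<delta> \<le> real j"
          using filterlim_real_sequentially unfolding filterlim_at_top by blast
        with ev have "\<forall>\<^sub>F j in sequentially. trapezoid (a j) (b j) j x = 1"
        proof eventually_elim
          case (elim j)
          then show ?case using \<delta> by (intro trapezoid_eq_1[of _ \<delta>]) (auto simp: field_simps)
        qed
        then have "(\<lambda>j. trapezoid (a j) (b j) j x) \<longlonglongrightarrow> 1" by (rule tendsto_eventually)
        then show ?thesis using True by simp
      next
        case False
        then show ?thesis using outside[OF False] by (simp add: trapezoid_eq_0)
      qed
    qed
  qed (auto simp: trapezoid_bounds)
  also have "(\<integral>x. indicator A x \<partial>gauss) = measure gauss A"
    by simp
  finally show ?thesis .
qed

text \<open>Rational corners make this a countable, hence measurable, condition on the environment.\<close>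

definition converges_on_trapezoids :: "environment \<Rightarrow> bool" where
  "converges_on_trapezoids \<omega> \<longleftrightarrow> (\<forall>p q :: rat. \<forall>k. (\<lambda>t. avg \<omega> t (scaled (trapezoid (of_rat p) (of_rat q) k) t))
     \<longlonglongrightarrow> (\<integral>x. trapezoid (of_rat p) (of_rat q) k x \<partial>gauss))"

lemma std_normal_singleton: "measure gauss {u} = 0"
proof -
  have "emeasure gauss {u} = (\<integral>\<^sup>+x. ennreal (std_normal_density x) * indicator {u} x \<partial>lborel)"
    by (rule emeasure_density) auto
  also have "\<dots> = (\<integral>\<^sup>+x. 0 \<partial>(lborel :: real measure))"
  proof (rule nn_integral_cong_AE)
    show "AE x in lborel. ennreal (std_normal_density x) * indicator {u} x = 0"
      using AE_lborel_singleton[of u] by eventually_elim auto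
  qed
  finally show ?thesis by (simp add: measure_def)
qed

text \<open>Trapezoids that converge to the indicators of \<open>{..<u}\<close> and \<open>{u<..}\<close> give lower bounds for the
mass on both sides of \<open>u\<close>. The normal distribution has no atoms, and the two bounds add up to \<open>1\<close>.
In this way no mass can escape to infinity, and tightness need not be proved separately.\<close>

lemma weak_conv_of_trapezoids:
  assumes "converges_on_trapezoids \<omega>"
  shows "weak_conv_m (\<lambda>n. mass_distribution \<omega> (Suc n)) gauss"
  unfolding weak_conv_m_def weak_conv_def
proof (intro allI impI)
  fix u :: real
  interpret N: real_distribution gauss by (rule real_dist_normal_dist)
  let ?F = "\<lambda>n. cdf (mass_distribution \<omega> (Suc n)) u"
  have trap: "(\<lambda>n. avg \<omega> (Suc n) (scaled (trapezoid (of_rat p) (of_rat q) k) (Suc n)))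
      \<longlonglongrightarrow> (\<integral>x. trapezoid (of_rat p) (of_rat q) k x \<partial>gauss)" for p q k
    using assms unfolding converges_on_trapezoids_def by (intro LIMSEQ_Suc) blast
  have small: "\<forall>\<^sub>F j in sequentially. 1 / real (Suc j) < e" if "0 < e" for e
    using order_tendstoD(2)[OF LIMSEQ_inverse_real_of_nat that] by (simp add: inverse_eq_divide)
  have large: "\<forall>\<^sub>F j in sequentially. x \<le> real j" for x
    using filterlim_real_sequentially unfolding filterlim_at_top by blast
  have lower: "\<forall>\<^sub>F n in sequentially. cdf gauss u - e < ?F n" if "0 < e" for e
  proof -
    have "\<forall>j. \<exists>r. u - 1 / real (Suc j) < of_rat r \<and> of_rat r < u"
      by (intro allI of_rat_dense) simp
    from choice[OF this] obtain q where q: "\<And>j. u - 1 / real (Suc j) < of_rat (q j) \<and> of_rat (q j) < u"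
      by blast
    have "(\<lambda>j. \<integral>x. trapezoid (- real j) (of_rat (q j)) j x \<partial>gauss) \<longlonglongrightarrow> measure gauss {..<u}"
    proof (rule integral_trapezoid_tendsto)
      fix x assume "x \<in> {..<u}"
      then have d: "0 < (u - x) / 2" by simp
      have "\<forall>\<^sub>F j in sequentially. - real j \<le> x - (u - x) / 2 \<and> x + (u - x) / 2 \<le> of_rat (q j)"
        using small[OF d] large[of "(u - x) / 2 - x"]
      proof eventually_elim
        case (elim j)
        have margin: "s < (u - x) / 2 \<Longrightarrow> u - s < r \<Longrightarrow> x + (u - x) / 2 \<le> r" for s r :: real
          by (simp add: field_simps)
        have "x + (u - x) / 2 \<le> of_rat (q j)"
          by (rule margin[OF elim(1)]) (use q in blast)
        with elim(2) show ?case by linarith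
      qed
      then show "\<exists>\<delta>>0. \<forall>\<^sub>F j in sequentially. - real j \<le> x - \<delta> \<and> x + \<delta> \<le> of_rat (q j)" using d by blast
    next
      fix x j assume "x \<notin> {..<u}"
      then show "x \<le> - real j \<or> of_rat (q j) \<le> x" using q[of j] by auto
    qed simp
    moreover have "measure gauss {..<u} = cdf gauss u"
    proof -
      have "{..u} = {..<u} \<union> {u}" by auto
      then show ?thesis
        using N.finite_measure_Union[of "{..<u}" "{u}"] std_normal_singleton[of u] by (simp add: cdf_def)
    qed
    ultimately have "\<forall>\<^sub>F j in sequentially. cdf gauss u - e < (\<integral>x. trapezoid (- real j) (of_rat (q j)) j x \<partial>gauss)"
      using that by (intro order_tendstoD(1)) auto
    then obtain j where j: "cdf gauss u - e < (\<integral>x. trapezoid (- real j) (of_rat (q j)) j x \<partial>gauss)"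
      by (auto simp: eventually_sequentially)
    then have "cdf gauss u - e < (\<integral>x. trapezoid (of_rat (- of_nat j)) (of_rat (q j)) j x \<partial>gauss)"
      by (simp add: of_rat_minus)
    from order_tendstoD(1)[OF trap this] show ?thesis
    proof eventually_elim
      case (elim n)
      also have "avg \<omega> (Suc n) (scaled (trapezoid (of_rat (- of_nat j)) (of_rat (q j)) j) (Suc n)) \<le> ?F n"
        using q[of j] by (intro trapezoid_le_cdf) auto
      finally show ?case .
    qed
  qed
  have upper: "\<forall>\<^sub>F n in sequentially. ?F n < cdf gauss u + e" if "0 < e" for e
  proof -
    have "\<forall>j. \<exists>r. u < of_rat r \<and> of_rat r < u + 1 / real (Suc j)"
      by (intro allI of_rat_dense) simp
    from choice[OF this] obtain p where p: "\<And>j. u < of_rat (p j) \<and> of_rat (p j) < u + 1 / real (Suc j)"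
      by blast
    have "(\<lambda>j. \<integral>x. trapezoid (of_rat (p j)) (real j) j x \<partial>gauss) \<longlonglongrightarrow> measure gauss {u<..}"
    proof (rule integral_trapezoid_tendsto)
      fix x assume "x \<in> {u<..}"
      then have d: "0 < (x - u) / 2" by simp
      have "\<forall>\<^sub>F j in sequentially. of_rat (p j) \<le> x - (x - u) / 2 \<and> x + (x - u) / 2 \<le> real j"
        using small[OF d] large[of "x + (x - u) / 2"]
      proof eventually_elim
        case (elim j)
        have margin: "s < (x - u) / 2 \<Longrightarrow> r < u + s \<Longrightarrow> r \<le> x - (x - u) / 2" for s r :: real
          by (simp add: field_simps)
        have "of_rat (p j) \<le> x - (x - u) / 2"
          by (rule margin[OF elim(1)]) (use p in blast)
        with elim(2) show ?case by linarith
      qed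
      then show "\<exists>\<delta>>0. \<forall>\<^sub>F j in sequentially. of_rat (p j) \<le> x - \<delta> \<and> x + \<delta> \<le> real j" using d by blast
    next
      fix x j assume "x \<notin> {u<..}"
      then show "x \<le> of_rat (p j) \<or> real j \<le> x" using p[of j] by auto
    qed simp
    moreover have "measure gauss {u<..} = 1 - cdf gauss u"
    proof -
      have "{u<..} = space gauss - {..u}" by auto
      then show ?thesis using N.prob_compl[of "{..u}"] by (simp add: cdf_def)
    qed
    ultimately have "\<forall>\<^sub>F j in sequentially. 1 - cdf gauss u - e < (\<integral>x. trapezoid (of_rat (p j)) (real j) j x \<partial>gauss)"
      using that by (intro order_tendstoD(1)) auto
    then obtain j where j: "1 - cdf gauss u - e < (\<integral>x. trapezoid (of_rat (p j)) (real j) j x \<partial>gauss)"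
      by (auto simp: eventually_sequentially)
    then have "1 - cdf gauss u - e < (\<integral>x. trapezoid (of_rat (p j)) (of_rat (of_nat j)) j x \<partial>gauss)"
      by simp
    from order_tendstoD(1)[OF trap this] show ?thesis
    proof eventually_elim
      case (elim n)
      have "?F n \<le> 1 - avg \<omega> (Suc n) (scaled (trapezoid (of_rat (p j)) (of_rat (of_nat j)) j) (Suc n))"
        using p[of j] by (intro cdf_le_one_minus_trapezoid) auto
      with elim show ?case by linarith
    qed
  qed
  show "?F \<longlonglongrightarrow> cdf gauss u"
  proof (rule LIMSEQ_I)
    fix r :: real assume "0 < r"
    from eventually_conj[OF lower[OF this] upper[OF this]]
    obtain n0 where "\<forall>n\<ge>n0. cdf gauss u - r < ?F n \<and> ?F n < cdf gauss u + r"
      by (auto simp: eventually_sequentially)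
    then show "\<exists>n0. \<forall>n\<ge>n0. norm (?F n - cdf gauss u) < r"
      by (intro exI[of _ n0]) (auto simp: abs_less_iff)
  qed
qed

lemma LIMSEQ_iff_inverse:
  fixes X :: "nat \<Rightarrow> real"
  shows "X \<longlonglongrightarrow> l \<longleftrightarrow> (\<forall>j. \<exists>n0. \<forall>n. n0 \<le> n \<longrightarrow> \<bar>X n - l\<bar> < inverse (real (Suc j)))"
proof
  assume "X \<longlonglongrightarrow> l"
  then show "\<forall>j. \<exists>n0. \<forall>n. n0 \<le> n \<longrightarrow> \<bar>X n - l\<bar> < inverse (real (Suc j))"
    using LIMSEQ_D[of X l] by (auto simp: real_norm_def)
next
  assume *: "\<forall>j. \<exists>n0. \<forall>n. n0 \<le> n \<longrightarrow> \<bar>X n - l\<bar> < inverse (real (Suc j))"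
  show "X \<longlonglongrightarrow> l"
  proof (rule LIMSEQ_I)
    fix r :: real assume "0 < r"
    then obtain j where j: "inverse (real (Suc j)) < r" using reals_Archimedean by blast
    from * obtain n0 where "\<forall>n. n0 \<le> n \<longrightarrow> \<bar>X n - l\<bar> < inverse (real (Suc j))" by blast
    then show "\<exists>n0. \<forall>n\<ge>n0. norm (X n - l) < r" using j by (intro exI[of _ n0]) force
  qed
qed

lemma measurable_converges_on_trapezoids [measurable]:
  "Measurable.pred environment_space converges_on_trapezoids"
  unfolding converges_on_trapezoids_def[abs_def] LIMSEQ_iff_inverse by measurable

lemma AE_converges_on_trapezoids:
  "AE c in config_measure. 0 < fst c 0 \<longrightarrow> converges_on_trapezoids (env c)"
proof -
  have "AE c in config_measure. \<forall>p q :: rat. \<forall>k. 0 < fst c 0 \<longrightarrow> (\<lambda>t. avg (env c) t (scaled (trapezoid (of_rat p) (of_rat q) k) t))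
     \<longlonglongrightarrow> (\<integral>x. trapezoid (of_rat p) (of_rat q) k x \<partial>gauss)"
    unfolding AE_all_countable
    by (intro allI AE_avg_tendsto[OF trapezoid_lipschitz trapezoid_support _ trapezoid_bounds(3)]) auto
  then show ?thesis
    by (rule AE_mp) (auto simp: converges_on_trapezoids_def)
qed

section \<open>The quenched central limit theorem\<close>

lemma AE_signed_eq: "AE c in config_measure. signed c = c"
proof -
  interpret A: prob_space counts_measure by (rule prob_space_counts_measure)
  interpret B: prob_space paths_measure by (rule prob_space_paths_measure)
  have distr_snd: "distr config_measure paths_measure snd = paths_measure"
  proof (rule measure_eqI)
    fix X assume "X \<in> sets (distr config_measure paths_measure snd)"
    then have X: "X \<in> sets paths_measure" by simp
    then have "emeasure (distr config_measure paths_measure snd) X = emeasure config_measure (snd -` X \<inter> space config_measure)"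
      by (intro emeasure_distr) (auto simp: config_measure_eq)
    also have "snd -` X \<inter> space config_measure = UNIV \<times> X" by auto
    also have "emeasure config_measure \<dots> = emeasure counts_measure UNIV * emeasure paths_measure X"
      using X sets.top[of counts_measure] unfolding config_measure_eq by (intro B.emeasure_pair_measure_Times) auto
    also have "\<dots> = emeasure paths_measure X" using A.emeasure_space_1 by simp
    finally show "emeasure (distr config_measure paths_measure snd) X = emeasure paths_measure X" .
  qed simp
  have "AE c in config_measure. snd c w s \<in> {-1, 1}" for w s
  proof -
    have "AE x in coin. x \<in> {-1, 1}" by (simp add: AE_measure_pmf_iff)
    then have "AE q in path_measure. q s \<in> {-1, 1}"
      by (intro AE_PiM_component[where i = s and M = "\<lambda>_. coin"] measure_pmf.prob_space_axioms) auto
    then have "AE x in paths_measure. x w s \<in> {-1, 1}"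
      by (intro AE_PiM_component[where i = w and M = "\<lambda>_. path_measure"] prob_space_path_measure) auto
    then have "AE x in distr config_measure paths_measure snd. x w s \<in> {-1, 1}"
      unfolding distr_snd .
    then show ?thesis
      by (rule AE_distrD[rotated]) (simp add: config_measure_eq)
  qed
  then have "AE c in config_measure. \<forall>w s. snd c w s \<in> {-1, 1}"
    unfolding AE_all_countable by blast
  then show ?thesis
  proof (rule AE_mp, intro AE_I2 impI)
    fix c :: config assume "\<forall>w s. snd c w s \<in> {-1, 1}"
    then have "(\<lambda>w s. sg (snd c w s)) = snd c" by (intro ext) (force simp: sg_def)
    then show "signed c = c" by (simp add: signed_def)
  qed
qed

theorem corollary1:
  shows "AE \<omega> in env_law_tilde. weak_conv_m (\<lambda>n. mass_distribution \<omega> (Suc n)) std_normal_distribution"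
proof -
  have "AE c in config_measure. 0 < visits (environment_of c) 0 0 \<longrightarrow> converges_on_trapezoids (environment_of c)"
    using AE_converges_on_trapezoids AE_signed_eq
  proof eventually_elim
    case (elim c)
    have "visits (env c) (int 0) 0 = card (occ c 0 0)" by (rule visits_env)
    moreover have "occ c 0 0 = {} " if "fst c 0 = 0" using that by (auto simp: occ_def walkers_def)
    ultimately show ?case using elim by (cases "fst c 0 = 0") auto
  qed
  moreover have "{\<omega> \<in> space environment_space. 0 < visits \<omega> 0 0 \<longrightarrow> converges_on_trapezoids \<omega>} \<in> sets environment_space"
    by measurable
  ultimately have "AE \<omega> in env_law. 0 < visits \<omega> 0 0 \<longrightarrow> converges_on_trapezoids \<omega>"
    unfolding env_law_def by (subst AE_distr_iff[OF measurable_environment_of]) auto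
  then have "AE \<omega> in env_law_tilde. converges_on_trapezoids \<omega>"
    unfolding env_law_tilde_def
    by (subst AE_density) (auto simp: env_law_def ennreal_of_nat_eq_real_of_nat)
  then show ?thesis
    by (rule AE_mp) (intro AE_I2 impI weak_conv_of_trapezoids)
qed

end
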